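(* Let $G$ be a Polish group. (1) The universal minimal proximal flow $\Pi(G)$ has a comeager orbit if and only if there exists a presyndetic maximal strongly amenable closed subgroup $H\le G$. Moreover, in this case, $\Pi(G)\simeq \mathrm{Sa}(G/H)$ for such $H$. (2) $\Pi(G)$ is metrizable if and only if there exists a presyndetic co-precompact maximal strongly amenable closed subgroup $H\le G$. Moreover, in this case, $\Pi(G)\simeq\widehat{G/H}$ for such $H$.
   Context: All topological spaces are Hausdorff. A $G$-flow is a (nonempty) compact Hausdorff space with a continuous left action of $G$; $\simeq$ denotes isomorphism of $G$-flows ($G$-equivariant homeomorphism). A flow $X$ is minimal if every orbit is dense, and proximal if for all $x,y\in X$ there is a net $(g_\lambda)$ in the group with $\lim g_\lambda x=\lim g_\lambda y$. $\Pi(G)$ is the universal minimal proximal flow of $G$: the (unique up to isomorphism) minimal proximal $G$-flow that maps $G$-equivariantly and continuously onto every minimal proximal $G$-flow. A topological group is strongly amenable if every proximal flow of it has a fixed point. A maximal strongly amenable closed subgroup is one that is maximal under inclusion among strongly amenable closed subgroups of $G$. A closed subgroup $H\le G$ is presyndetic if for every open neighbourhood $U$ of $1_G$ the set $UH$ is syndetic, i.e. there is a finite $F\subseteq G$ with $FUH=G$ (equivalently, $\mathrm{Sa}(G/H)$ is minimal). For a closed subgroup $H\le G$, $\mathrm{Sa}(G/H)$ is the Samuel compactification of $G/H$: the Gelfand spectrum of the unital commutative $C^*$-algebra of bounded functions $f\colon G/H\to\mathbb{C}$ such that for every $\varepsilon>0$ there is an open neighbourhood $U$ of $1_G$ with $|f(ux)-f(x)|<\varepsilon$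 for all $u\in U$, $x\in G/H$; it is a $G$-flow (with the action induced by translation) containing $G/H$ as a dense $G$-invariant subset. $\widehat{G/H}$ is the completion of $G/H$ with respect to the uniformity with basic entourages $\{(x,ux): x\in G/H,\ u\in U\}$, $U$ a symmetric open neighbourhood of $1_G$. $H$ is co-precompact if $\mathrm{Sa}(G/H)=\widehat{G/H}$ (equivalently, this uniformity is precompact; for Polish $G$, equivalently $\mathrm{Sa}(G/H)$ is metrizable). *)

theory Defs
  imports "HOL-Analysis.Analysis"
begin

text \<open>
  Groups are written additively but are not assumed commutative: the class
  \<open>topological_group_add\<close> only extends \<open>group_add\<close>. So \<open>g +o H\<close> is the left coset
  usually written \<open>g H\<close>, and \<open>U + H\<close> is the product set usually written \<open>U H\<close>.
\<close>

definition closed_subgroup :: "'g::topological_group_add set \<Rightarrow> bool" where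
  "closed_subgroup H \<longleftrightarrow>
     closed H \<and> 0 \<in> H \<and> (\<forall>g\<in>H. \<forall>h\<in>H. g + h \<in> H) \<and> (\<forall>g\<in>H. - g \<in> H)"


section \<open>Flows\<close>

text \<open>
  The acting group is a subgroup \<open>H\<close> of the ambient group type with its subspace topology;
  the whole group is \<open>H = UNIV\<close>. Nothing is required of \<open>a g x\<close> when \<open>g \<notin> H\<close> or
  \<open>x \<notin> topspace X\<close>.
\<close>

definition flow ::
  "'g::topological_group_add set \<Rightarrow> 'x topology \<Rightarrow> ('g \<Rightarrow> 'x \<Rightarrow> 'x) \<Rightarrow> bool" where
  "flow H X a \<longleftrightarrow>
     topspace X \<noteq> {} \<and> compact_space X \<and> Hausdorff_space X \<and>
     continuous_map (prod_topology (top_of_set H) X) X (\<lambda>(g, x). a g x) \<and>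
     (\<forall>x\<in>topspace X. a 0 x = x) \<and>
     (\<forall>x\<in>topspace X. \<forall>g\<in>H. \<forall>h\<in>H. a (g + h) x = a g (a h x))"

definition orbit_of :: "'g set \<Rightarrow> ('g \<Rightarrow> 'x \<Rightarrow> 'x) \<Rightarrow> 'x \<Rightarrow> 'x set" where
  "orbit_of H a x = (\<lambda>g. a g x) ` H"

definition minimal_flow ::
  "'g::topological_group_add set \<Rightarrow> 'x topology \<Rightarrow> ('g \<Rightarrow> 'x \<Rightarrow> 'x) \<Rightarrow> bool" where
  "minimal_flow H X a \<longleftrightarrow>
     flow H X a \<and> (\<forall>x\<in>topspace X. X closure_of (orbit_of H a x) = topspace X)"

text \<open>
  A net in \<open>H\<close> is represented by the filter of its tails, a proper filter on the group that
  contains \<open>H\<close>; conversely every such filter is the tail filter of a net in \<open>H\<close>.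
\<close>

definition proximal_flow ::
  "'g::topological_group_add set \<Rightarrow> 'x topology \<Rightarrow> ('g \<Rightarrow> 'x \<Rightarrow> 'x) \<Rightarrow> bool" where
  "proximal_flow H X a \<longleftrightarrow>
     flow H X a \<and>
     (\<forall>x\<in>topspace X. \<forall>y\<in>topspace X. \<exists>F z. F \<noteq> bot \<and> F \<le> principal H \<and>
        limitin X (\<lambda>g. a g x) z F \<and> limitin X (\<lambda>g. a g y) z F)"

definition equivariant_on ::
  "'g set \<Rightarrow> 'x set \<Rightarrow> ('g \<Rightarrow> 'x \<Rightarrow> 'x) \<Rightarrow> ('g \<Rightarrow> 'y \<Rightarrow> 'y) \<Rightarrow> ('x \<Rightarrow> 'y) \<Rightarrow> bool" where
  "equivariant_on H S a b \<phi> \<longleftrightarrow> (\<forall>g\<in>H. \<forall>x\<in>S. \<phi> (a g x) = b g (\<phi> x))"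

definition flow_iso ::
  "'g set \<Rightarrow> 'x topology \<Rightarrow> ('g \<Rightarrow> 'x \<Rightarrow> 'x) \<Rightarrow> 'y topology \<Rightarrow> ('g \<Rightarrow> 'y \<Rightarrow> 'y) \<Rightarrow> bool" where
  "flow_iso H X a Y b \<longleftrightarrow>
     (\<exists>\<phi>. homeomorphic_map X Y \<phi> \<and> equivariant_on H (topspace X) a b \<phi>)"

text \<open>
  In the next two definitions ``every flow'' ranges over the flows whose points have type
  \<open>'g set set\<close>. This loses nothing: a flow with a dense orbit injects into \<open>'g set set\<close>,
  so minimal flows and orbit closures have isomorphic copies there. Lemmas
  \<open>strongly_amenable_fixed_point\<close> and \<open>universal_minimal_proximal_flow_factor\<close> below
  derive both properties for flows on an arbitrary type.
\<close>

definition strongly_amenable :: "'g::topological_group_add set \<Rightarrow> bool" where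
  "strongly_amenable H \<longleftrightarrow>
     (\<forall>(X :: 'g set set topology) a. proximal_flow H X a \<longrightarrow>
        (\<exists>x\<in>topspace X. \<forall>g\<in>H. a g x = x))"

definition universal_minimal_proximal_flow ::
  "'x topology \<Rightarrow> ('g::topological_group_add \<Rightarrow> 'x \<Rightarrow> 'x) \<Rightarrow> bool" where
  "universal_minimal_proximal_flow P a \<longleftrightarrow>
     minimal_flow UNIV P a \<and> proximal_flow UNIV P a \<and>
     (\<forall>(X :: 'g set set topology) b. minimal_flow UNIV X b \<and> proximal_flow UNIV X b \<longrightarrow>
        (\<exists>\<phi>. continuous_map P X \<phi> \<and> \<phi> ` topspace P = topspace X \<and>
             equivariant_on UNIV (topspace P) a b \<phi>))"

lemma flow_action_in:
  assumes "flow H X a" "g \<in> H" "x \<in> topspace X"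
  shows "a g x \<in> topspace X"
proof -
  have "(g, x) \<in> topspace (prod_topology (top_of_set H) X)" using assms by simp
  moreover have "continuous_map (prod_topology (top_of_set H) X) X (\<lambda>(g, x). a g x)"
    using assms by (simp add: flow_def)
  ultimately show ?thesis
    using continuous_map_image_subset_topspace by force
qed

lemma flow_iso_copy:
  assumes fl: "flow H X a" and inj: "inj_on e (topspace X)"
  shows "\<exists>Y b. flow H Y b \<and> homeomorphic_map X Y e \<and> equivariant_on H (topspace X) a b e"
proof -
  define r where "r = inv_into (topspace X) e"
  define Y where "Y = pullback_topology (e ` topspace X) r X"
  define b where "b g y = e (a g (r y))" for g y
  have re: "r (e x) = x" if "x \<in> topspace X" for x
    using that inj by (simp add: r_def)
  have topY: "topspace Y = e ` topspace X"
    unfolding Y_def topspace_pullback_topology using re by auto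
  have contr: "continuous_map Y X r"
    unfolding Y_def by (metis continuous_map_id continuous_map_pullback id_comp comp_id)
  have conte: "continuous_map X Y e"
    unfolding Y_def
    by (rule continuous_map_pullback')
      (auto simp: re intro: continuous_map_eq[OF continuous_map_id])
  have hom: "homeomorphic_maps X Y e r"
    unfolding homeomorphic_maps_def using contr conte re topY by auto
  then have hm: "homeomorphic_map X Y e"
    using homeomorphic_map_maps by blast
  have act: "continuous_map (prod_topology (top_of_set H) X) X (\<lambda>(g, x). a g x)"
    using fl by (simp add: flow_def)
  have aX: "a g x \<in> topspace X" if "g \<in> H" "x \<in> topspace X" for g x
    using flow_action_in[OF fl] that .
  have cb: "continuous_map (prod_topology (top_of_set H) Y) Y (\<lambda>(g, y). b g y)"
  proof -
    have "continuous_map (prod_topology (top_of_set H) Y) (prod_topology (top_of_set H) X)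
            (\<lambda>p. (fst p, r (snd p)))"
      by (intro continuous_map_pairedI continuous_map_fst
           continuous_map_compose[OF continuous_map_snd contr, unfolded o_def])
    from continuous_map_compose[OF continuous_map_compose[OF this act] conte]
    show ?thesis by (simp add: o_def b_def case_prod_unfold)
  qed
  have XY: "X homeomorphic_space Y"
    using hom homeomorphic_space_def by blast
  have "flow H Y b"
    unfolding flow_def
  proof (intro conjI ballI)
    show "topspace Y \<noteq> {}" using fl topY by (simp add: flow_def)
    show "compact_space Y"
      using fl XY homeomorphic_compact_space by (auto simp: flow_def)
    show "Hausdorff_space Y"
      using fl XY homeomorphic_Hausdorff_space by (auto simp: flow_def)
    show "b 0 y = y" if "y \<in> topspace Y" for y
      using that fl topY by (auto simp: b_def re flow_def)
    show "b (g + h) y = b g (b h y)" if "y \<in> topspace Y" "g \<in> H" "h \<in> H" for y g h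
      using that fl topY aX by (auto simp: b_def re flow_def)
  qed (fact cb)
  moreover have "equivariant_on H (topspace X) a b e"
    by (simp add: equivariant_on_def b_def re)
  ultimately show ?thesis using hm by blast
qed

lemma flow_small_copy:
  fixes X :: "'x topology" and a :: "'g::topological_group_add \<Rightarrow> 'x \<Rightarrow> 'x"
  assumes fl: "flow H X a" and x: "x \<in> topspace X"
    and dense: "X closure_of (orbit_of H a x) = topspace X"
  shows "\<exists>(Y :: 'g set set topology) b. flow H Y b \<and> flow_iso H X a Y b"
proof -
  define e where "e y = {A. y \<in> X closure_of ((\<lambda>g. a g x) ` (A \<inter> H))}" for y
  have aux: "e y \<noteq> e z" if yz: "y \<in> topspace X" "z \<in> topspace X" "y \<noteq> z" for y z
  proof -
    obtain U V where UV: "openin X U" "openin X V" "y \<in> U" "z \<in> V" "disjnt U V"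
      using fl[unfolded flow_def] yz unfolding Hausdorff_space_def by blast
    define A where "A = {g. a g x \<in> U}"
    have im: "(\<lambda>g. a g x) ` (A \<inter> H) = U \<inter> orbit_of H a x"
      by (auto simp: A_def orbit_of_def)
    have "y \<in> X closure_of (U \<inter> orbit_of H a x)"
      using openin_Int_closure_of_subset[OF UV(1), of "orbit_of H a x"] dense UV(3) yz(1) by blast
    moreover have "z \<notin> X closure_of (U \<inter> orbit_of H a x)"
      using UV(2,4,5) by (auto simp: in_closure_of disjnt_iff)
    ultimately have "A \<in> e y" "A \<notin> e z"
      by (simp_all add: e_def im)
    then show ?thesis by blast
  qed
  have "inj_on e (topspace X)"
    by (rule inj_onI) (use aux in blast)
  from flow_iso_copy[OF fl this] obtain Y b where
    "flow H Y b" "homeomorphic_map X Y e" "equivariant_on H (topspace X) a b e"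
    by (elim exE conjE)
  then show ?thesis
    unfolding flow_iso_def by (intro exI conjI)
qed

lemma flow_iso_minimal:
  assumes m: "minimal_flow H X a" and Y: "flow H Y b" and iso: "flow_iso H X a Y b"
  shows "minimal_flow H Y b"
proof -
  obtain \<phi> where \<phi>: "homeomorphic_map X Y \<phi>" "equivariant_on H (topspace X) a b \<phi>"
    using iso unfolding flow_iso_def by (elim exE conjE)
  have fl: "flow H X a" using m by (simp add: minimal_flow_def)
  have "Y closure_of (orbit_of H b y) = topspace Y" if y: "y \<in> topspace Y" for y
  proof -
    obtain x where x: "x \<in> topspace X" "y = \<phi> x"
      using y homeomorphic_imp_surjective_map[OF \<phi>(1)] by blast
    have sub: "orbit_of H a x \<subseteq> topspace X"
      using flow_action_in[OF fl] x(1) by (auto simp: orbit_of_def)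
    have "orbit_of H b y = \<phi> ` orbit_of H a x"
      unfolding orbit_of_def image_image x(2)
      by (rule image_cong) (use \<phi>(2) x(1) in \<open>simp_all add: equivariant_on_def\<close>)
    then have "Y closure_of (orbit_of H b y) = \<phi> ` (X closure_of (orbit_of H a x))"
      using homeomorphic_map_closure_of[OF \<phi>(1) sub] by simp
    also have "X closure_of (orbit_of H a x) = topspace X"
      using m x(1) by (simp add: minimal_flow_def)
    finally show ?thesis
      using homeomorphic_imp_surjective_map[OF \<phi>(1)] by simp
  qed
  then show ?thesis using Y by (simp add: minimal_flow_def)
qed

lemma flow_iso_proximal:
  assumes p: "proximal_flow H X a" and Y: "flow H Y b" and iso: "flow_iso H X a Y b"
  shows "proximal_flow H Y b"
proof -
  obtain \<phi> where \<phi>: "homeomorphic_map X Y \<phi>" "equivariant_on H (topspace X) a b \<phi>"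
    using iso unfolding flow_iso_def by (elim exE conjE)
  have cont: "continuous_map X Y \<phi>"
    using \<phi>(1) by (rule homeomorphic_imp_continuous_map)
  have lim: "limitin Y (\<lambda>g. b g (\<phi> x)) (\<phi> z) F"
    if "limitin X (\<lambda>g. a g x) z F" "F \<le> principal H" "x \<in> topspace X" for x z F
  proof -
    have "eventually (\<lambda>g. g \<in> H) F" using that(2) by (simp add: le_principal)
    then have "\<forall>\<^sub>F g in F. \<phi> (a g x) = b g (\<phi> x)"
      by eventually_elim (use \<phi>(2) that(3) in \<open>auto simp: equivariant_on_def\<close>)
    with continuous_map_limit[OF cont that(1)] show ?thesis
      unfolding o_def by (rule limitin_transform_eventually[rotated])
  qed
  have "\<exists>F z. F \<noteq> bot \<and> F \<le> principal H \<and>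
        limitin Y (\<lambda>g. b g y) z F \<and> limitin Y (\<lambda>g. b g y') z F"
    if y: "y \<in> topspace Y" "y' \<in> topspace Y" for y y'
  proof -
    obtain x x' where x: "x \<in> topspace X" "y = \<phi> x" "x' \<in> topspace X" "y' = \<phi> x'"
      using y homeomorphic_imp_surjective_map[OF \<phi>(1)] by blast
    obtain F z where F: "F \<noteq> bot" "F \<le> principal H"
        "limitin X (\<lambda>g. a g x) z F" "limitin X (\<lambda>g. a g x') z F"
      using p[unfolded proximal_flow_def, THEN conjunct2, rule_format, OF x(1,3)]
      by (elim exE conjE)
    show ?thesis
      unfolding x(2,4) using F lim[OF F(3,2) x(1)] lim[OF F(4,2) x(3)]
      by (intro exI conjI)
  qed
  then show ?thesis using Y by (simp add: proximal_flow_def)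
qed

lemma flow_orbit_closure:
  assumes fl: "flow H X a" and H: "closed_subgroup H" and x: "x \<in> topspace X"
  defines "S \<equiv> X closure_of (orbit_of H a x)"
  shows "flow H (subtopology X S) a" "x \<in> S"
    "subtopology X S closure_of (orbit_of H a x) = S"
proof -
  have orb: "orbit_of H a x \<subseteq> topspace X"
    using flow_action_in[OF fl] x by (auto simp: orbit_of_def)
  have SX: "S \<subseteq> topspace X" unfolding S_def by (rule closure_of_subset_topspace)
  have orbS: "orbit_of H a x \<subseteq> S"
    unfolding S_def using orb by (rule closure_of_subset)
  have "a 0 x = x" "0 \<in> H" using fl H x by (auto simp: flow_def closed_subgroup_def)
  then have "x \<in> orbit_of H a x" unfolding orbit_of_def by force
  then show xS: "x \<in> S" using orbS by blast
  have act: "continuous_map (prod_topology (top_of_set H) X) X (\<lambda>(g, x). a g x)"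
    using fl by (simp add: flow_def)
  have inv: "a g y \<in> S" if g: "g \<in> H" and y: "y \<in> S" for g y
  proof -
    have "continuous_map X (prod_topology (top_of_set H) X) (\<lambda>y. (g, y))"
      by (intro continuous_map_pairedI) (use g in auto)
    from continuous_map_compose[OF this act] have cg: "continuous_map X X (a g)"
      by (simp add: o_def)
    have "a g ` orbit_of H a x \<subseteq> orbit_of H a x"
    proof
      fix z assume "z \<in> a g ` orbit_of H a x"
      then obtain h where h: "h \<in> H" "z = a g (a h x)" by (auto simp: orbit_of_def)
      then have "z = a (g + h) x" "g + h \<in> H"
        using fl H x g by (auto simp: flow_def closed_subgroup_def)
      then show "z \<in> orbit_of H a x" by (auto simp: orbit_of_def)
    qed
    moreover have "a g ` (X closure_of orbit_of H a x) \<subseteq> X closure_of (a g ` orbit_of H a x)"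
      using cg by (rule continuous_map_image_closure_subset)
    ultimately show ?thesis
      using y closure_of_mono[of "a g ` orbit_of H a x" "orbit_of H a x" X]
      unfolding S_def by blast
  qed
  have topS: "topspace (subtopology X S) = S" using SX by auto
  have "continuous_map (prod_topology (top_of_set H) (subtopology X S)) (subtopology X S)
          (\<lambda>(g, x). a g x)"
  proof -
    have "prod_topology (top_of_set H) (subtopology X S)
        = subtopology (prod_topology (top_of_set H) X) (UNIV \<times> S)"
      using subtopology_Times[of "top_of_set H" X UNIV S] by simp
    then show ?thesis
      using act inv by (auto simp: continuous_map_in_subtopology intro: continuous_map_from_subtopology)
  qed
  moreover have "closedin X S" unfolding S_def by (rule closedin_closure_of)
  then have "compact_space (subtopology X S)"
    using fl by (simp add: flow_def closedin_compact_space compact_space_subtopology)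
  moreover have "Hausdorff_space (subtopology X S)"
    using fl by (simp add: flow_def Hausdorff_space_subtopology)
  ultimately show "flow H (subtopology X S) a"
    using fl subsetD[OF SX] xS unfolding flow_def topS by auto
  show "subtopology X S closure_of (orbit_of H a x) = S"
    using orbS by (simp add: closure_of_subtopology inf.absorb2 S_def)
qed

lemma proximal_orbit_closure:
  assumes p: "proximal_flow H X a" and H: "closed_subgroup H" and x: "x \<in> topspace X"
  defines "S \<equiv> X closure_of (orbit_of H a x)"
  shows "proximal_flow H (subtopology X S) a"
proof -
  have fl: "flow H X a" using p by (simp add: proximal_flow_def)
  note flS = flow_orbit_closure(1)[OF fl H x, folded S_def]
  have SX: "S \<subseteq> topspace X" unfolding S_def by (rule closure_of_subset_topspace)
  have topS: "topspace (subtopology X S) = S" using SX by auto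
  have "\<exists>F z. F \<noteq> bot \<and> F \<le> principal H \<and>
        limitin (subtopology X S) (\<lambda>g. a g y) z F \<and> limitin (subtopology X S) (\<lambda>g. a g y') z F"
    if y: "y \<in> S" "y' \<in> S" for y y'
  proof -
    obtain F z where F: "F \<noteq> bot" "F \<le> principal H"
        "limitin X (\<lambda>g. a g y) z F" "limitin X (\<lambda>g. a g y') z F"
      using p[unfolded proximal_flow_def, THEN conjunct2, rule_format,
          OF subsetD[OF SX y(1)] subsetD[OF SX y(2)]]
      by (elim exE conjE)
    have evH: "eventually (\<lambda>g. g \<in> H) F" using F(2) by (simp add: le_principal)
    have ev: "\<forall>\<^sub>F g in F. a g w \<in> S" if "w \<in> S" for w
      using evH
    proof eventually_elim
      case (elim g)
      have "a g w \<in> topspace (subtopology X S)"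
        using flow_action_in[OF flS elim] that topS by blast
      then show ?case using topS by blast
    qed
    have "closedin X S" unfolding S_def by simp
    then have "z \<in> S"
      using limitin_closedin[OF F(3) _ ev[OF y(1)] F(1)] by blast
    then show ?thesis
      using F ev[OF y(1)] ev[OF y(2)]
      by (intro exI[of _ F] exI[of _ z] conjI) (simp_all add: limitin_subtopology)
  qed
  then show ?thesis using flS by (simp only: proximal_flow_def topS) blast
qed

lemma strongly_amenable_fixed_point:
  fixes X :: "'x topology"
  assumes sa: "strongly_amenable H" and H: "closed_subgroup H" and p: "proximal_flow H X a"
  shows "\<exists>x\<in>topspace X. \<forall>g\<in>H. a g x = x"
proof -
  have fl: "flow H X a" using p by (simp add: proximal_flow_def)
  then obtain x where x: "x \<in> topspace X" unfolding flow_def by blast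
  define S where "S = X closure_of (orbit_of H a x)"
  have SX: "S \<subseteq> topspace X" unfolding S_def by (rule closure_of_subset_topspace)
  have topS: "topspace (subtopology X S) = S" using SX by auto
  note S = flow_orbit_closure[OF fl H x, folded S_def]
  have "x \<in> topspace (subtopology X S)"
      "subtopology X S closure_of (orbit_of H a x) = topspace (subtopology X S)"
    using S(2,3) topS by simp_all
  from flow_small_copy[OF S(1) this]
  obtain Y :: "'a set set topology" and b
    where Yb: "flow H Y b" "flow_iso H (subtopology X S) a Y b"
    by (elim exE conjE)
  then have "proximal_flow H Y b"
    using flow_iso_proximal[OF proximal_orbit_closure[OF p H x]] unfolding S_def by blast
  from sa[unfolded strongly_amenable_def, rule_format, OF this]
  obtain y where y: "y \<in> topspace Y" "\<And>g. g \<in> H \<Longrightarrow> b g y = y"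
    by blast
  obtain \<phi> where \<phi>: "homeomorphic_map (subtopology X S) Y \<phi>" "equivariant_on H S a b \<phi>"
    using Yb(2) topS by (auto simp: flow_iso_def)
  obtain s where s: "s \<in> S" "y = \<phi> s"
    using y(1) unfolding homeomorphic_imp_surjective_map[OF \<phi>(1), symmetric] topS
    by (elim imageE)
  have "a g s = s" if g: "g \<in> H" for g
  proof -
    have "\<phi> (a g s) = \<phi> s" using \<phi>(2) g s y by (simp add: equivariant_on_def)
    moreover have "a g s \<in> S" using flow_action_in[OF S(1) g] s(1) unfolding topS by blast
    ultimately show ?thesis
      using homeomorphic_imp_injective_map[OF \<phi>(1)] s(1) topS by (simp add: inj_on_def)
  qed
  then show ?thesis using s(1) SX by blast
qed

lemma universal_minimal_proximal_flow_factor: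
  fixes X :: "'x topology" and a :: "'g::topological_group_add \<Rightarrow> 'p \<Rightarrow> 'p"
  assumes P: "universal_minimal_proximal_flow P a"
    and m: "minimal_flow UNIV X b" and p: "proximal_flow UNIV X b"
  shows "\<exists>\<phi>. continuous_map P X \<phi> \<and> \<phi> ` topspace P = topspace X \<and>
             equivariant_on UNIV (topspace P) a b \<phi>"
proof -
  have fl: "flow UNIV X b" using m by (simp add: minimal_flow_def)
  then obtain x where x: "x \<in> topspace X" unfolding flow_def by blast
  then have "X closure_of (orbit_of UNIV b x) = topspace X"
    using m by (simp add: minimal_flow_def)
  from flow_small_copy[OF fl x this]
  obtain Y :: "'g set set topology" and c
    where Y: "flow UNIV Y c" "flow_iso UNIV X b Y c"
    by (elim exE conjE)
  have "minimal_flow UNIV Y c \<and> proximal_flow UNIV Y c"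
    using flow_iso_minimal[OF m Y] flow_iso_proximal[OF p Y] by (rule conjI)
  from P[unfolded universal_minimal_proximal_flow_def, THEN conjunct2, THEN conjunct2,
      rule_format, OF this]
  obtain \<phi> where \<phi>: "continuous_map P Y \<phi>" "\<phi> ` topspace P = topspace Y"
      "equivariant_on UNIV (topspace P) a c \<phi>"
    by (elim exE conjE)
  obtain \<theta> where \<theta>: "homeomorphic_map X Y \<theta>" "equivariant_on UNIV (topspace X) b c \<theta>"
    using Y(2) by (auto simp: flow_iso_def)
  then obtain \<rho> where \<rho>: "homeomorphic_maps X Y \<theta> \<rho>"
    using homeomorphic_map_maps by blast
  then have r: "continuous_map Y X \<rho>" "\<And>x. x \<in> topspace X \<Longrightarrow> \<rho> (\<theta> x) = x"
      "\<And>y. y \<in> topspace Y \<Longrightarrow> \<theta> (\<rho> y) = y"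
    by (auto simp: homeomorphic_maps_def)
  have r4: "\<rho> ` topspace Y = topspace X"
    using \<rho> homeomorphic_imp_surjective_map[of Y X \<rho>] by (simp add: homeomorphic_maps_map)
  have eq: "\<rho> (c g y) = b g (\<rho> y)" if "y \<in> topspace Y" for g y
  proof -
    have "\<rho> y \<in> topspace X" using r4 that by blast
    moreover from this have "b g (\<rho> y) \<in> topspace X" using flow_action_in[OF fl] by blast
    moreover have "\<theta> (b g (\<rho> y)) = c g y"
      using \<theta>(2) calculation(1) r(3)[OF that] by (simp add: equivariant_on_def)
    ultimately show ?thesis using r(2)[of "b g (\<rho> y)"] by simp
  qed
  show ?thesis
  proof (intro exI conjI)
    show "continuous_map P X (\<rho> \<circ> \<phi>)" using \<phi>(1) r(1) by (rule continuous_map_compose)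
    show "(\<rho> \<circ> \<phi>) ` topspace P = topspace X" by (simp only: image_comp[symmetric] \<phi>(2) r4)
    show "equivariant_on UNIV (topspace P) a b (\<rho> \<circ> \<phi>)"
      unfolding equivariant_on_def
    proof (intro ballI)
      fix g x assume x: "x \<in> topspace P"
      then have "\<phi> x \<in> topspace Y" using \<phi>(2) by blast
      moreover have "\<phi> (a g x) = c g (\<phi> x)"
        using \<phi>(3) x unfolding equivariant_on_def by blast
      ultimately show "(\<rho> \<circ> \<phi>) (a g x) = b g ((\<rho> \<circ> \<phi>) x)"
        using eq by (simp add: o_def)
    qed
  qed
qed

definition maximal_strongly_amenable :: "'g::topological_group_add set \<Rightarrow> bool" where
  "maximal_strongly_amenable H \<longleftrightarrow>
     closed_subgroup H \<and> strongly_amenable H \<and>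
     (\<forall>K. closed_subgroup K \<and> strongly_amenable K \<and> H \<subseteq> K \<longrightarrow> K = H)"

definition presyndetic :: "'g::topological_group_add set \<Rightarrow> bool" where
  "presyndetic H \<longleftrightarrow>
     closed_subgroup H \<and>
     (\<forall>U. open U \<and> 0 \<in> U \<longrightarrow> (\<exists>F. finite F \<and> F + (U + H) = UNIV))"

definition comeager_in :: "'x topology \<Rightarrow> 'x set \<Rightarrow> bool" where
  "comeager_in X S \<longleftrightarrow>
     S \<subseteq> topspace X \<and>
     (\<exists>\<N>. countable \<N> \<and> (\<forall>N\<in>\<N>. X interior_of (X closure_of N) = {}) \<and>
          topspace X - S \<subseteq> \<Union>\<N>)"

definition has_comeager_orbit ::
  "'x topology \<Rightarrow> ('g \<Rightarrow> 'x \<Rightarrow> 'x) \<Rightarrow> bool" where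
  "has_comeager_orbit X a \<longleftrightarrow> (\<exists>x\<in>topspace X. comeager_in X (orbit_of UNIV a x))"


section \<open>The Samuel compactification of a coset space\<close>

definition left_cosets :: "'g::group_add set \<Rightarrow> 'g set set" where
  "left_cosets H = range (\<lambda>g. g +o H)"

text \<open>
  Functions on \<open>G/H\<close> are represented by functions on \<open>'g set\<close> that vanish off the cosets,
  so that pointwise operations stay within the representation.
\<close>

definition unif_cont_algebra ::
  "'g::topological_group_add set \<Rightarrow> ('g set \<Rightarrow> complex) set" where
  "unif_cont_algebra H =
     {f. (\<forall>x. x \<notin> left_cosets H \<longrightarrow> f x = 0) \<and> bounded (f ` left_cosets H) \<and>
         (\<forall>\<epsilon>>0. \<exists>U. open U \<and> 0 \<in> U \<and>
            (\<forall>u\<in>U. \<forall>x\<in>left_cosets H. cmod (f (u +o x) - f x) < \<epsilon>))}"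

definition algebra_characters ::
  "('s \<Rightarrow> complex) set \<Rightarrow> (('s \<Rightarrow> complex) \<Rightarrow> complex) set" where
  "algebra_characters A =
     {\<psi> \<in> extensional A.
        (\<forall>f\<in>A. \<forall>g\<in>A. \<psi> (\<lambda>x. f x + g x) = \<psi> f + \<psi> g) \<and>
        (\<forall>c. \<forall>f\<in>A. \<psi> (\<lambda>x. c * f x) = c * \<psi> f) \<and>
        (\<forall>f\<in>A. \<forall>g\<in>A. \<psi> (\<lambda>x. f x * g x) = \<psi> f * \<psi> g) \<and>
        (\<exists>f\<in>A. \<psi> f \<noteq> 0)}"

text \<open>Weak-star topology, i.e. pointwise convergence on the algebra.\<close>

definition gelfand_spectrum ::
  "('s \<Rightarrow> complex) set \<Rightarrow> (('s \<Rightarrow> complex) \<Rightarrow> complex) topology" where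
  "gelfand_spectrum A =
     subtopology (product_topology (\<lambda>_. euclidean) A) (algebra_characters A)"

definition samuel ::
  "'g::topological_group_add set \<Rightarrow> (('g set \<Rightarrow> complex) \<Rightarrow> complex) topology" where
  "samuel H = gelfand_spectrum (unif_cont_algebra H)"

text \<open>
  The action on \<open>G/H\<close> extends to characters by \<open>(g \<cdot> \<psi>) f = \<psi> (f \<circ> g)\<close>; the point
  \<open>x\<close> of \<open>G/H\<close> corresponds to evaluation at \<open>x\<close>.
\<close>

definition samuel_action ::
  "'g::topological_group_add set \<Rightarrow> 'g \<Rightarrow>
     (('g set \<Rightarrow> complex) \<Rightarrow> complex) \<Rightarrow> (('g set \<Rightarrow> complex) \<Rightarrow> complex)" where
  "samuel_action H g \<psi> = (\<lambda>f\<in>unif_cont_algebra H. \<psi> (\<lambda>x. f (g +o x)))"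

definition samuel_point ::
  "'g::topological_group_add set \<Rightarrow> 'g set \<Rightarrow> (('g set \<Rightarrow> complex) \<Rightarrow> complex)" where
  "samuel_point H x = (\<lambda>f\<in>unif_cont_algebra H. f x)"


section \<open>Completion of a uniformity and of a coset space\<close>

text \<open>
  A uniformity on a set of points of type \<open>'a\<close> is given by its filter of entourages.
  Its (Hausdorff) completion is the space of minimal Cauchy filters. In the order on
  \<open>'a filter\<close> smaller means more eventually true predicates, so minimality with respect to
  inclusion of filters is maximality with respect to \<open>\<le>\<close>.
\<close>

definition cauchy_wrt :: "('a \<times> 'a) filter \<Rightarrow> 'a filter \<Rightarrow> bool" where
  "cauchy_wrt \<U> F \<longleftrightarrow> F \<noteq> bot \<and> F \<times>\<^sub>F F \<le> \<U>"

definition minimal_cauchy_wrt :: "('a \<times> 'a) filter \<Rightarrow> 'a filter \<Rightarrow> bool" where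
  "minimal_cauchy_wrt \<U> F \<longleftrightarrow>
     cauchy_wrt \<U> F \<and> (\<forall>F'. cauchy_wrt \<U> F' \<and> F \<le> F' \<longrightarrow> F' = F)"

text \<open>
  The completed entourage of \<open>V\<close> relates two minimal Cauchy filters having a common member
  \<open>M\<close> with \<open>M \<times> M \<subseteq> V\<close>.
\<close>

definition completion_entourage :: "('a \<times> 'a) set \<Rightarrow> ('a filter \<times> 'a filter) set" where
  "completion_entourage V =
     {(F, F'). \<exists>M. M \<times> M \<subseteq> V \<and> eventually (\<lambda>x. x \<in> M) F \<and> eventually (\<lambda>x. x \<in> M) F'}"

definition completion_open :: "('a \<times> 'a) filter \<Rightarrow> 'a filter set \<Rightarrow> bool" where
  "completion_open \<U> W \<longleftrightarrow>
     W \<subseteq> Collect (minimal_cauchy_wrt \<U>) \<and>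
     (\<forall>F\<in>W. \<exists>V. eventually (\<lambda>p. p \<in> V) \<U> \<and>
        (\<forall>F'. minimal_cauchy_wrt \<U> F' \<and> (F, F') \<in> completion_entourage V \<longrightarrow> F' \<in> W))"

lemma completion_openD:
  assumes "completion_open \<U> W" "F \<in> W"
  shows "\<exists>V. eventually (\<lambda>p. p \<in> V) \<U> \<and>
    (\<forall>F'. minimal_cauchy_wrt \<U> F' \<and> (F, F') \<in> completion_entourage V \<longrightarrow> F' \<in> W)"
  using assms by (simp add: completion_open_def)

lemma istopology_completion_open: "istopology (completion_open \<U>)"
  unfolding istopology_def
proof (intro conjI allI impI)
  fix S T assume S: "completion_open \<U> S" and T: "completion_open \<U> T"
  show "completion_open \<U> (S \<inter> T)"
    unfolding completion_open_def
  proof (intro conjI ballI)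
    show "S \<inter> T \<subseteq> Collect (minimal_cauchy_wrt \<U>)"
      using S unfolding completion_open_def by blast
    fix F assume "F \<in> S \<inter> T"
    then have F: "F \<in> S" "F \<in> T" by auto
    obtain V where V: "eventually (\<lambda>p. p \<in> V) \<U>"
        "\<forall>F'. minimal_cauchy_wrt \<U> F' \<and> (F, F') \<in> completion_entourage V \<longrightarrow> F' \<in> S"
      using completion_openD[OF S F(1)] by (elim exE conjE)
    obtain W where W: "eventually (\<lambda>p. p \<in> W) \<U>"
        "\<forall>F'. minimal_cauchy_wrt \<U> F' \<and> (F, F') \<in> completion_entourage W \<longrightarrow> F' \<in> T"
      using completion_openD[OF T F(2)] by (elim exE conjE)
    have "eventually (\<lambda>p. p \<in> V \<inter> W) \<U>"
      using V(1) W(1) by eventually_elim auto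
    moreover have "completion_entourage (V \<inter> W) \<subseteq> completion_entourage V"
      "completion_entourage (V \<inter> W) \<subseteq> completion_entourage W"
      unfolding completion_entourage_def by blast+
    ultimately show "\<exists>V. eventually (\<lambda>p. p \<in> V) \<U> \<and>
        (\<forall>F'. minimal_cauchy_wrt \<U> F' \<and> (F, F') \<in> completion_entourage V \<longrightarrow> F' \<in> S \<inter> T)"
      using V(2) W(2) by (intro exI[of _ "V \<inter> W"] conjI) (assumption, auto)
  qed
next
  fix K assume K: "\<forall>S\<in>K. completion_open \<U> S"
  show "completion_open \<U> (\<Union>K)"
    unfolding completion_open_def
  proof (intro conjI ballI)
    show "\<Union>K \<subseteq> Collect (minimal_cauchy_wrt \<U>)"
      using K unfolding completion_open_def by blast
    fix F assume "F \<in> \<Union>K"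
    then obtain S where S: "S \<in> K" "F \<in> S" by blast
    obtain V where "eventually (\<lambda>p. p \<in> V) \<U>"
        "\<forall>F'. minimal_cauchy_wrt \<U> F' \<and> (F, F') \<in> completion_entourage V \<longrightarrow> F' \<in> S"
      using completion_openD[OF K[rule_format, OF S(1)] S(2)] by (elim exE conjE)
    with S(1) show "\<exists>V. eventually (\<lambda>p. p \<in> V) \<U> \<and>
        (\<forall>F'. minimal_cauchy_wrt \<U> F' \<and> (F, F') \<in> completion_entourage V \<longrightarrow> F' \<in> \<Union>K)"
      by (intro exI[of _ V] conjI) auto
  qed
qed

definition completion_topology :: "('a \<times> 'a) filter \<Rightarrow> 'a filter topology" where
  "completion_topology \<U> = topology (completion_open \<U>)"

lemma openin_completion_topology [simp]:
  "openin (completion_topology \<U>) = completion_open \<U>"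
  unfolding completion_topology_def
  by (rule topology_inverse'[OF istopology_completion_open])

definition completion_point :: "('a \<times> 'a) filter \<Rightarrow> 'a \<Rightarrow> 'a filter" where
  "completion_point \<U> x = filtercomap (\<lambda>y. (x, y)) \<U>"

definition coset_uniformity ::
  "'g::topological_group_add set \<Rightarrow> ('g set \<times> 'g set) filter" where
  "coset_uniformity H =
     (INF U\<in>{U. open U \<and> 0 \<in> U \<and> uminus ` U = U}.
        principal {(x, u +o x) | x u. x \<in> left_cosets H \<and> u \<in> U})"

definition coset_completion :: "'g::topological_group_add set \<Rightarrow> 'g set filter topology" where
  "coset_completion H = completion_topology (coset_uniformity H)"

definition coset_completion_action :: "'g::group_add \<Rightarrow> 'g set filter \<Rightarrow> 'g set filter" where
  "coset_completion_action g F = filtermap (\<lambda>x. g +o x) F"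

text \<open>
  Equality of the Samuel compactification and the completion means a homeomorphism that is
  the identity on the copies of \<open>G/H\<close>; by density there is at most one such.
\<close>

definition co_precompact :: "'g::topological_group_add set \<Rightarrow> bool" where
  "co_precompact H \<longleftrightarrow>
     (\<exists>\<phi>. homeomorphic_map (coset_completion H) (samuel H) \<phi> \<and>
        (\<forall>x\<in>left_cosets H.
           \<phi> (completion_point (coset_uniformity H) x) = samuel_point H x))"

end

theory Submission
  imports Defs
begin

text \<open>
  Let \<open>P\<close> be the universal minimal proximal flow of the Polish group \<open>G\<close>. The proof turns on points \<open>x\<close> of
  \<open>P\<close> that are nearly open: \<open>x\<close> is interior to the closure of \<open>U x\<close> for every neighbourhood \<open>U\<close> of the
  identity. By Baire category a point with comeager orbit is nearly open, and so is a point fixed by a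
  presyndetic subgroup. Conversely completeness of \<open>G\<close> gives an open mapping theorem
  (\<open>effros_open_orbit_map\<close>) and comeagerness of the orbit (\<open>nearly_open_imp_comeager_orbit\<close>).

  The engine is \<open>extension_of_collapsing_fibre\<close>. For a bounded right uniformly continuous function \<open>F\<close>
  on \<open>G\<close>, the orbit closure of \<open>(F, x)\<close> in a compact space of functions times \<open>P\<close> is a flow over \<open>P\<close>.
  Whenever it is minimal and proximal, universality provides a section of its projection to \<open>P\<close>, and the
  section extends \<open>F\<close> from the orbit of \<open>x\<close> to a continuous function on \<open>P\<close>. It is used in three situations.

  \<^item> If \<open>x\<close> is nearly open with stabilizer \<open>K\<close>, all uniformly continuous functions on \<open>G/K\<close> extend to
    \<open>P\<close>. So \<open>P\<close> is the Samuel compactification of \<open>G/K\<close> (\<open>samuel_isomorphism\<close>).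

  \<^item> Let \<open>Y\<close> be a minimal proximal flow of that \<open>K\<close>. The distance along the group to an open subset of \<open>Y\<close>
    is semicontinuous on \<open>Y\<close>, hence continuous at generic points. For such a point \<open>y\<close>, the pair formed by
    the distance function at \<open>y\<close> and \<open>y\<close> itself has as orbit closure an almost one-to-one extension of \<open>Y\<close>.
    So \<open>extension_of_collapsing_fibre\<close> applies and shows that the distance is invariant, which forces \<open>Y\<close>
    to be a point. So \<open>K\<close> is strongly amenable
    (\<open>stabilizer_strongly_amenable\<close>). It is maximal: a larger such group fixes a point of \<open>P\<close>, and the
    open mapping theorem together with proximality shows that \<open>K\<close> fixes only \<open>x\<close>.

  \<^item> For the distance to an open subset of \<open>P\<close> itself one finds that open sets which are apart along the
    group have disjoint closures (\<open>separated_open_sets_disjoint_closures\<close>). If \<open>P\<close> is metrizable, no infinite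
    sequence of open sets can then be pairwise apart, which yields both a nearly open point
    (\<open>metrizable_nearly_open_point\<close>) and precompactness of its orbit
    (\<open>metrizable_imp_orbit_precompact\<close>).

  Starting from a presyndetic maximal strongly amenable \<open>H\<close> instead, \<open>P\<close> is still proximal for \<open>H\<close>, so \<open>H\<close>
  fixes a point; the point is nearly open, its stabilizer is strongly amenable, and by maximality \<open>H\<close> is this
  stabilizer. Thus the groups in the theorem are exactly the stabilizers of nearly open points. For a
  precompact orbit, tracing neighbourhoods of points of \<open>P\<close> on the orbit identifies \<open>P\<close> with the completion of
  \<open>G/K\<close> (\<open>completion_isomorphism\<close>), and distances to countably many orbit points metrize \<open>P\<close>.
\<close>

section \<open>A group norm for a first countable topological group\<close>

lemma group_translation_continuous:
  fixes g :: "'g::topological_group_add"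
  shows "continuous_on UNIV (\<lambda>x. g + x)" "continuous_on UNIV (\<lambda>x. x + g)"
    "continuous_on UNIV (\<lambda>x::'g. - x)"
  by (auto simp: continuous_on_def intro!: tendsto_intros)

lemma open_group_vimage:
  fixes g :: "'g::topological_group_add"
  assumes "open U"
  shows "open {x. g + x \<in> U}" "open {x. x + g \<in> U}" "open {x. - x \<in> U}"
  using open_vimage[OF assms group_translation_continuous(1)[of g]]
    open_vimage[OF assms group_translation_continuous(2)[of g]]
    open_vimage[OF assms group_translation_continuous(3)]
  by (simp_all add: vimage_def)

lemma open_add_rectangle:
  fixes U :: "'g::topological_group_add set"
  assumes "open U" "a + b \<in> U"
  obtains V W where "open V" "a \<in> V" "open W" "b \<in> W" "\<And>v w. v \<in> V \<Longrightarrow> w \<in> W \<Longrightarrow> v + w \<in> U"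
proof -
  have "\<forall>\<^sub>F p in nhds a \<times>\<^sub>F nhds b. fst p + snd p \<in> U"
    using tendsto_add_Pair[of a b] assms by (simp add: tendsto_def)
  then show thesis
    unfolding eventually_prod_filter eventually_nhds
    using that by (metis fst_conv snd_conv)
qed

lemma zero_nhd_threefold:
  fixes U :: "'g::topological_group_add set"
  assumes "open U" "0 \<in> U"
  shows "\<exists>V. open V \<and> 0 \<in> V \<and> V \<subseteq> U \<and> (\<forall>v\<in>V. - v \<in> V) \<and>
    (\<forall>a\<in>V. \<forall>b\<in>V. \<forall>c\<in>V. a + b + c \<in> U)"
proof -
  have "0 + 0 \<in> U" using assms by simp
  with assms(1) obtain A B where A: "open A" "0 \<in> A" "open B" "0 \<in> B"
    "\<And>v w. v \<in> A \<Longrightarrow> w \<in> B \<Longrightarrow> v + w \<in> U" by (rule open_add_rectangle) blast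
  have "0 + 0 \<in> A" using A by simp
  with A(1) obtain C D where C: "open C" "0 \<in> C" "open D" "0 \<in> D"
    "\<And>v w. v \<in> C \<Longrightarrow> w \<in> D \<Longrightarrow> v + w \<in> A" by (rule open_add_rectangle) blast
  define E where "E = U \<inter> B \<inter> C \<inter> D"
  define V where "V = E \<inter> {x. - x \<in> E}"
  have "open E" using A C assms by (auto simp: E_def)
  then have "open V" unfolding V_def by (intro open_Int open_group_vimage)
  moreover have "0 \<in> V" using A C assms by (auto simp: V_def E_def)
  moreover have "a + b + c \<in> U" if "a \<in> V" "b \<in> V" "c \<in> V" for a b c
    using that A(5)[of "a + b" c] C(5)[of a b] by (auto simp: V_def E_def)
  ultimately show ?thesis by (intro exI[of _ V]) (auto simp: V_def E_def)
qed

text \<open>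
  The chain estimate behind the Birkhoff-Kakutani metrization: cut the sum at half of its
  weight. Both outer pieces and the single middle summand then lie in the next neighbourhood.
\<close>

lemma chain_sum_in_nhd:
  fixes V :: "nat \<Rightarrow> 'g::group_add set"
  assumes dec: "\<And>m n. m \<le> n \<Longrightarrow> V n \<subseteq> V m" and zero: "\<And>n. 0 \<in> V n"
    and third: "\<And>n a b c. a \<in> V (Suc n) \<Longrightarrow> b \<in> V (Suc n) \<Longrightarrow> c \<in> V (Suc n) \<Longrightarrow> a + b + c \<in> V n"
  shows "\<forall>(n, g)\<in>set ps. g \<in> V n \<Longrightarrow> (\<Sum>(n, g)\<leftarrow>ps. (1/2) ^ n) < (1/2 :: real) ^ k \<Longrightarrow>
    (\<Sum>(n, g)\<leftarrow>ps. g) \<in> V k"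
proof (induction "length ps" arbitrary: ps k rule: less_induct)
  case less
  let ?w = "\<lambda>ps. \<Sum>(n, g)\<leftarrow>ps. (1/2 :: real) ^ n"
  have nn: "0 \<le> ?w qs" for qs :: "(nat \<times> 'g) list"
    by (rule sum_list_nonneg) auto
  show ?case
  proof (cases "ps = []")
    case True
    then show ?thesis using zero by simp
  next
    case False
    \<comment> \<open>The shortest initial segment that carries more than half of the weight.\<close>
    define j where "j = (LEAST j. ?w ps / 2 < ?w (take j ps))"
    have wpos: "0 < ?w ps"
    proof -
      obtain n g qs where "ps = (n, g) # qs" using False by (metis neq_Nil_conv surj_pair)
      then show ?thesis using nn[of qs] by (simp add: add_pos_nonneg)
    qed
    then have ex: "?w ps / 2 < ?w (take (length ps) ps)" by simp
    have j: "?w ps / 2 < ?w (take j ps)" unfolding j_def by (rule LeastI) (rule ex)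
    have jle: "j \<le> length ps" unfolding j_def by (rule Least_le) (rule ex)
    have "j \<noteq> 0" using j wpos by (intro notI) simp
    then obtain i where i: "j = Suc i" using not0_implies_Suc by blast
    have iw: "?w (take i ps) \<le> ?w ps / 2"
      using not_less_Least[of i "\<lambda>j. ?w ps / 2 < ?w (take j ps)"] i j_def by force
    obtain n g where ng: "ps ! i = (n, g)" by force
    have il: "i < length ps" using jle i by simp
    have split: "ps = take i ps @ (n, g) # drop (Suc i) ps"
      using id_take_nth_drop[OF il] ng by simp
    have takej: "take j ps = take i ps @ [(n, g)]"
      using take_Suc_conv_app_nth[OF il] ng i by simp
    have total: "?w ps = ?w (take i ps) + (1/2)^n + ?w (drop (Suc i) ps)"
      by (subst split) simp
    have tail: "?w (drop (Suc i) ps) \<le> ?w ps / 2"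
      using j unfolding takej total by simp
    have half: "?w ps / 2 < (1/2) ^ Suc k" using less.prems(2) by simp
    have "(1/2::real)^n \<le> ?w ps"
      using total nn[of "take i ps"] nn[of "drop (Suc i) ps"] by linarith
    then have "(1/2::real)^n < (1/2)^k" using less.prems(2) by (rule le_less_trans)
    then have "k < n" using power_strict_decreasing_iff[of "1/2::real" n k] by simp
    moreover have "g \<in> V n" using less.prems(1) split by (metis (no_types, lifting) case_prodD in_set_conv_decomp)
    ultimately have g: "g \<in> V (Suc k)" using dec[of "Suc k" n] by auto
    have 1: "(\<Sum>(n, g)\<leftarrow>take i ps. g) \<in> V (Suc k)"
      by (rule less.hyps) (use il less.prems(1) iw half in \<open>auto dest: in_set_takeD\<close>)
    have 2: "(\<Sum>(n, g)\<leftarrow>drop (Suc i) ps. g) \<in> V (Suc k)"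
      by (rule less.hyps) (use il less.prems(1) tail half in \<open>auto dest: in_set_dropD\<close>)
    have "(\<Sum>(n, g)\<leftarrow>ps. g) = (\<Sum>(n, g)\<leftarrow>take i ps. g) + g + (\<Sum>(n, g)\<leftarrow>drop (Suc i) ps. g)"
      by (subst split) (simp add: add.assoc)
    then show ?thesis using third[OF 1 g 2] by simp
  qed
qed

text \<open>
  A norm on a group here is a subadditive symmetric length function whose balls
  form a neighbourhood base of the identity. The right invariant metric \<open>N (g - h)\<close> it induces
  measures the right uniformity, which is the one that flows see: \<open>u + g\<close> is close to \<open>g\<close> for
  small \<open>u\<close>, uniformly in \<open>g\<close>.
\<close>

definition is_group_norm :: "('g::topological_group_add \<Rightarrow> real) \<Rightarrow> bool" where
  "is_group_norm N \<longleftrightarrow>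
     (\<forall>g. 0 \<le> N g \<and> N (- g) = N g) \<and> N 0 = 0 \<and> (\<forall>g h. N (g + h) \<le> N g + N h) \<and>
     (\<forall>U. open U \<and> 0 \<in> U \<longrightarrow> (\<exists>r>0. \<forall>g. N g < r \<longrightarrow> g \<in> U)) \<and>
     (\<forall>r>0. \<exists>U. open U \<and> 0 \<in> U \<and> (\<forall>g\<in>U. N g < r))"

text \<open>
  Take a decreasing neighbourhood base \<open>V n\<close> with threefold sums of \<open>V (n + 1)\<close> inside \<open>V n\<close>, give the
  elements of \<open>V n\<close> weight \<open>2\<^sup>-\<^sup>n\<close>, and let \<open>N g\<close> be the least weight of a finite sum with
  value \<open>g\<close>.
\<close>

lemma group_norm_exists:
  "\<exists>N :: 'g::{topological_group_add, first_countable_topology} \<Rightarrow> real. is_group_norm N"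
proof -
  obtain B :: "nat \<Rightarrow> 'g set" where B: "\<And>n. open (B n)" "\<And>n. 0 \<in> B n"
    "\<And>U. open U \<Longrightarrow> 0 \<in> U \<Longrightarrow> \<exists>n. B n \<subseteq> U"
  proof -
    obtain B :: "nat \<Rightarrow> 'g set" where B: "\<forall>i. 0 \<in> B i \<and> open (B i)"
      "\<forall>S. open S \<and> 0 \<in> S \<longrightarrow> (\<exists>i. B i \<subseteq> S)"
      using first_countable_basis[of "0::'g"] by blast
    then show thesis by (intro that[of B]) auto
  qed
  define good where "good n V \<longleftrightarrow> open V \<and> 0 \<in> V \<and> (\<forall>v\<in>V. - v \<in> V) \<and> (n > 0 \<longrightarrow> V \<subseteq> B (n - 1)) \<and> (n = 0 \<longrightarrow> V = UNIV)"
    for n and V :: "'g set"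
  have "\<exists>V. \<forall>n. good n (V n) \<and> V (Suc n) \<subseteq> V n \<and>
      (\<forall>a\<in>V (Suc n). \<forall>b\<in>V (Suc n). \<forall>c\<in>V (Suc n). a + b + c \<in> V n)"
  proof (rule dependent_nat_choice)
    show "\<exists>V. good 0 V" by (rule exI[of _ UNIV]) (simp add: good_def)
    fix V n assume V: "good n V"
    have "open (V \<inter> B n)" "0 \<in> V \<inter> B n" using V B by (auto simp: good_def)
    from zero_nhd_threefold[OF this] show "\<exists>W. good (Suc n) W \<and> W \<subseteq> V \<and>
      (\<forall>a\<in>W. \<forall>b\<in>W. \<forall>c\<in>W. a + b + c \<in> V)"
      unfolding good_def by auto
  qed
  then obtain V where V: "\<And>n. good n (V n)" "\<And>n. V (Suc n) \<subseteq> V n"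
    "\<And>n a b c. a \<in> V (Suc n) \<Longrightarrow> b \<in> V (Suc n) \<Longrightarrow> c \<in> V (Suc n) \<Longrightarrow> a + b + c \<in> V n"
    by blast
  have dec: "V n \<subseteq> V m" if "m \<le> n" for m n using lift_Suc_antimono_le[of V m n] V(2) that by blast
  define L where "L g = {ps. (\<forall>(n, x)\<in>set ps. x \<in> V n) \<and> (\<Sum>(n, x)\<leftarrow>ps. x) = g}" for g
  define w where "w ps = (\<Sum>(n, x)\<leftarrow>ps. (1/2 :: real) ^ n)" for ps :: "(nat \<times> 'g) list"
  define N where "N g = Inf (w ` L g)" for g
  have nn: "0 \<le> w ps" for ps unfolding w_def by (rule sum_list_nonneg) auto
  have bdd: "bdd_below (w ` L g)" for g by (rule bdd_belowI[of _ 0]) (use nn in auto)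
  have single: "[(n, g)] \<in> L g" if "g \<in> V n" for g n using that by (simp add: L_def)
  have V0: "V 0 = UNIV" using V(1)[of 0] by (simp add: good_def)
  have ne: "w ` L g \<noteq> {}" for g using single[of g 0] V0 by auto
  have Nle: "N g \<le> w ps" if "ps \<in> L g" for g ps
    unfolding N_def using that by (intro cInf_lower bdd) auto
  have N_V: "N g \<le> (1/2) ^ n" if "g \<in> V n" for g n
    using Nle[OF single[OF that]] by (simp add: w_def)
  have V_N: "g \<in> V k" if less: "N g < (1/2) ^ k" for g k
  proof -
    from cInf_lessD[OF ne less[unfolded N_def]]
    obtain ps where "ps \<in> L g" "w ps < (1/2) ^ k" by (elim bexE imageE) simp
    moreover have "\<And>n. 0 \<in> V n" using V(1) by (simp add: good_def)
    ultimately show ?thesis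
      using chain_sum_in_nhd[of V ps k, OF dec _ V(3)] unfolding L_def w_def by blast
  qed
  have sub: "N (g + h) \<le> N g + N h" for g h
  proof -
    have "N (g + h) - N h \<le> w ps" if ps: "ps \<in> L g" for ps
    proof -
      have "N (g + h) - w ps \<le> w qs" if qs: "qs \<in> L h" for qs
      proof -
        have "ps @ qs \<in> L (g + h)" using ps qs by (auto simp: L_def)
        from Nle[OF this] show ?thesis by (simp add: w_def)
      qed
      then have "N (g + h) - w ps \<le> N h" unfolding N_def[of h] by (intro cInf_greatest ne) auto
      then show ?thesis by simp
    qed
    then have "N (g + h) - N h \<le> N g" unfolding N_def[of g] by (intro cInf_greatest ne) auto
    then show ?thesis by simp
  qed
  have inv: "N (- g) \<le> N g" for g
  proof -
    have "N (- g) \<le> w ps" if ps: "ps \<in> L g" for ps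
    proof -
      define qs where "qs = rev (map (\<lambda>(n, x). (n, - x)) ps)"
      have "(\<Sum>(n, x)\<leftarrow>rev (map (\<lambda>(n, x). (n, - x)) ps). x) = - (\<Sum>(n, x)\<leftarrow>ps. x)"
        by (induction ps) (auto simp: minus_add)
      moreover have "w (rev (map (\<lambda>(n, x). (n, - x)) ps)) = w ps"
        unfolding w_def by (induction ps) auto
      ultimately have "qs \<in> L (- g)" "w qs = w ps"
        using ps V(1) by (auto simp: L_def qs_def good_def)
      then show ?thesis using Nle by metis
    qed
    then show ?thesis unfolding N_def[of g] by (intro cInf_greatest ne) auto
  qed
  have "is_group_norm N"
    unfolding is_group_norm_def
  proof (intro conjI allI impI)
    fix g h
    show "0 \<le> N g" unfolding N_def by (intro cInf_greatest ne) (use nn in auto)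
    show "N (- g) = N g" using inv[of g] inv[of "- g"] by simp
    show "N (g + h) \<le> N g + N h" by (rule sub)
  next
    have "[] \<in> L 0" by (simp add: L_def)
    from Nle[OF this] have "N 0 \<le> 0" by (simp add: w_def)
    moreover have "0 \<le> N 0" unfolding N_def by (intro cInf_greatest ne) (use nn in auto)
    ultimately show "N 0 = 0" by simp
  next
    fix U :: "'g set" assume "open U \<and> 0 \<in> U"
    then obtain n where n: "B n \<subseteq> U" using B(3) by blast
    have "V (Suc n) \<subseteq> B n" using V(1)[of "Suc n"] by (simp add: good_def)
    then show "\<exists>r>0. \<forall>g. N g < r \<longrightarrow> g \<in> U"
      using V_N n by (intro exI[of _ "(1/2)^Suc n"]) (auto simp del: power_Suc)
  next
    fix r :: real assume "r > 0"
    then obtain n where "(1/2)^n < r" using real_arch_pow_inv[of r "1/2"] by auto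
    then show "\<exists>U. open U \<and> 0 \<in> U \<and> (\<forall>g\<in>U. N g < r)"
      using V(1)[of n] le_less_trans[OF N_V] by (intro exI[of _ "V n"] conjI ballI) (auto simp only: good_def)
  qed
  then show ?thesis by blast
qed

definition gnorm :: "'g::{topological_group_add, first_countable_topology} \<Rightarrow> real" where
  "gnorm = (SOME N. is_group_norm N)"

lemma gnorm_is_group_norm:
  "is_group_norm (gnorm :: 'g::{topological_group_add, first_countable_topology} \<Rightarrow> real)"
  unfolding gnorm_def by (rule someI_ex[OF group_norm_exists])

lemma gnorm_ge_0 [simp]: "0 \<le> gnorm g"
  and gnorm_minus [simp]: "gnorm (- g) = gnorm g" and gnorm_zero [simp]: "gnorm 0 = 0"
  and gnorm_triangle: "gnorm (g + h) \<le> gnorm g + gnorm h"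
  and gnorm_ball_subset: "open U \<Longrightarrow> 0 \<in> U \<Longrightarrow> \<exists>r>0. \<forall>g. gnorm g < r \<longrightarrow> g \<in> U"
  and gnorm_small_nhd: "r > 0 \<Longrightarrow> \<exists>U. open U \<and> 0 \<in> U \<and> (\<forall>g\<in>U. gnorm g < r)"
  using gnorm_is_group_norm unfolding is_group_norm_def by blast+

lemma gnorm_minus_commute: "gnorm (g - h) = gnorm (h - g)"
  by (metis gnorm_minus minus_diff_eq)

lemma gnorm_diff_triangle: "gnorm (a - c) \<le> gnorm (a - b) + gnorm (b - c)"
  using gnorm_triangle[of "a - b" "b - c"] by (metis add_diff_eq diff_add_cancel)

lemma open_gnorm_ball: "open {g. gnorm (g - c) < r}"
proof (rule Topological_Spaces.openI)
  fix x :: 'a assume "x \<in> {g. gnorm (g - c) < r}"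
  then have "r - gnorm (x - c) > 0" by simp
  from gnorm_small_nhd[OF this] obtain U :: "'a set"
    where U: "open U" "0 \<in> U" "\<forall>g\<in>U. gnorm g < r - gnorm (x - c)" by blast
  have "gnorm (y - c) < r" if "y - x \<in> U" for y
    using U(3) that gnorm_diff_triangle[of y c x] by force
  then show "\<exists>T. open T \<and> x \<in> T \<and> T \<subseteq> {g. gnorm (g - c) < r}"
    using open_group_vimage(2)[OF U(1), of "- x"] U(2)
    by (intro exI[of _ "{y. y + - x \<in> U}"]) auto
qed


section \<open>Orbit closures, minimality and proximality\<close>

abbreviation orbit_closure ::
  "'g set \<Rightarrow> 'x topology \<Rightarrow> ('g \<Rightarrow> 'x \<Rightarrow> 'x) \<Rightarrow> 'x \<Rightarrow> 'x set" where
  "orbit_closure H X a x \<equiv> X closure_of (orbit_of H a x)"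

definition pair_action ::
  "('g \<Rightarrow> 'x \<Rightarrow> 'x) \<Rightarrow> ('g \<Rightarrow> 'y \<Rightarrow> 'y) \<Rightarrow> 'g \<Rightarrow> 'x \<times> 'y \<Rightarrow> 'x \<times> 'y" where
  "pair_action a b g = (\<lambda>(x, y). (a g x, b g y))"

lemma pair_action_simp [simp]: "pair_action a b g (x, y) = (a g x, b g y)"
  by (simp add: pair_action_def)

lemma closed_subgroup_UNIV [simp]: "closed_subgroup UNIV"
  by (simp add: closed_subgroup_def)

lemma flow_zero: "flow H X a \<Longrightarrow> x \<in> topspace X \<Longrightarrow> a 0 x = x"
  and flow_add: "flow H X a \<Longrightarrow> x \<in> topspace X \<Longrightarrow> g \<in> H \<Longrightarrow> h \<in> H \<Longrightarrow> a (g + h) x = a g (a h x)"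
  and flow_Hausdorff: "flow H X a \<Longrightarrow> Hausdorff_space X"
  and flow_compact: "flow H X a \<Longrightarrow> compact_space X"
  and flow_continuous: "flow H X a \<Longrightarrow> continuous_map (prod_topology (top_of_set H) X) X (\<lambda>(g, x). a g x)"
  by (simp_all add: flow_def)

lemma flow_continuous_act:
  assumes "flow H X a" "g \<in> H"
  shows "continuous_map X X (a g)"
proof -
  have "continuous_map X (prod_topology (top_of_set H) X) (\<lambda>y. (g, y))"
    by (intro continuous_map_pairedI) (use assms in auto)
  from continuous_map_compose[OF this flow_continuous[OF assms(1)]]
  show ?thesis by (simp add: o_def)
qed

lemma flow_continuous_orbit_map:
  assumes "flow H X a" "x \<in> topspace X"
  shows "continuous_map (top_of_set H) X (\<lambda>g. a g x)"
proof -
  have "continuous_map (top_of_set H) (prod_topology (top_of_set H) X) (\<lambda>g. (g, x))"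
    by (intro continuous_map_pairedI) (use assms in \<open>auto simp: id_def[symmetric]\<close>)
  from continuous_map_compose[OF this flow_continuous[OF assms(1)]]
  show ?thesis by (simp add: o_def)
qed

lemma flow_prod:
  assumes X: "flow H X a" and Y: "flow H Y b"
  shows "flow H (prod_topology X Y) (pair_action a b)"
  unfolding flow_def
proof (intro conjI ballI)
  have sX: "continuous_map (prod_topology (top_of_set H) (prod_topology X Y)) (prod_topology (top_of_set H) X)
      (\<lambda>p. (fst p, fst (snd p)))"
    by (intro continuous_map_pairedI continuous_map_fst
        continuous_map_compose[OF continuous_map_snd continuous_map_fst, unfolded o_def])
  have sY: "continuous_map (prod_topology (top_of_set H) (prod_topology X Y)) (prod_topology (top_of_set H) Y)
      (\<lambda>p. (fst p, snd (snd p)))"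
    by (intro continuous_map_pairedI continuous_map_fst
        continuous_map_compose[OF continuous_map_snd continuous_map_snd, unfolded o_def])
  have "continuous_map (prod_topology (top_of_set H) (prod_topology X Y)) (prod_topology X Y)
      (\<lambda>p. (a (fst p) (fst (snd p)), b (fst p) (snd (snd p))))"
    using continuous_map_compose[OF sX flow_continuous[OF X]]
      continuous_map_compose[OF sY flow_continuous[OF Y]]
    by (intro continuous_map_pairedI) (simp_all add: o_def)
  then show "continuous_map (prod_topology (top_of_set H) (prod_topology X Y)) (prod_topology X Y)
      (\<lambda>(g, p). pair_action a b g p)"
    by (simp add: pair_action_def case_prod_unfold)
qed (use assms in \<open>auto simp: flow_def compact_space_prod_topology Hausdorff_space_prod_topology\<close>)

lemma orbit_subset_topspace:
  "flow H X a \<Longrightarrow> x \<in> topspace X \<Longrightarrow> orbit_of H a x \<subseteq> topspace X"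
  using flow_action_in by (fastforce simp: orbit_of_def)

lemma orbit_subset_orbit_closure:
  "flow H X a \<Longrightarrow> x \<in> topspace X \<Longrightarrow> orbit_of H a x \<subseteq> orbit_closure H X a x"
  by (rule closure_of_subset[OF orbit_subset_topspace])

lemma orbit_closure_self:
  "flow H X a \<Longrightarrow> closed_subgroup H \<Longrightarrow> x \<in> topspace X \<Longrightarrow> x \<in> orbit_closure H X a x"
  by (rule flow_orbit_closure(2))

lemma orbit_closure_invariant:
  assumes "flow H X a" "closed_subgroup H" "x \<in> topspace X" "y \<in> orbit_closure H X a x" "g \<in> H"
  shows "a g y \<in> orbit_closure H X a x"
proof -
  have "topspace (subtopology X (orbit_closure H X a x)) = orbit_closure H X a x"
    by (simp add: Int_absorb1 closure_of_subset_topspace)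
  then show ?thesis
    using flow_action_in[OF flow_orbit_closure(1)[OF assms(1-3)] assms(5), of y] assms(4) by simp
qed

lemma orbit_closure_trans:
  assumes "flow H X a" "closed_subgroup H" "x \<in> topspace X" "y \<in> orbit_closure H X a x"
  shows "orbit_closure H X a y \<subseteq> orbit_closure H X a x"
proof (rule closure_of_minimal)
  show "orbit_of H a y \<subseteq> orbit_closure H X a x"
    using orbit_closure_invariant[OF assms] by (auto simp: orbit_of_def)
qed simp

lemma closure_of_continuous_image:
  assumes "continuous_map X Y \<phi>" "compact_space X" "Hausdorff_space Y" "S \<subseteq> topspace X"
  shows "\<phi> ` (X closure_of S) = Y closure_of (\<phi> ` S)"
proof
  show "\<phi> ` (X closure_of S) \<subseteq> Y closure_of (\<phi> ` S)"
    by (rule continuous_map_image_closure_subset[OF assms(1)])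
  have "closed_map X Y \<phi>"
    using assms by (intro continuous_imp_closed_map)
  then have "closedin Y (\<phi> ` (X closure_of S))"
    unfolding closed_map_def by simp
  moreover have "\<phi> ` S \<subseteq> \<phi> ` (X closure_of S)"
    using closure_of_subset[OF assms(4)] by blast
  ultimately show "Y closure_of (\<phi> ` S) \<subseteq> \<phi> ` (X closure_of S)"
    by (rule closure_of_minimal[rotated])
qed

lemma orbit_closure_image:
  assumes X: "flow H X a" and Y: "Hausdorff_space Y" and \<phi>: "continuous_map X Y \<phi>"
    and eq: "equivariant_on H (topspace X) a b \<phi>" and x: "x \<in> topspace X"
  shows "orbit_closure H Y b (\<phi> x) = \<phi> ` orbit_closure H X a x"
proof -
  have "orbit_of H b (\<phi> x) = \<phi> ` orbit_of H a x"
    using eq x by (force simp: orbit_of_def equivariant_on_def)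
  then show ?thesis
    using closure_of_continuous_image[OF \<phi> flow_compact[OF X] Y orbit_subset_topspace[OF X x]]
    by simp
qed

lemma closure_of_meets:
  "x \<in> X closure_of S \<Longrightarrow> openin X T \<Longrightarrow> x \<in> T \<Longrightarrow> \<exists>y\<in>S. y \<in> T"
  by (auto simp: in_closure_of)

lemma minimal_flow_orbit_closure:
  "minimal_flow H X a \<Longrightarrow> x \<in> topspace X \<Longrightarrow> orbit_closure H X a x = topspace X"
  by (simp add: minimal_flow_def)

text \<open>
  A common limit \<open>z\<close> of \<open>a g x\<close> and \<open>a g y\<close> along a filter is the same as a diagonal point in the orbit
  closure of the pair; in this form proximality passes through continuous images of compact
  flows. Conversely a diagonal limit point \<open>(z, z)\<close> yields the filter generated by the sets of group
  elements taking both points into a given neighbourhood of \<open>z\<close>.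
\<close>

lemma proximal_flow_iff:
  fixes X :: "'x topology"
  shows "proximal_flow H X a \<longleftrightarrow> flow H X a \<and>
     (\<forall>x\<in>topspace X. \<forall>y\<in>topspace X. \<exists>z.
        (z, z) \<in> orbit_closure H (prod_topology X X) (pair_action a a) (x, y))"
proof -
  have "(\<exists>F z. F \<noteq> bot \<and> F \<le> principal H \<and> limitin X (\<lambda>g. a g x) z F \<and> limitin X (\<lambda>g. a g y) z F)
      \<longleftrightarrow> (\<exists>z. (z, z) \<in> orbit_closure H (prod_topology X X) (pair_action a a) (x, y))"
    (is "?lim \<longleftrightarrow> ?cl") for x y
  proof
    assume ?lim
    then obtain F z where F: "F \<noteq> bot" "F \<le> principal H"
      "limitin X (\<lambda>g. a g x) z F" "limitin X (\<lambda>g. a g y) z F" by blast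
    have "(z, z) \<in> orbit_closure H (prod_topology X X) (pair_action a a) (x, y)"
      unfolding in_closure_of
    proof (intro conjI allI impI)
      show "(z, z) \<in> topspace (prod_topology X X)" using limitin_topspace[OF F(3)] by simp
      fix T assume "(z, z) \<in> T \<and> openin (prod_topology X X) T"
      then obtain U V where UV: "openin X U" "openin X V" "z \<in> U" "z \<in> V" "U \<times> V \<subseteq> T"
        unfolding openin_prod_topology_alt by blast
      have "\<forall>\<^sub>F g in F. g \<in> H \<and> a g x \<in> U \<and> a g y \<in> V"
        using F UV by (auto simp: limitin_def le_principal intro!: eventually_conj)
      then obtain g where "g \<in> H" "a g x \<in> U" "a g y \<in> V"
        using eventually_happens'[OF F(1)] by blast
      then show "\<exists>p. p \<in> orbit_of H (pair_action a a) (x, y) \<and> p \<in> T"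
        using UV(5) by (intro exI[of _ "(a g x, a g y)"]) (auto simp: orbit_of_def)
    qed
    then show ?cl by blast
  next
    assume ?cl
    then obtain z where z: "(z, z) \<in> orbit_closure H (prod_topology X X) (pair_action a a) (x, y)"
      by blast
    then have zX: "z \<in> topspace X" by (auto simp: in_closure_of)
    define B where "B W = {g \<in> H. a g x \<in> W \<and> a g y \<in> W}" for W
    define F where "F = (INF W\<in>{W. openin X W \<and> z \<in> W}. principal (B W))"
    have ev: "eventually P F \<longleftrightarrow> (\<exists>W\<in>{W. openin X W \<and> z \<in> W}. eventually P (principal (B W)))" for P
      unfolding F_def
    proof (rule eventually_INF_base)
      show "{W. openin X W \<and> z \<in> W} \<noteq> {}" using zX by blast
      fix V W assume "V \<in> {W. openin X W \<and> z \<in> W}" "W \<in> {W. openin X W \<and> z \<in> W}"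
      then show "\<exists>U\<in>{W. openin X W \<and> z \<in> W}. principal (B U) \<le> inf (principal (B V)) (principal (B W))"
        by (intro bexI[of _ "V \<inter> W"]) (auto simp: B_def)
    qed
    have ne: "B W \<noteq> {}" if W: "openin X W" "z \<in> W" for W
    proof -
      have "openin (prod_topology X X) (W \<times> W)" "(z, z) \<in> W \<times> W"
        using W by (auto simp: openin_prod_Times_iff)
      from closure_of_meets[OF z this]
      obtain p where p: "p \<in> orbit_of H (pair_action a a) (x, y)" "p \<in> W \<times> W" by (elim bexE)
      from p(1) obtain g where "g \<in> H" "p = (a g x, a g y)"
        unfolding orbit_of_def pair_action_simp by (elim imageE)
      then have "g \<in> B W" using p(2) unfolding B_def by simp
      then show ?thesis by blast
    qed
    have "F \<noteq> bot"
      unfolding trivial_limit_def ev eventually_principal using ne by blast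
    moreover have "F \<le> principal H"
      unfolding le_principal ev eventually_principal using zX
      by (intro bexI[of _ "topspace X"]) (simp_all add: B_def)
    moreover have "\<exists>W\<in>{W. openin X W \<and> z \<in> W}. \<forall>g\<in>B W. a g x \<in> U"
        "\<exists>W\<in>{W. openin X W \<and> z \<in> W}. \<forall>g\<in>B W. a g y \<in> U" if "openin X U \<and> z \<in> U" for U
      using that by (intro bexI[of _ U]; simp add: B_def)+
    then have "limitin X (\<lambda>g. a g x) z F" "limitin X (\<lambda>g. a g y) z F"
      unfolding limitin_def ev eventually_principal using zX by blast+
    ultimately show ?lim by (intro exI conjI)
  qed
  then show ?thesis unfolding proximal_flow_def by simp
qed

lemma minimal_proximal_pair:
  assumes H: "closed_subgroup H" and m: "minimal_flow H X a" and p: "proximal_flow H X a"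
    and xy: "x \<in> topspace X" "y \<in> topspace X" and w: "w \<in> topspace X"
  shows "(w, w) \<in> orbit_closure H (prod_topology X X) (pair_action a a) (x, y)"
proof -
  have fl: "flow H X a" using m by (simp add: minimal_flow_def)
  note flp = flow_prod[OF fl fl]
  obtain z where z: "(z, z) \<in> orbit_closure H (prod_topology X X) (pair_action a a) (x, y)"
    using p xy unfolding proximal_flow_iff by blast
  then have zX: "z \<in> topspace X" by (auto simp: in_closure_of)
  have "orbit_closure H (prod_topology X X) (pair_action a a) (z, z) = (\<lambda>x. (x, x)) ` orbit_closure H X a z"
    by (rule orbit_closure_image[OF fl flow_Hausdorff[OF flp]])
      (use zX in \<open>auto simp: equivariant_on_def intro!: continuous_map_pairedI\<close>)
  then have "(w, w) \<in> orbit_closure H (prod_topology X X) (pair_action a a) (z, z)"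
    using minimal_flow_orbit_closure[OF m zX] w by auto
  then show ?thesis
    using orbit_closure_trans[OF flp H _ z] xy by auto
qed

text \<open>
  Over a minimal proximal factor any two points can be moved simultaneously towards the fibre over a
  prescribed point. Proximality of extensions thus reduces to single fibres.
\<close>

lemma pair_moves_to_fibre:
  assumes H: "closed_subgroup H" and X: "flow H X b" and mY: "minimal_flow H Y a" and pY: "proximal_flow H Y a"
    and \<pi>: "continuous_map X Y \<pi>" "equivariant_on H (topspace X) b a \<pi>"
    and y: "y \<in> topspace Y" and z: "z \<in> topspace X"
    and st: "s \<in> orbit_closure H X b z" "t \<in> orbit_closure H X b z"
  obtains w w' where "w \<in> orbit_closure H X b z" "w' \<in> orbit_closure H X b z" "\<pi> w = y" "\<pi> w' = y"
    "(w, w') \<in> orbit_closure H (prod_topology X X) (pair_action b b) (s, t)"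
proof -
  let ?S = "orbit_closure H X b z" and ?XX = "prod_topology X X" and ?bb = "pair_action b b"
  note flXX = flow_prod[OF X X]
  have Y: "flow H Y a" using mY by (simp add: minimal_flow_def)
  have SX: "?S \<subseteq> topspace X" by (rule closure_of_subset_topspace)
  have stX: "s \<in> topspace X" "t \<in> topspace X" using st SX by auto
  define \<phi> where "\<phi> = (\<lambda>p. (\<pi> (fst p), \<pi> (snd p)))"
  have c\<phi>: "continuous_map ?XX (prod_topology Y Y) \<phi>"
    unfolding \<phi>_def using continuous_map_compose[OF continuous_map_fst \<pi>(1)] continuous_map_compose[OF continuous_map_snd \<pi>(1)]
    by (intro continuous_map_pairedI) (simp_all add: o_def)
  have "orbit_closure H (prod_topology Y Y) (pair_action a a) (\<phi> (s, t)) = \<phi> ` orbit_closure H ?XX ?bb (s, t)"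
    by (rule orbit_closure_image[OF flXX flow_Hausdorff[OF flow_prod[OF Y Y]] c\<phi>])
      (use \<pi>(2) stX in \<open>auto simp: equivariant_on_def \<phi>_def\<close>)
  moreover have "(y, y) \<in> orbit_closure H (prod_topology Y Y) (pair_action a a) (\<phi> (s, t))"
    unfolding \<phi>_def fst_conv snd_conv
    using continuous_map_image_subset_topspace[OF \<pi>(1)] stX by (intro minimal_proximal_pair[OF H mY pY _ _ y]) auto
  ultimately obtain w w' where w: "(w, w') \<in> orbit_closure H ?XX ?bb (s, t)" "\<pi> w = y" "\<pi> w' = y"
    by (auto simp: \<phi>_def)
  have "orbit_closure H ?XX ?bb (s, t) \<subseteq> ?S \<times> ?S"
  proof (rule closure_of_minimal)
    have "b g s \<in> ?S" "b g t \<in> ?S" if "g \<in> H" for g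
      using orbit_closure_invariant[OF X H z _ that] st by blast+
    then show "orbit_of H ?bb (s, t) \<subseteq> ?S \<times> ?S" unfolding orbit_of_def pair_action_simp by blast
    show "closedin ?XX (?S \<times> ?S)" by (simp add: closedin_prod_Times_iff)
  qed
  then show thesis using that w by blast
qed

text \<open>
  A criterion for the orbit closure of \<open>x\<close> to be both minimal and proximal: every pair in it can be
  driven back to \<open>(x, x)\<close>.
\<close>

lemma orbit_closure_minimal_proximal:
  assumes fl: "flow H X a" and H: "closed_subgroup H" and x: "x \<in> topspace X"
    and pair: "\<And>y z. y \<in> orbit_closure H X a x \<Longrightarrow> z \<in> orbit_closure H X a x \<Longrightarrow>
      (x, x) \<in> orbit_closure H (prod_topology X X) (pair_action a a) (y, z)"
  defines "S \<equiv> orbit_closure H X a x"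
  shows "minimal_flow H (subtopology X S) a" "proximal_flow H (subtopology X S) a"
proof -
  have SX: "S \<subseteq> topspace X" unfolding S_def by (rule closure_of_subset_topspace)
  have topS: "topspace (subtopology X S) = S" using SX by auto
  note flS = flow_orbit_closure(1)[OF fl H x, folded S_def]
  note flp = flow_prod[OF fl fl]
  have prodS: "prod_topology (subtopology X S) (subtopology X S) = subtopology (prod_topology X X) (S \<times> S)"
    by (simp add: subtopology_Times)
  have "(x, x) \<in> orbit_closure H (prod_topology (subtopology X S) (subtopology X S)) (pair_action a a) (y, z)"
    if "y \<in> S" "z \<in> S" for y z
  proof -
    have "orbit_of H (pair_action a a) (y, z) \<subseteq> S \<times> S"
      using orbit_closure_invariant[OF fl H x] that unfolding S_def by (auto simp: orbit_of_def)
    moreover have "x \<in> S" unfolding S_def by (rule orbit_closure_self[OF fl H x])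
    ultimately show ?thesis
      unfolding prodS using pair that
      by (simp add: closure_of_subtopology S_def[symmetric] Int_absorb1)
  qed
  then show "proximal_flow H (subtopology X S) a"
    unfolding proximal_flow_iff topS using flS by blast
  show "minimal_flow H (subtopology X S) a"
    unfolding minimal_flow_def topS
  proof (intro conjI ballI flS)
    fix y assume y: "y \<in> S"
    have "fst ` orbit_closure H (prod_topology X X) (pair_action a a) (y, y) = orbit_closure H X a (fst (y, y))"
      using SX y by (intro orbit_closure_image[OF flp flow_Hausdorff[OF fl], symmetric])
        (auto simp: equivariant_on_def continuous_map_fst)
    then have "x \<in> orbit_closure H X a y"
      using pair[of y y] y unfolding S_def by force
    then have "S \<subseteq> orbit_closure H X a y"
      using orbit_closure_trans[OF fl H] SX y unfolding S_def by blast
    moreover have "orbit_of H a y \<subseteq> S"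
      using orbit_closure_invariant[OF fl H x] y unfolding S_def by (auto simp: orbit_of_def)
    ultimately show "subtopology X S closure_of orbit_of H a y = S"
      by (auto simp: closure_of_subtopology Int_absorb1)
  qed
qed

text \<open>
  The pair of images of a point can be moved to the diagonal of \<open>Y\<close>; by compactness this happens at
  the images of some point of \<open>X\<close>, where the maps agree, and hence on its dense orbit.
\<close>

lemma equivariant_maps_agree:
  assumes m: "minimal_flow H X a" and p: "proximal_flow H Y b" and H: "closed_subgroup H"
    and \<phi>: "continuous_map X Y \<phi>" "equivariant_on H (topspace X) a b \<phi>"
    and \<psi>: "continuous_map X Y \<psi>" "equivariant_on H (topspace X) a b \<psi>"
    and x: "x \<in> topspace X"
  shows "\<phi> x = \<psi> x"
proof -
  have flX: "flow H X a" using m by (simp add: minimal_flow_def)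
  have flY: "flow H Y b" using p by (simp add: proximal_flow_def)
  define \<theta> where "\<theta> = (\<lambda>x. (\<phi> x, \<psi> x))"
  have \<theta>: "continuous_map X (prod_topology Y Y) \<theta>"
    unfolding \<theta>_def by (intro continuous_map_pairedI \<phi> \<psi>)
  have "\<phi> x \<in> topspace Y" "\<psi> x \<in> topspace Y"
    using \<phi>(1) \<psi>(1) x by (auto simp: continuous_map_def)
  with p obtain z where z: "(z, z) \<in> orbit_closure H (prod_topology Y Y) (pair_action b b) (\<theta> x)"
    unfolding proximal_flow_iff \<theta>_def by blast
  have "orbit_closure H (prod_topology Y Y) (pair_action b b) (\<theta> x) = \<theta> ` orbit_closure H X a x"
    using \<phi>(2) \<psi>(2) x
    by (intro orbit_closure_image[OF flX _ \<theta>] flow_Hausdorff[OF flow_prod[OF flY flY]])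
      (auto simp: equivariant_on_def \<theta>_def)
  then obtain y where y: "y \<in> topspace X" "\<phi> y = \<psi> y"
    using z minimal_flow_orbit_closure[OF m x] by (auto simp: \<theta>_def)
  define E where "E = {x \<in> topspace X. \<phi> x = \<psi> x}"
  have "closedin X E" unfolding E_def
    using \<phi>(1) \<psi>(1) flow_Hausdorff[OF flY] by (intro closedin_continuous_maps_eq)
  moreover have "orbit_of H a y \<subseteq> E"
    using y \<phi>(2) \<psi>(2) flow_action_in[OF flX _ y(1)] by (auto simp: orbit_of_def E_def equivariant_on_def)
  ultimately have "orbit_closure H X a y \<subseteq> E" by (intro closure_of_minimal)
  then show ?thesis using minimal_flow_orbit_closure[OF m y(1)] x unfolding E_def by blast
qed

lemma minimal_proximal_subflow:
  assumes p: "proximal_flow H X a" and H: "closed_subgroup H"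
  shows "\<exists>S\<subseteq>topspace X. minimal_flow H (subtopology X S) a \<and> proximal_flow H (subtopology X S) a"
proof -
  have fl: "flow H X a" using p by (simp add: proximal_flow_def)
  \<comment> \<open>The complement of a maximal member is a minimal nonempty closed invariant set.\<close>
  define \<A> where "\<A> = {U. openin X U \<and> U \<noteq> topspace X \<and> (\<forall>g\<in>H. \<forall>x\<in>topspace X - U. a g x \<notin> U)}"
  have "\<exists>M\<in>\<A>. \<forall>U\<in>\<A>. M \<subseteq> U \<longrightarrow> U = M"
  proof (rule subset_Zorn_nonempty)
    have "topspace X \<noteq> {}" using fl unfolding flow_def by blast
    then have "{} \<in> \<A>" unfolding \<A>_def using openin_empty by blast
    then show "\<A> \<noteq> {}" by blast
    fix \<C> assume ne: "\<C> \<noteq> {}" and ch: "subset.chain \<A> \<C>"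
    have sub: "\<C> \<subseteq> \<A>" using ch by (simp add: subset.chain_def)
    have "\<Union>\<C> \<noteq> topspace X"
    proof
      assume eq: "\<Union>\<C> = topspace X"
      have "\<forall>U\<in>\<C>. openin X U" using sub by (auto simp: \<A>_def)
      with eq obtain \<F> where \<F>: "finite \<F>" "\<F> \<subseteq> \<C>" "\<Union>\<F> = topspace X"
        using flow_compact[OF fl] unfolding compact_space_alt by (metis subset_refl Union_mono subset_antisym)
      have "topspace X \<noteq> {}" using fl by (simp add: flow_def)
      then have "\<F> \<noteq> {}" using \<F>(3) by (metis Union_empty)
      moreover have "subset.chain \<A> \<F>" using ch \<F>(2) unfolding subset.chain_def by blast
      ultimately have "\<Union>\<F> \<in> \<F>" by (rule Union_in_chain[OF \<F>(1)])
      then show False using \<F> sub by (auto simp: \<A>_def)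
    qed
    then show "\<Union>\<C> \<in> \<A>" using sub by (auto simp: \<A>_def)
  qed
  then obtain M where M: "M \<in> \<A>" "\<And>U. U \<in> \<A> \<Longrightarrow> M \<subseteq> U \<Longrightarrow> U = M" by blast
  then obtain x where x: "x \<in> topspace X" "x \<notin> M"
    unfolding \<A>_def using openin_subset by blast
  define S where "S = orbit_closure H X a x"
  have cl: "closedin X (topspace X - M)" using M(1) by (auto simp: \<A>_def)
  have inS: "orbit_closure H X a y \<subseteq> topspace X - M" if "y \<in> topspace X - M" for y
    using that M(1) flow_action_in[OF fl] by (intro closure_of_minimal cl) (auto simp: orbit_of_def \<A>_def)
  have eq: "orbit_closure H X a y = topspace X - M" if y: "y \<in> topspace X - M" for y
  proof -
    have "topspace X - orbit_closure H X a y \<in> \<A>"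
      using orbit_closure_self[OF fl H, of y] orbit_closure_invariant[OF fl H, of y]
        flow_action_in[OF fl] y by (auto simp: \<A>_def openin_diff)
    moreover have "M \<subseteq> topspace X - orbit_closure H X a y"
      using inS[OF y] M(1) openin_subset by (fastforce simp: \<A>_def)
    ultimately have "topspace X - orbit_closure H X a y = M" by (rule M(2))
    then show ?thesis using closure_of_subset_topspace[of X "orbit_of H a y"] by blast
  qed
  have SX: "S \<subseteq> topspace X" unfolding S_def by (rule closure_of_subset_topspace)
  have topS: "topspace (subtopology X S) = S" using SX by auto
  have "minimal_flow H (subtopology X S) a"
    unfolding minimal_flow_def topS
  proof (intro conjI ballI)
    show "flow H (subtopology X S) a" unfolding S_def by (rule flow_orbit_closure(1)[OF fl H x(1)])
    fix y assume "y \<in> S"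
    then have "orbit_closure H X a y = S" using eq x by (simp add: S_def)
    moreover have "orbit_of H a y \<subseteq> orbit_closure H X a y"
      using SX \<open>y \<in> S\<close> by (intro orbit_subset_orbit_closure[OF fl]) auto
    ultimately show "subtopology X S closure_of orbit_of H a y = S"
      by (simp add: closure_of_subtopology Int_absorb1)
  qed
  then show ?thesis using proximal_orbit_closure[OF p H x(1)] SX unfolding S_def by blast
qed


section \<open>Points with nearly open orbit map\<close>

text \<open>
  Nearly open is meant as in the open mapping theorem: images of neighbourhoods of the identity under
  the orbit map \<open>g \<mapsto> g x\<close> are dense in a neighbourhood of \<open>x\<close>. For Polish groups the points of a minimal
  flow with this property are the ones with comeager orbit, but the property is easier to verify.
\<close>

definition nearly_open_point ::
  "'x topology \<Rightarrow> ('g::topological_group_add \<Rightarrow> 'x \<Rightarrow> 'x) \<Rightarrow> 'x \<Rightarrow> bool" where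
  "nearly_open_point X a x \<longleftrightarrow> x \<in> topspace X \<and>
     (\<forall>U. open U \<and> 0 \<in> U \<longrightarrow> x \<in> X interior_of (X closure_of ((\<lambda>g. a g x) ` U)))"

lemma flow_act_inverse:
  assumes "flow UNIV X a" "x \<in> topspace X"
  shows "a (- g) (a g x) = x" "a g (a (- g) x) = x"
  using flow_add[OF assms, of "- g" g] flow_add[OF assms, of g "- g"] flow_zero[OF assms] by auto

lemma flow_act_in:
  "flow UNIV X a \<Longrightarrow> x \<in> topspace X \<Longrightarrow> a g x \<in> topspace X"
  by (simp add: flow_action_in)

lemma interior_of_mem: "x \<in> X interior_of S \<Longrightarrow> x \<in> S"
  by (rule subsetD[OF interior_of_subset])

lemma flow_homeomorphic_act:
  assumes "flow UNIV X a"
  shows "homeomorphic_map X X (a g)"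
proof -
  have "homeomorphic_maps X X (a g) (a (- g))"
    unfolding homeomorphic_maps_def
    using flow_continuous_act[OF assms] flow_act_inverse[OF assms] by auto
  then show ?thesis using homeomorphic_map_maps by blast
qed

lemma flow_image_act:
  assumes "flow UNIV X a" "x \<in> topspace X"
  shows "(\<lambda>h. a (g + h) x) ` U = a g ` ((\<lambda>h. a h x) ` U)"
  unfolding image_image using flow_add[OF assms] by auto

lemma flow_act_closure:
  assumes "flow UNIV X a" "x \<in> topspace X"
  shows "a g ` (X closure_of ((\<lambda>h. a h x) ` U)) = X closure_of ((\<lambda>h. a (g + h) x) ` U)"
  unfolding flow_image_act[OF assms]
  by (rule homeomorphic_map_closure_of[OF flow_homeomorphic_act[OF assms(1)], symmetric])
    (use flow_act_in[OF assms] in blast)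

lemma flow_act_interior_closure:
  assumes "flow UNIV X a" "x \<in> topspace X"
  shows "a g ` (X interior_of (X closure_of ((\<lambda>h. a h x) ` U)))
    = X interior_of (X closure_of ((\<lambda>h. a (g + h) x) ` U))"
  unfolding flow_act_closure[OF assms, symmetric]
  by (rule homeomorphic_map_interior_of[OF flow_homeomorphic_act[OF assms(1)], symmetric])
    (rule closure_of_subset_topspace)

lemma nearly_open_point_translate:
  assumes fl: "flow UNIV X a" and x: "nearly_open_point X a x" and V: "open V" "g \<in> V"
  shows "a g x \<in> X interior_of (X closure_of ((\<lambda>h. a h x) ` V))"
proof -
  have xX: "x \<in> topspace X" using x by (simp add: nearly_open_point_def)
  define U where "U = {h. g + h \<in> V}"
  have "open U" "0 \<in> U" using V by (auto simp: U_def intro: open_group_vimage)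
  then have "x \<in> X interior_of (X closure_of ((\<lambda>h. a h x) ` U))"
    using x by (simp add: nearly_open_point_def)
  then have "a g x \<in> a g ` (X interior_of (X closure_of ((\<lambda>h. a h x) ` U)))" by blast
  also have "\<dots> = X interior_of (X closure_of ((\<lambda>h. a (g + h) x) ` U))"
    by (rule flow_act_interior_closure[OF fl xX])
  also have "(\<lambda>h. a (g + h) x) ` U = (\<lambda>h. a h x) ` V"
  proof -
    have "V = (\<lambda>h. g + h) ` U"
      unfolding U_def by (auto intro!: image_eqI[of _ _ "- g + _"] simp: add.assoc[symmetric])
    then show ?thesis by (simp add: image_image)
  qed
  finally show ?thesis .
qed

lemma nearly_open_point_act:
  assumes fl: "flow UNIV X a" and x: "nearly_open_point X a x"
  shows "nearly_open_point X a (a g x)"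
  unfolding nearly_open_point_def
proof (intro conjI allI impI)
  have xX: "x \<in> topspace X" using x by (simp add: nearly_open_point_def)
  then show "a g x \<in> topspace X" by (rule flow_act_in[OF fl])
  fix U :: "'a set" assume U: "open U \<and> 0 \<in> U"
  define V where "V = {h. h + - g \<in> U}"
  have V: "open V" "g \<in> V" using U by (auto simp: V_def intro: open_group_vimage(2)[of U "- g", simplified])
  have "(\<lambda>h. a h x) ` V = (\<lambda>h. a h (a g x)) ` U"
  proof
    show "(\<lambda>h. a h x) ` V \<subseteq> (\<lambda>h. a h (a g x)) ` U"
    proof
      fix y assume "y \<in> (\<lambda>h. a h x) ` V"
      then obtain h where h: "h - g \<in> U" "y = a h x" by (auto simp: V_def)
      moreover have "a h x = a (h - g) (a g x)"
        using flow_add[OF fl xX, of "h - g" g] by simp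
      ultimately show "y \<in> (\<lambda>h. a h (a g x)) ` U" by blast
    qed
    show "(\<lambda>h. a h (a g x)) ` U \<subseteq> (\<lambda>h. a h x) ` V"
    proof
      fix y assume "y \<in> (\<lambda>h. a h (a g x)) ` U"
      then obtain h where h: "h \<in> U" "y = a (h + g) x" using flow_add[OF fl xX] by auto
      moreover have "h + g \<in> V" using h by (simp add: V_def add.assoc)
      ultimately show "y \<in> (\<lambda>h. a h x) ` V" by blast
    qed
  qed
  then show "a g x \<in> X interior_of (X closure_of ((\<lambda>h. a h (a g x)) ` U))"
    using nearly_open_point_translate[OF fl x V] by simp
qed

lemma geometric_steps_limit:
  fixes f :: "nat \<Rightarrow> 'a::complete_space"
  assumes step: "\<And>n. dist (f n) (f (Suc n)) < \<delta> / 2 ^ n" and "\<delta> > 0"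
  obtains l where "f \<longlonglongrightarrow> l" "\<And>n. dist (f n) l \<le> 2 * \<delta> / 2 ^ n"
proof -
  have tele: "dist (f m) (f (m + k)) \<le> 2 * \<delta> / 2 ^ m - 2 * \<delta> / 2 ^ (m + k)" for m k
  proof (induction k)
    case (Suc k)
    have "dist (f m) (f (m + Suc k)) \<le> dist (f m) (f (m + k)) + dist (f (m + k)) (f (m + Suc k))"
      by (rule dist_triangle)
    also have "\<dots> \<le> 2 * \<delta> / 2 ^ m - 2 * \<delta> / 2 ^ (m + k) + \<delta> / 2 ^ (m + k)"
      using Suc step[of "m + k"] by simp
    also have "\<dots> = 2 * \<delta> / 2 ^ m - 2 * \<delta> / 2 ^ (m + Suc k)" by (simp add: field_simps)
    finally show ?case .
  qed simp
  have le: "dist (f m) (f n) \<le> 2 * \<delta> / 2 ^ m" if "m \<le> n" for m n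
  proof -
    have "2 * \<delta> / 2 ^ m - 2 * \<delta> / 2 ^ n \<le> 2 * \<delta> / 2 ^ m" using \<open>\<delta> > 0\<close> by simp
    then show ?thesis using tele[of m "n - m"] that by simp
  qed
  have "Cauchy f"
  proof (rule metric_CauchyI)
    fix e :: real assume "e > 0"
    then obtain M where M: "(1/2) ^ M < e / (4 * \<delta>)"
      using real_arch_pow_inv[of "e / (4 * \<delta>)" "1/2"] \<open>\<delta> > 0\<close> by auto
    have "dist (f m) (f n) < e" if "M \<le> m" "M \<le> n" for m n
    proof -
      have "dist (f m) (f n) \<le> dist (f M) (f m) + dist (f M) (f n)" by (rule dist_triangle3)
      also have "\<dots> \<le> 2 * \<delta> / 2 ^ M + 2 * \<delta> / 2 ^ M" using le[OF that(1)] le[OF that(2)] by simp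
      also have "\<dots> < e" using M \<open>\<delta> > 0\<close> by (simp add: field_simps power_one_over)
      finally show ?thesis .
    qed
    then show "\<exists>M. \<forall>m\<ge>M. \<forall>n\<ge>M. dist (f m) (f n) < e" by blast
  qed
  then obtain l where l: "f \<longlonglongrightarrow> l" using Cauchy_convergent convergent_def by blast
  have "dist (f n) l \<le> 2 * \<delta> / 2 ^ n" for n
  proof (rule Lim_bounded)
    show "(\<lambda>k. dist (f n) (f k)) \<longlonglongrightarrow> dist (f n) l" by (intro tendsto_intros l)
    show "\<forall>k\<ge>n. dist (f n) (f k) \<le> 2 * \<delta> / 2 ^ n" using le by blast
  qed
  with l show thesis by (rule that)
qed

lemma open_orbit_preimage:
  assumes "flow UNIV X a" "x \<in> topspace X" "openin X A"
  shows "open {g. a g x \<in> A}"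
  using openin_continuous_map_preimage[OF flow_continuous_orbit_map[OF assms(1,2)] assms(3)]
  by simp

text \<open>
  The sets \<open>closure (B(w\<^sub>n, s\<^sub>n) y)\<close> shrink onto \<open>w0 y\<close>: by continuity of the action, for large \<open>n\<close> the
  whole closure lies in a prescribed closed neighbourhood of \<open>w0 y\<close>.
\<close>

lemma shrinking_closures_limit:
  fixes a :: "'g::{topological_group_add, metric_space} \<Rightarrow> 'x \<Rightarrow> 'x"
  assumes fl: "flow UNIV X a" and y: "y \<in> topspace X" and z: "z \<in> topspace X"
    and w: "w \<longlonglongrightarrow> w0" and z': "limitin X z' z sequentially" and s: "s \<longlonglongrightarrow> (0::real)"
    and cl: "\<And>n. z' n \<in> X closure_of ((\<lambda>g. a g y) ` ball (w n) (s n))"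
  shows "z = a w0 y"
proof (rule ccontr)
  assume "z \<noteq> a w0 y"
  moreover have wy: "a w0 y \<in> topspace X" by (rule flow_act_in[OF fl y])
  ultimately obtain A B where AB: "openin X A" "openin X B" "z \<in> A" "a w0 y \<in> B" "disjnt A B"
    using flow_Hausdorff[OF fl] z unfolding Hausdorff_space_def by blast
  have "open {g. a g y \<in> B}" by (rule open_orbit_preimage[OF fl y AB(2)])
  then obtain e where e: "e > 0" "ball w0 e \<subseteq> {g. a g y \<in> B}"
    using AB(4) by (auto simp: open_contains_ball)
  have "\<forall>\<^sub>F n in sequentially. dist (w n) w0 < e / 2"
    using w half_gt_zero[OF e(1)] unfolding tendsto_iff by blast
  moreover have "\<forall>\<^sub>F n in sequentially. s n < e / 2"
    using order_tendstoD(2)[OF s half_gt_zero[OF e(1)]] .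
  moreover have "\<forall>\<^sub>F n in sequentially. z' n \<in> A"
    by (rule limitinD[OF z' AB(1,3)])
  ultimately have "\<forall>\<^sub>F n in sequentially. dist (w n) w0 < e / 2 \<and> s n < e / 2 \<and> z' n \<in> A"
    by (intro eventually_conj)
  then obtain n where n: "dist (w n) w0 < e / 2" "s n < e / 2" "z' n \<in> A"
    using eventually_happens' sequentially_bot by blast
  from closure_of_meets[OF cl AB(1) n(3)]
  obtain g where g: "dist (w n) g < s n" "a g y \<in> A" by auto
  have "dist w0 g < e"
    using dist_triangle[of w0 g "w n"] g(1) n(1,2) by (simp add: dist_commute)
  then have "a g y \<in> B" using e(2) by auto
  then show False using g(2) AB(5) by (auto simp: disjnt_iff)
qed

text \<open>
  An open mapping theorem of Effros type. From nearly open to open: approximate alternately from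
  both sides, choosing \<open>w\<^sub>n\<close> with \<open>w\<^sub>n y\<close> close to \<open>v\<^sub>n x\<close>, then \<open>v\<^sub>n\<^sub>+\<^sub>1\<close> with \<open>v\<^sub>n\<^sub>+\<^sub>1 x\<close> close to \<open>w\<^sub>n y\<close>,
  with steps shrinking geometrically in a complete metric of the group.
\<close>

lemma nearly_open_points_same_orbit:
  fixes a :: "'g::{topological_group_add, complete_space} \<Rightarrow> 'x \<Rightarrow> 'x"
  assumes fl: "flow UNIV X a" and x: "nearly_open_point X a x" and U: "open U" "0 \<in> U"
  shows "\<exists>V. open V \<and> 0 \<in> V \<and>
    (\<forall>y. nearly_open_point X a y \<and> y \<in> X closure_of ((\<lambda>g. a g x) ` V) \<longrightarrow> (\<exists>u\<in>U. y = a u x))"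
proof -
  define I where "I z g r = X interior_of (X closure_of ((\<lambda>h. a h z) ` ball g r))" for z and g :: 'g and r
  have xX: "x \<in> topspace X" using x by (simp add: nearly_open_point_def)
  have "0 + 0 \<in> U" using U by simp
  with U(1) obtain A B where AB: "open A" "0 \<in> A" "open B" "0 \<in> B"
    "\<And>v w. v \<in> A \<Longrightarrow> w \<in> B \<Longrightarrow> v + w \<in> U" by (rule open_add_rectangle) blast
  have "open ({w. - w \<in> A} \<inter> B)" "0 \<in> {w. - w \<in> A} \<inter> B"
    using AB by (auto intro: open_group_vimage)
  then obtain e where e: "e > 0" "ball 0 e \<subseteq> {w. - w \<in> A} \<inter> B"
    unfolding open_contains_ball by blast
  \<comment> \<open>The construction starts within \<open>\<delta>\<close> of \<open>0\<close> and moves by at most \<open>2 \<delta>\<close>, so it stays in the ball of radius \<open>e\<close>.\<close>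
  define \<delta> where "\<delta> = e / 4"
  have \<delta>: "\<delta> > 0" using e(1) by (simp add: \<delta>_def)
  have "\<exists>u\<in>U. y = a u x" if y: "nearly_open_point X a y" "y \<in> X closure_of ((\<lambda>g. a g x) ` ball 0 \<delta>)" for y
  proof -
    have yX: "y \<in> topspace X" using y by (simp add: nearly_open_point_def)
    have self: "a g z \<in> I z g r" if "nearly_open_point X a z" "r > 0" for g z r
      unfolding I_def using nearly_open_point_translate[OF fl that(1), of "ball g r" g] that(2) by simp
    have meet: "\<exists>h\<in>ball g r. a h z \<in> I z' g' r'" if "p \<in> I z g r" "p \<in> I z' g' r'" for p z g r z' g' r'
    proof -
      have "p \<in> X closure_of ((\<lambda>h. a h z) ` ball g r)"
        using that(1) unfolding I_def by (rule interior_of_mem)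
      from closure_of_meets[OF this _ that(2)] show ?thesis unfolding I_def by auto
    qed
    have "y \<in> I y 0 \<delta>" using self[OF y(1) \<delta>, of 0] flow_zero[OF fl yX] by simp
    from closure_of_meets[OF y(2) _ this] obtain v0 where v0: "dist 0 v0 < \<delta>" "a v0 x \<in> I y 0 \<delta>"
      unfolding I_def by auto
    \<comment> \<open>The first conjunct pins the starting point of the sequence, which the choice principle leaves open.\<close>
    define R where "R n p \<longleftrightarrow> (n = 0 \<longrightarrow> p = (v0, 0)) \<and> a (fst p) x \<in> I y (snd p) (\<delta> / 2 ^ n)"
      for n :: nat and p
    have "\<exists>f. \<forall>n. R n (f n) \<and> (dist (fst (f n)) (fst (f (Suc n))) < \<delta> / 2 ^ n \<and>
      dist (snd (f n)) (snd (f (Suc n))) < \<delta> / 2 ^ n)"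
    proof (rule dependent_nat_choice)
      show "\<exists>p. R 0 p" using v0 by (intro exI[of _ "(v0, 0)"]) (simp add: R_def)
      fix p n assume p: "R n p"
      define s where "s = \<delta> / 2 ^ n"
      have s: "s > 0" "\<delta> / 2 ^ Suc n = s / 2" using \<delta> by (auto simp: s_def)
      have "a (fst p) x \<in> I y (snd p) s" using p by (simp add: R_def s_def)
      from meet[OF this self[OF x s(1)]] obtain w where w: "w \<in> ball (snd p) s" "a w y \<in> I x (fst p) s" by blast
      from meet[OF w(2) self[OF y(1), of "s/2"]] s(1)
      obtain v where v: "v \<in> ball (fst p) s" "a v x \<in> I y w (s / 2)" by auto
      show "\<exists>q. R (Suc n) q \<and> dist (fst p) (fst q) < \<delta> / 2 ^ n \<and> dist (snd p) (snd q) < \<delta> / 2 ^ n"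
        using v w by (intro exI[of _ "(v, w)"]) (simp add: R_def s s_def[symmetric] del: power_Suc)
    qed
    then obtain f where f: "\<And>n. R n (f n)" "\<And>n. dist (fst (f n)) (fst (f (Suc n))) < \<delta> / 2 ^ n"
      "\<And>n. dist (snd (f n)) (snd (f (Suc n))) < \<delta> / 2 ^ n" by blast
    from geometric_steps_limit[OF f(2) \<delta>] obtain v where v: "(\<lambda>n. fst (f n)) \<longlonglongrightarrow> v"
      "\<And>n. dist (fst (f n)) v \<le> 2 * \<delta> / 2 ^ n" by blast
    from geometric_steps_limit[OF f(3) \<delta>] obtain w where w: "(\<lambda>n. snd (f n)) \<longlonglongrightarrow> w"
      "\<And>n. dist (snd (f n)) w \<le> 2 * \<delta> / 2 ^ n" by blast
    have eq: "a v x = a w y"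
    proof (rule shrinking_closures_limit[OF fl yX flow_act_in[OF fl xX] w(1)])
      show "limitin X (\<lambda>n. a (fst (f n)) x) (a v x) sequentially"
        using continuous_map_limit[OF flow_continuous_orbit_map[OF fl xX], of "\<lambda>n. fst (f n)" v sequentially] v(1)
        by (simp add: o_def)
      show "(\<lambda>n. \<delta> / 2 ^ n) \<longlonglongrightarrow> 0"
        using tendsto_mult_right_zero[OF LIMSEQ_realpow_zero[of "1/2"], of \<delta>]
        by (simp add: power_one_over field_simps)
      show "a (fst (f n)) x \<in> X closure_of ((\<lambda>g. a g y) ` ball (snd (f n)) (\<delta> / 2 ^ n))" for n
        using f(1)[of n] unfolding R_def I_def by (blast dest: interior_of_mem)
    qed
    have "f 0 = (v0, 0)" using f(1)[of 0] by (simp add: R_def)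
    then have "dist v0 v \<le> 2 * \<delta>" "dist 0 w \<le> 2 * \<delta>" using v(2)[of 0] w(2)[of 0] by auto
    then have "dist 0 v < e" "dist 0 w < e"
      using v0(1) dist_triangle[of 0 v v0] \<delta> by (auto simp: \<delta>_def)
    then have "- w \<in> A" "v \<in> B" using e(2) by auto
    then have "- w + v \<in> U" by (rule AB(5))
    moreover have "y = a (- w + v) x"
      using flow_add[OF fl xX, of "- w" v] eq flow_act_inverse(1)[OF fl yX, of w] by simp
    ultimately show ?thesis by blast
  qed
  then show ?thesis using \<delta> by (intro exI[of _ "ball 0 \<delta>"]) auto
qed

definition stabilizer :: "('g \<Rightarrow> 'x \<Rightarrow> 'x) \<Rightarrow> 'x \<Rightarrow> 'g set" where
  "stabilizer a x = {g. a g x = x}"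

lemma closed_subgroup_stabilizer:
  assumes fl: "flow UNIV X a" and x: "x \<in> topspace X"
  shows "closed_subgroup (stabilizer a x)"
  unfolding closed_subgroup_def
proof (intro conjI ballI)
  have "closedin X {x}" using flow_Hausdorff[OF fl] x by (simp add: closedin_Hausdorff_singleton)
  from closedin_continuous_map_preimage[OF flow_continuous_orbit_map[OF fl x] this]
  show "closed (stabilizer a x)" by (simp add: stabilizer_def)
  show "0 \<in> stabilizer a x" using flow_zero[OF fl x] by (simp add: stabilizer_def)
  show "g + h \<in> stabilizer a x" if "g \<in> stabilizer a x" "h \<in> stabilizer a x" for g h
    using that flow_add[OF fl x] by (simp add: stabilizer_def)
  show "- g \<in> stabilizer a x" if "g \<in> stabilizer a x" for g
    using that flow_act_inverse(1)[OF fl x, of g] by (simp add: stabilizer_def)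
qed

text \<open>
  The form in which openness is used below: whatever moves \<open>x\<close> little is a small perturbation of an
  element of the stabilizer.
\<close>

lemma effros_open_orbit_map:
  fixes a :: "'g::{topological_group_add, complete_space} \<Rightarrow> 'x \<Rightarrow> 'x"
  assumes fl: "flow UNIV X a" and x: "nearly_open_point X a x" and U: "open U" "0 \<in> U"
  shows "\<exists>W. openin X W \<and> x \<in> W \<and>
    (\<forall>g. a g x \<in> W \<longrightarrow> (\<exists>u\<in>U. \<exists>k\<in>stabilizer a x. g = u + k))"
proof -
  have xX: "x \<in> topspace X" using x by (simp add: nearly_open_point_def)
  obtain V where V: "open V" "0 \<in> V"
    "\<And>y. nearly_open_point X a y \<Longrightarrow> y \<in> X closure_of ((\<lambda>g. a g x) ` V) \<Longrightarrow> \<exists>u\<in>U. y = a u x"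
    using nearly_open_points_same_orbit[OF fl x U] by blast
  define W where "W = X interior_of (X closure_of ((\<lambda>g. a g x) ` V))"
  have "x \<in> W" using x V(1,2) by (simp add: nearly_open_point_def W_def)
  moreover have "\<exists>u\<in>U. \<exists>k\<in>stabilizer a x. g = u + k" if "a g x \<in> W" for g
  proof -
    have "a g x \<in> X closure_of ((\<lambda>g. a g x) ` V)" using that unfolding W_def by (rule interior_of_mem)
    from V(3)[OF nearly_open_point_act[OF fl x] this] obtain u where u: "u \<in> U" "a g x = a u x" by blast
    have "a (- u + g) x = x"
      using flow_add[OF fl xX, of "- u" g] u(2) flow_act_inverse(1)[OF fl xX] by simp
    then show ?thesis using u(1)
      by (intro bexI[of _ u] bexI[of _ "- u + g"]) (auto simp: stabilizer_def add.assoc[symmetric])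
  qed
  ultimately show ?thesis by (intro exI[of _ W]) (auto simp: W_def)
qed

section \<open>Comeager orbits are orbits of nearly open points\<close>

lemma flow_nonmeager:
  assumes fl: "flow H X a" and \<N>: "countable \<N>" "\<And>N. N \<in> \<N> \<Longrightarrow> X interior_of (X closure_of N) = {}"
    and W: "openin X W" "W \<noteq> {}"
  shows "\<not> W \<subseteq> \<Union>\<N>"
proof
  assume sub: "W \<subseteq> \<Union>\<N>"
  have "X interior_of \<Union>((\<lambda>N. X closure_of N) ` \<N>) = {}"
  proof (rule Baire_category_alt)
    show "completely_metrizable_space X \<or> locally_compact_space X \<and> regular_space X"
      using fl by (simp add: flow_def compact_imp_locally_compact_space compact_Hausdorff_imp_regular_space)
  qed (use \<N> in auto)
  moreover have "W \<subseteq> \<Union>((\<lambda>N. X closure_of N) ` \<N>)"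
  proof
    fix x assume x: "x \<in> W"
    then obtain N where N: "N \<in> \<N>" "x \<in> N" using sub by blast
    moreover have "x \<in> topspace X" using x W(1) openin_subset by blast
    ultimately have "x \<in> X closure_of N" by (auto simp: in_closure_of)
    then show "x \<in> \<Union>((\<lambda>N. X closure_of N) ` \<N>)" using N(1) by blast
  qed
  ultimately show False using W interior_of_maximal by blast
qed

text \<open>
  By the Baire category theorem one of the countably many translates of the closure of \<open>V x\<close> has
  interior points. So \<open>closure (V x)\<close> has an interior point \<open>v x\<close>, and translating back by \<open>-v\<close> puts \<open>x\<close>
  into the interior of the closure of \<open>(-V + V) x\<close>.
\<close>

lemma nearly_open_point_of_countable_cover:
  fixes a :: "'g::topological_group_add \<Rightarrow> 'x \<Rightarrow> 'x"
  assumes fl: "flow UNIV X a" and x: "x \<in> topspace X"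
    and \<N>: "countable \<N>" "\<And>N. N \<in> \<N> \<Longrightarrow> X interior_of (X closure_of N) = {}"
    and cover: "\<And>V. open V \<Longrightarrow> 0 \<in> V \<Longrightarrow>
      \<exists>Q. countable Q \<and> topspace X \<subseteq> \<Union>\<N> \<union> (\<Union>q\<in>Q. X closure_of ((\<lambda>g. a (q + g) x) ` V))"
  shows "nearly_open_point X a x"
  unfolding nearly_open_point_def
proof (intro conjI allI impI x)
  fix U :: "'g set" assume "open U \<and> 0 \<in> U"
  from zero_nhd_threefold[OF conjunct1[OF this] conjunct2[OF this]]
  obtain V where V: "open V" "0 \<in> V" "\<forall>v\<in>V. - v \<in> V"
      "\<forall>a\<in>V. \<forall>b\<in>V. \<forall>c\<in>V. a + b + c \<in> U"
    by (elim exE conjE)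
  obtain Q where Q: "countable Q"
    "topspace X \<subseteq> \<Union>\<N> \<union> (\<Union>q\<in>Q. X closure_of ((\<lambda>g. a (q + g) x) ` V))" using cover[OF V(1,2)] by blast
  have orb: "(\<lambda>g. a g x) ` S \<subseteq> topspace X" for S using flow_act_in[OF fl x] by blast
  define C where "C = X closure_of ((\<lambda>g. a g x) ` V)"
  have CX: "C \<subseteq> topspace X" unfolding C_def by (rule closure_of_subset_topspace)
  have Cq: "X closure_of ((\<lambda>g. a (q + g) x) ` V) = a q ` C" for q
    unfolding C_def by (rule flow_act_closure[OF fl x, symmetric])
  have "X interior_of C \<noteq> {}"
  proof
    assume e: "X interior_of C = {}"
    have "X interior_of (a q ` C) = {}" for q
      using homeomorphic_map_interior_of[OF flow_homeomorphic_act[OF fl] CX] e by simp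
    then have nd: "X interior_of (X closure_of (a q ` C)) = {}" for q
      using Cq[of q] closure_of_closure_of by metis
    have "\<not> topspace X \<subseteq> \<Union>(\<N> \<union> (\<lambda>q. a q ` C) ` Q)"
    proof (rule flow_nonmeager[OF fl])
      show "countable (\<N> \<union> (\<lambda>q. a q ` C) ` Q)" using \<N>(1) Q(1) by simp
      show "topspace X \<noteq> {}" using x by blast
    qed (use \<N>(2) nd in auto)
    then show False using Q(2) unfolding Cq by auto
  qed
  then obtain p where p: "p \<in> X interior_of C" by blast
  then have "p \<in> C" by (rule interior_of_mem)
  from closure_of_meets[OF this[unfolded C_def] _ p] obtain v where v: "v \<in> V" "a v x \<in> X interior_of C" by auto
  have vC: "a (- v) ` (X interior_of C) = X interior_of (X closure_of ((\<lambda>g. a (- v + g) x) ` V))"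
    unfolding C_def by (rule flow_act_interior_closure[OF fl x])
  have "- v + g \<in> U" if "g \<in> V" for g using V(4)[rule_format, of "- v" g 0] V(2,3) v(1) that by simp
  then have "(\<lambda>g. a (- v + g) x) ` V \<subseteq> (\<lambda>g. a g x) ` U" by auto
  then have "X interior_of (X closure_of ((\<lambda>g. a (- v + g) x) ` V)) \<subseteq> X interior_of (X closure_of ((\<lambda>g. a g x) ` U))"
    by (intro interior_of_mono closure_of_mono)
  moreover have "x = a (- v) (a v x)" using flow_act_inverse(1)[OF fl x] by simp
  then have "x \<in> a (- v) ` (X interior_of C)" using v(2) by (rule image_eqI)
  ultimately show "x \<in> X interior_of (X closure_of ((\<lambda>g. a g x) ` U))" using vC by blast
qed

lemma countable_translates_cover:
  fixes V :: "'g::{topological_group_add, second_countable_topology} set"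
  assumes "open V" "0 \<in> V"
  shows "\<exists>Q. countable Q \<and> (\<forall>g. \<exists>q\<in>Q. \<exists>v\<in>V. g = q + v)"
proof -
  obtain D :: "'g set" where D: "countable D" "\<And>X. open X \<Longrightarrow> X \<noteq> {} \<Longrightarrow> \<exists>d\<in>D. d \<in> X"
    using countable_dense_setE by blast
  have "\<exists>q\<in>D. \<exists>v\<in>V. g = q + v" for g
  proof -
    have "open {x. - x \<in> {y. y + g \<in> V}}" using assms by (intro open_group_vimage)
    moreover have "g \<in> {x. - x \<in> {y. y + g \<in> V}}" using assms by simp
    ultimately obtain d where "d \<in> D" "- d + g \<in> V" using D(2) by blast
    then show ?thesis by (intro bexI[of _ d] bexI[of _ "- d + g"]) (auto simp: add.assoc[symmetric])
  qed
  then show ?thesis using D(1) by blast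
qed

lemma comeager_orbit_imp_nearly_open:
  fixes a :: "'g::{topological_group_add, second_countable_topology} \<Rightarrow> 'x \<Rightarrow> 'x"
  assumes fl: "flow UNIV X a" and x: "x \<in> topspace X" and cm: "comeager_in X (orbit_of UNIV a x)"
  shows "nearly_open_point X a x"
proof -
  obtain \<N> where \<N>: "countable \<N>" "\<And>N. N \<in> \<N> \<Longrightarrow> X interior_of (X closure_of N) = {}"
    "topspace X - orbit_of UNIV a x \<subseteq> \<Union>\<N>" using cm unfolding comeager_in_def by blast
  show ?thesis
  proof (rule nearly_open_point_of_countable_cover[OF fl x \<N>(1,2)])
    fix V :: "'g set" assume "open V" "0 \<in> V"
    then obtain Q where Q: "countable Q" "\<And>g. \<exists>q\<in>Q. \<exists>v\<in>V. g = q + v"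
      using countable_translates_cover by blast
    have cl: "(\<lambda>g. a (q + g) x) ` V \<subseteq> X closure_of ((\<lambda>g. a (q + g) x) ` V)" for q
      by (rule closure_of_subset) (use flow_act_in[OF fl x] in blast)
    have "orbit_of UNIV a x \<subseteq> (\<Union>q\<in>Q. X closure_of ((\<lambda>g. a (q + g) x) ` V))"
    proof
      fix y assume "y \<in> orbit_of UNIV a x"
      then obtain g where g: "y = a g x" by (auto simp: orbit_of_def)
      obtain q v where "q \<in> Q" "v \<in> V" "y = a (q + v) x" using Q(2)[of g] unfolding g by blast
      then show "y \<in> (\<Union>q\<in>Q. X closure_of ((\<lambda>g. a (q + g) x) ` V))" using cl by blast
    qed
    then show "\<exists>Q. countable Q \<and> topspace X \<subseteq> \<Union>\<N> \<union> (\<Union>q\<in>Q. X closure_of ((\<lambda>g. a (q + g) x) ` V))"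
      using Q(1) \<N>(3) by blast
  qed
qed

text \<open>
  A point outside the countably many exceptional sets can be followed down a tree of sets
  \<open>int (closure (B(q\<^sub>n, 2\<^sup>-\<^sup>n) x))\<close> with \<open>q\<^sub>n\<close> in a countable dense set and \<open>d(q\<^sub>n, q\<^sub>n\<^sub>+\<^sub>1) < 2\<^sup>-\<^sup>n\<close>; it is then
  \<open>g x\<close> for \<open>g = lim q\<^sub>n\<close>.
\<close>

lemma nearly_open_imp_comeager_orbit:
  fixes a :: "'g::{topological_group_add, polish_space} \<Rightarrow> 'x \<Rightarrow> 'x"
  assumes fl: "flow UNIV X a" and x: "nearly_open_point X a x"
    and dense: "orbit_closure UNIV X a x = topspace X"
  shows "comeager_in X (orbit_of UNIV a x)"
proof -
  have xX: "x \<in> topspace X" using x by (simp add: nearly_open_point_def)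
  obtain D :: "'g set" where D: "countable D" "\<And>X. open X \<Longrightarrow> X \<noteq> {} \<Longrightarrow> \<exists>d\<in>D. d \<in> X"
    using countable_dense_setE by blast
  define B where "B n q = ball q (1 / 2 ^ n :: real)" for n :: nat and q :: 'g
  define I where "I n q = X interior_of (X closure_of ((\<lambda>h. a h x) ` B n q))" for n :: nat and q :: 'g
  have self: "a q x \<in> I n q" for n q
    unfolding I_def by (rule nearly_open_point_translate[OF fl x]) (auto simp: B_def)
  have oI: "openin X (I n q)" for n q unfolding I_def by simp
  have orbD: "a g x \<in> topspace X" for g by (rule flow_act_in[OF fl xX])
  define T where "T n q = (\<Union>p\<in>D \<inter> B n q. I (Suc n) p)" for n q
  have oT: "openin X (T n q)" for n q unfolding T_def using oI by blast
  define T0 where "T0 = (\<Union>p\<in>D. I 0 p)"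
  have oT0: "openin X T0" unfolding T0_def using oI by blast
  \<comment> \<open>By density of \<open>D\<close>, the closure of a set containing \<open>q x\<close> for all \<open>q \<in> D \<inter> V\<close> contains \<open>V x\<close>.\<close>
  have dns: "(\<lambda>h. a h x) ` V \<subseteq> X closure_of O'" if V: "open V" and O': "\<And>q. q \<in> D \<Longrightarrow> q \<in> V \<Longrightarrow> a q x \<in> O'" for V O'
  proof
    fix y assume "y \<in> (\<lambda>h. a h x) ` V"
    then obtain g where g: "g \<in> V" "y = a g x" by blast
    show "y \<in> X closure_of O'"
      unfolding in_closure_of
    proof (intro conjI allI impI)
      show "y \<in> topspace X" using g orbD by simp
      fix W assume W: "y \<in> W \<and> openin X W"
      then have "open (V \<inter> {h. a h x \<in> W})" using V open_orbit_preimage[OF fl xX] by blast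
      moreover have "g \<in> V \<inter> {h. a h x \<in> W}" using g W by simp
      ultimately obtain q where "q \<in> D" "q \<in> V \<inter> {h. a h x \<in> W}" using D(2) by blast
      then show "\<exists>z. z \<in> O' \<and> z \<in> W" using O' by blast
    qed
  qed
  define \<N> where "\<N> = insert (topspace X - T0) ((\<lambda>(n, q). I n q - T n q) ` (UNIV \<times> D))"
  have "countable \<N>" unfolding \<N>_def using D(1) by simp
  moreover have "X interior_of (X closure_of N) = {}" if "N \<in> \<N>" for N
  proof -
    have T0: "X closure_of T0 = topspace X"
    proof -
      have "(\<lambda>h. a h x) ` UNIV \<subseteq> X closure_of T0"
        by (rule dns) (use self in \<open>auto simp: T0_def\<close>)
      then have "topspace X \<subseteq> X closure_of T0"
        using dense closure_of_minimal[of "orbit_of UNIV a x" "X closure_of T0" X] by (simp add: orbit_of_def)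
      then show ?thesis using closure_of_subset_topspace[of X T0] by blast
    qed
    have IT: "I n q \<subseteq> X closure_of (T n q)" for n q
    proof -
      have "(\<lambda>h. a h x) ` B n q \<subseteq> X closure_of (T n q)"
      proof (rule dns)
        fix p assume "p \<in> D" "p \<in> B n q"
        then show "a p x \<in> T n q" unfolding T_def using self[of p "Suc n"] by blast
      qed (simp add: B_def)
      then have "X closure_of ((\<lambda>h. a h x) ` B n q) \<subseteq> X closure_of (T n q)"
        by (intro closure_of_minimal) auto
      then show ?thesis unfolding I_def by (rule order_trans[OF interior_of_subset])
    qed
    have "W = {}" if W: "openin X W" "W \<subseteq> X closure_of (I n q - T n q)" for W n q
    proof (rule ccontr)
      assume "W \<noteq> {}"
      then obtain y where y: "y \<in> W" by blast
      obtain z where z: "z \<in> I n q - T n q" "z \<in> W" using closure_of_meets[OF _ W(1) y] y W(2) by blast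
      then have "z \<in> X closure_of (T n q)" using IT by blast
      from closure_of_meets[OF this openin_Int[OF W(1) oI]] z
      obtain t where t: "t \<in> T n q" "t \<in> W" by blast
      have "openin X (W \<inter> T n q)" using W(1) oT by blast
      from closure_of_meets[OF _ this] t W(2) show False by blast
    qed
    moreover have "X closure_of (topspace X - T0) = topspace X - T0"
      by (intro closure_of_closedin closedin_diff closedin_topspace oT0)
    moreover have "X interior_of (topspace X - T0) = {}"
      using T0 by (simp add: interior_of_complement)
    ultimately show ?thesis using \<open>N \<in> \<N>\<close> unfolding \<N>_def by (auto simp: interior_of_eq_empty)
  qed
  moreover have "topspace X - \<Union>\<N> \<subseteq> orbit_of UNIV a x"
  proof
    fix z assume z: "z \<in> topspace X - \<Union>\<N>"
    define R where "R n q \<longleftrightarrow> q \<in> D \<and> z \<in> I n q" for n q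
    have "\<exists>f. \<forall>n. R n (f n) \<and> dist (f n) (f (Suc n)) < 1 / 2 ^ n"
    proof (rule dependent_nat_choice)
      have "z \<in> T0" using z unfolding \<N>_def by blast
      then show "\<exists>q. R 0 q" unfolding T0_def R_def by blast
      fix q n assume q: "R n q"
      have "z \<in> T n q" using z q unfolding \<N>_def R_def by blast
      then show "\<exists>p. R (Suc n) p \<and> dist q p < 1 / 2 ^ n" unfolding T_def R_def B_def by auto
    qed
    then obtain f where f: "\<And>n. R n (f n)" "\<And>n. dist (f n) (f (Suc n)) < 1 / 2 ^ n" by blast
    from geometric_steps_limit[OF f(2)] obtain g where g: "f \<longlonglongrightarrow> g" by auto
    have "z = a g x"
    proof (rule shrinking_closures_limit[OF fl xX _ g])
      show "z \<in> topspace X" using z by blast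
      then show "limitin X (\<lambda>n. z) z sequentially" by simp
      show "(\<lambda>n. 1 / 2 ^ n :: real) \<longlonglongrightarrow> 0"
        using LIMSEQ_realpow_zero[of "1/2"] by (simp add: power_one_over)
      show "z \<in> X closure_of ((\<lambda>g. a g x) ` ball (f n) (1 / 2 ^ n))" for n
        using f(1)[of n] unfolding R_def I_def B_def by (blast dest: interior_of_mem)
    qed
    then show "z \<in> orbit_of UNIV a x" by (auto simp: orbit_of_def)
  qed
  ultimately show ?thesis
    unfolding comeager_in_def using orbD by (intro conjI exI[of _ \<N>]) (auto simp: orbit_of_def)
qed


section \<open>Extending right uniformly continuous functions to the universal flow\<close>

text \<open>
  Those which are also right invariant under a subgroup are the real functions on its coset space that
  define the Samuel compactification.
\<close>

definition right_unif_cont :: "('g::topological_group_add \<Rightarrow> real) \<Rightarrow> bool" where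
  "right_unif_cont F \<longleftrightarrow> (\<exists>c. \<forall>g. \<bar>F g\<bar> \<le> c) \<and>
     (\<forall>e>0. \<exists>U. open U \<and> 0 \<in> U \<and> (\<forall>u\<in>U. \<forall>g. \<bar>F (u + g) - F g\<bar> < e))"

definition shift :: "'g::plus \<Rightarrow> ('g \<Rightarrow> real) \<Rightarrow> 'g \<Rightarrow> real" where
  "shift g \<omega> = (\<lambda>h. \<omega> (h + g))"

lemma shift_apply [simp]: "shift g \<omega> h = \<omega> (h + g)" by (simp add: shift_def)

definition modulus_space :: "real \<Rightarrow> ('g::topological_group_add \<Rightarrow> real) \<Rightarrow> ('g \<Rightarrow> real) set" where
  "modulus_space c m = {\<omega>. (\<forall>g. \<bar>\<omega> g\<bar> \<le> c) \<and> (\<forall>u g. \<bar>\<omega> (u + g) - \<omega> g\<bar> \<le> m u)}"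

lemma fun_open_contains_box:
  fixes \<omega> :: "'a \<Rightarrow> real"
  assumes "open T" "\<omega> \<in> T"
  shows "\<exists>A e. finite A \<and> e > 0 \<and> {\<eta>. \<forall>h\<in>A. \<bar>\<eta> h - \<omega> h\<bar> < e} \<subseteq> T"
proof -
  have "openin (product_topology (\<lambda>_. euclideanreal) UNIV) T"
    using assms(1) by (simp add: open_fun_def)
  from product_topology_open_contains_basis[OF this assms(2)]
  obtain X where X: "\<omega> \<in> (\<Pi>\<^sub>E i\<in>UNIV. X i)" "\<And>i. open (X i)" "finite {i. X i \<noteq> UNIV}"
    "(\<Pi>\<^sub>E i\<in>UNIV. X i) \<subseteq> T" by auto
  define A where "A = {i. X i \<noteq> UNIV}"
  have "\<exists>e>0. \<forall>t. \<bar>t - \<omega> i\<bar> < e \<longrightarrow> t \<in> X i" for i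
    using X(1) X(2)[of i] unfolding open_contains_ball
    by (metis PiE_mem UNIV_I dist_real_def abs_minus_commute mem_ball subsetD)
  then obtain e where e: "\<And>i. e i > 0" "\<And>i t. \<bar>t - \<omega> i\<bar> < e i \<Longrightarrow> t \<in> X i" by metis
  define d where "d = Min (insert 1 (e ` A))"
  have fin: "finite A" using X(3) by (simp add: A_def)
  have "d > 0" unfolding d_def using fin e(1) by auto
  moreover have "\<eta> \<in> T" if "\<forall>h\<in>A. \<bar>\<eta> h - \<omega> h\<bar> < d" for \<eta>
  proof -
    have "\<eta> h \<in> X h" for h
    proof (cases "h \<in> A")
      case True
      then have "d \<le> e h" unfolding d_def using fin by simp
      then show ?thesis using that True e(2) by fastforce
    qed (simp add: A_def)
    then show ?thesis using X(4) by auto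
  qed
  ultimately show ?thesis using fin by blast
qed

text \<open>
  Bounds and moduli of continuity are closed conditions in the product topology, so these spaces
  are compact. A uniformly continuous function lies in one of them together with its translates.
\<close>

lemma compactin_modulus_space: "compactin euclidean (modulus_space c m)"
proof (rule closed_compactin)
  have "compactin (product_topology (\<lambda>_. euclideanreal) UNIV) (\<Pi>\<^sub>E g\<in>(UNIV::'a set). {-c..c})"
    unfolding compactin_PiE by simp
  then show "compactin euclidean (\<Pi>\<^sub>E g\<in>(UNIV::'a set). {-c..c})"
    by (simp add: euclidean_product_topology)
  show "modulus_space c m \<subseteq> (\<Pi>\<^sub>E g\<in>UNIV. {-c..c})"
    by (auto simp: modulus_space_def abs_le_iff minus_le_iff)
  have eq: "modulus_space c m = (\<Inter>g. {\<omega>. \<bar>\<omega> g\<bar> \<le> c}) \<inter> (\<Inter>u. \<Inter>g. {\<omega>. \<bar>\<omega> (u + g) - \<omega> g\<bar> \<le> m u})"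
    by (auto simp: modulus_space_def)
  have "closed (modulus_space c m)" unfolding eq
    by (intro closed_Int closed_INT ballI closed_Collect_le continuous_intros continuous_on_product_coordinates)
  then show "closedin euclidean (modulus_space c m)" by simp
qed

lemma Hausdorff_fun_space: "Hausdorff_space (euclidean :: ('a \<Rightarrow> real) topology)"
  unfolding euclidean_product_topology[symmetric] by (simp add: Hausdorff_space_product_topology)

text \<open>
  The translation action is jointly continuous on functions with a common modulus, because
  \<open>h + g = (h + g - g0 - h) + (h + g0)\<close> and the first summand is small for \<open>g\<close> near \<open>g0\<close>.
\<close>

lemma flow_shift:
  fixes m :: "'g::topological_group_add \<Rightarrow> real"
  assumes m: "\<And>e. e > 0 \<Longrightarrow> \<exists>U. open U \<and> 0 \<in> U \<and> (\<forall>u\<in>U. m u < e)"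
    and ne: "modulus_space c m \<noteq> {}"
  shows "flow UNIV (top_of_set (modulus_space c m)) shift"
  unfolding flow_def
proof (intro conjI ballI)
  let ?M = "modulus_space c m"
  show "topspace (top_of_set ?M) \<noteq> {}" using ne by simp
  show "compact_space (top_of_set ?M)" by (intro compact_space_subtopology compactin_modulus_space)
  show "Hausdorff_space (top_of_set ?M)" by (intro Hausdorff_space_subtopology Hausdorff_fun_space)
  have "continuous_on (UNIV \<times> ?M) (\<lambda>(g, \<omega>). shift g \<omega>)"
  proof (rule continuous_on_coordinatewise_then_product)
    fix h :: 'g
    show "continuous_on (UNIV \<times> ?M) (\<lambda>p. (case p of (g, \<omega>) \<Rightarrow> shift g \<omega>) h)"
      unfolding continuous_on_def
    proof (intro ballI tendstoI)
      fix p :: "'g \<times> ('g \<Rightarrow> real)" and e :: real assume "p \<in> UNIV \<times> ?M" and e: "e > 0"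
      obtain g0 \<omega>0 where p: "p = (g0, \<omega>0)" by force
      obtain U where U: "open U" "0 \<in> U" "\<forall>u\<in>U. m u < e / 2" using m[of "e/2"] e by auto
      define A where "A = {g. h + (g - g0 - h) \<in> U}"
      define B where "B = {\<omega> :: 'g \<Rightarrow> real. \<bar>\<omega> (h + g0) - \<omega>0 (h + g0)\<bar> < e / 2}"
      have "open A"
        unfolding A_def using open_group_vimage(2)[OF open_group_vimage(2)[OF open_group_vimage(1)[OF U(1), of h], of "- h"], of "- g0"]
        by simp
      moreover have "open B" unfolding B_def
        by (intro open_Collect_less continuous_intros continuous_on_product_coordinates)
      ultimately have "open (A \<times> B)" by (rule open_Times)
      moreover have "p \<in> A \<times> B" using U(2) e by (simp add: p A_def B_def)
      moreover have "dist (case q of (g, \<omega>) \<Rightarrow> shift g \<omega> h) (case p of (g, \<omega>) \<Rightarrow> shift g \<omega> h) < e"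
        if "q \<in> A \<times> B" "q \<in> UNIV \<times> ?M" for q
      proof -
        obtain g \<omega> where q: "q = (g, \<omega>)" by force
        have \<omega>: "\<omega> \<in> ?M" "h + (g - g0 - h) \<in> U" "\<bar>\<omega> (h + g0) - \<omega>0 (h + g0)\<bar> < e / 2"
          using that by (auto simp: q A_def B_def)
        have "\<bar>\<omega> (h + (g - g0 - h) + (h + g0)) - \<omega> (h + g0)\<bar> \<le> m (h + (g - g0 - h))"
          using \<omega>(1) unfolding modulus_space_def by blast
        also have "\<dots> < e / 2" using \<omega>(2) U(3) by blast
        finally have "\<bar>\<omega> (h + (g - g0 - h) + (h + g0)) - \<omega> (h + g0)\<bar> < e / 2" .
        moreover have "h + (g - g0 - h) + (h + g0) = h + g"
          by (simp add: add.assoc[symmetric] add_diff_eq)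
        ultimately have "\<bar>\<omega> (h + g) - \<omega> (h + g0)\<bar> < e / 2" by simp
        then have "\<bar>\<omega> (h + g) - \<omega>0 (h + g0)\<bar> < e" using \<omega>(3) by arith
        then show ?thesis by (simp add: p q dist_real_def)
      qed
      ultimately show "\<forall>\<^sub>F q in at p within UNIV \<times> ?M.
          dist ((case q of (g, \<omega>) \<Rightarrow> shift g \<omega>) h) ((case p of (g, \<omega>) \<Rightarrow> shift g \<omega>) h) < e"
        unfolding eventually_at_topological by (intro exI[of _ "A \<times> B"]) (auto simp: case_prod_unfold)
    qed
  qed
  moreover have "(\<lambda>(g, \<omega>). shift g \<omega>) \<in> UNIV \<times> ?M \<rightarrow> ?M"
    by (auto simp: modulus_space_def add.assoc)
  ultimately show "continuous_map (prod_topology (top_of_set UNIV) (top_of_set ?M)) (top_of_set ?M) (\<lambda>(g, \<omega>). shift g \<omega>)"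
    unfolding prod_topology_subtopology_eu continuous_map_subtopology_eu by blast
qed (auto simp: shift_def add.assoc)

lemma right_unif_cont_modulus:
  assumes "right_unif_cont F"
  shows "\<exists>c m. F \<in> modulus_space c m \<and> (\<forall>e>0. \<exists>U. open U \<and> 0 \<in> U \<and> (\<forall>u\<in>U. m u < e))"
proof -
  obtain c where c: "\<And>g. \<bar>F g\<bar> \<le> c" using assms unfolding right_unif_cont_def by blast
  define m where "m u = (SUP g. \<bar>F (u + g) - F g\<bar>)" for u
  have "\<bar>F (u + g) - F g\<bar> \<le> 2 * c" for u g using c[of "u + g"] c[of g] by linarith
  then have bdd: "bdd_above (range (\<lambda>g. \<bar>F (u + g) - F g\<bar>))" for u by (intro bdd_aboveI[of _ "2 * c"]) auto
  have "\<exists>U. open U \<and> 0 \<in> U \<and> (\<forall>u\<in>U. m u < e)" if "e > 0" for e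
  proof -
    obtain U where U: "open U" "0 \<in> U" "\<forall>u\<in>U. \<forall>g. \<bar>F (u + g) - F g\<bar> < e / 2"
      using assms \<open>e > 0\<close> unfolding right_unif_cont_def by (meson half_gt_zero)
    have "m u \<le> e / 2" if "u \<in> U" for u
      unfolding m_def using U(3) that by (intro cSUP_least) (auto intro: less_imp_le)
    then show ?thesis using U(1,2) \<open>e > 0\<close> by (intro exI[of _ U]) force
  qed
  moreover have "F \<in> modulus_space c m"
    unfolding modulus_space_def m_def using c bdd by (auto intro!: cSUP_upper)
  ultimately show ?thesis by blast
qed

lemma right_unif_cont_function_flow:
  assumes "right_unif_cont F"
  obtains M where "F \<in> M" "closed M" "flow UNIV (top_of_set M) shift"
proof -
  obtain c m where cm: "F \<in> modulus_space c m" "\<And>e. e > 0 \<Longrightarrow> \<exists>U. open U \<and> 0 \<in> U \<and> (\<forall>u\<in>U. m u < e)"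
    using right_unif_cont_modulus[OF assms] by blast
  have "flow UNIV (top_of_set (modulus_space c m)) shift" by (rule flow_shift[OF cm(2)]) (use cm(1) in auto)
  moreover have "closed (modulus_space c m)"
    using compactin_modulus_space[of c m] Hausdorff_fun_space by (metis closed_closedin compactin_imp_closedin)
  ultimately show thesis using that cm(1) by blast
qed

definition graph_closure ::
  "'x topology \<Rightarrow> ('g::topological_group_add \<Rightarrow> 'x \<Rightarrow> 'x) \<Rightarrow> ('g \<Rightarrow> real) \<Rightarrow> 'x \<Rightarrow> (('g \<Rightarrow> real) \<times> 'x) set" where
  "graph_closure P act F x = orbit_closure UNIV (prod_topology euclidean P) (pair_action shift act) (F, x)"

text \<open>
  The orbit closure \<open>Z\<close> of \<open>(F, x)\<close> is a flow over \<open>P\<close>. If its fibre over \<open>x\<close> collapses to \<open>F\<close> under the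
  stabilizer of \<open>x\<close>, then \<open>Z\<close> is minimal and proximal, because pairs can be moved into that fibre.
  So \<open>Z\<close> is a factor of the universal flow \<open>P\<close>, and the factor map is a section of the projection
  to \<open>P\<close>, since \<open>P\<close> has no endomorphism but the identity. The section sends \<open>x\<close> to a point of the
  fibre fixed by the stabilizer, which must be \<open>(F, x)\<close>; evaluating its function component at \<open>0\<close>
  extends \<open>F\<close> from the orbit of \<open>x\<close> to \<open>P\<close>.
\<close>

lemma extension_of_collapsing_fibre:
  fixes act :: "'g::topological_group_add \<Rightarrow> 'p \<Rightarrow> 'p"
  assumes univ: "universal_minimal_proximal_flow P act" and x: "x \<in> topspace P"
    and F: "right_unif_cont F"
    and collapse: "\<And>\<omega> \<omega>'. (\<omega>, x) \<in> graph_closure P act F x \<Longrightarrow> (\<omega>', x) \<in> graph_closure P act F x \<Longrightarrow>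
      (F, F) \<in> prod_topology euclidean euclidean closure_of ((\<lambda>k. (shift k \<omega>, shift k \<omega>')) ` stabilizer act x)"
  shows "(\<forall>k\<in>stabilizer act x. shift k F = F) \<and>
    (\<exists>f. continuous_map P euclideanreal f \<and> (\<forall>g. f (act g x) = F g))"
proof -
  have mP: "minimal_flow UNIV P act" and pP: "proximal_flow UNIV P act"
    using univ by (auto simp: universal_minimal_proximal_flow_def)
  have flP: "flow UNIV P act" using mP by (simp add: minimal_flow_def)
  obtain M where M: "F \<in> M" "flow UNIV (top_of_set M) shift"
    using right_unif_cont_function_flow[OF F] by blast
  define \<Omega> where "\<Omega> = top_of_set M"
  have flO: "flow UNIV \<Omega> shift" using M(2) by (simp add: \<Omega>_def)
  have topO: "topspace \<Omega> = M" by (simp add: \<Omega>_def)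
  define X where "X = prod_topology \<Omega> P"
  define b where "b = pair_action shift act"
  have flX: "flow UNIV X b" unfolding X_def b_def by (rule flow_prod[OF flO flP])
  define XX where "XX = prod_topology X X"
  define bb where "bb = pair_action b b"
  have flXX: "flow UNIV XX bb" unfolding XX_def bb_def by (rule flow_prod[OF flX flX])
  define z0 where "z0 = (F, x)"
  have z0: "z0 \<in> topspace X" using M(1) x topO by (simp add: z0_def X_def)
  define S where "S = orbit_closure UNIV X b z0"
  have SX: "S \<subseteq> topspace X" unfolding S_def by (rule closure_of_subset_topspace)
  have topX: "topspace X = M \<times> topspace P" by (simp add: X_def topO)
  have XE: "X = subtopology (prod_topology euclidean P) (M \<times> UNIV)"
    unfolding X_def \<Omega>_def by (simp add: subtopology_Times)
  have S_graph: "S \<subseteq> graph_closure P act F x"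
    unfolding S_def graph_closure_def XE b_def z0_def by (rule closure_of_subtopology_subset)
  have fibre: "(z0, z0) \<in> orbit_closure UNIV XX bb (w, w')"
    if w: "w \<in> S" "w' \<in> S" "snd w = x" "snd w' = x" for w w'
  proof -
    obtain \<omega> \<omega>' where ww: "w = (\<omega>, x)" "w' = (\<omega>', x)" using w(3,4) by (metis prod.collapse)
    define K where "K = stabilizer act x"
    define T where "T = (\<lambda>k. (shift k \<omega>, shift k \<omega>')) ` K"
    have \<omega>M: "\<omega> \<in> M" "\<omega>' \<in> M" using w(1,2) SX topX by (auto simp: ww)
    then have TM: "T \<subseteq> M \<times> M"
      using flow_act_in[OF flO] unfolding topO T_def by auto
    have "(F, F) \<in> prod_topology euclidean euclidean closure_of T"
      unfolding T_def K_def using collapse w(1,2) S_graph by (auto simp: ww)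
    then have FT: "(F, F) \<in> prod_topology \<Omega> \<Omega> closure_of T"
      using M(1) TM unfolding \<Omega>_def subtopology_Times[symmetric] closure_of_subtopology
      by (simp add: Int_absorb1)
    define j where "j = (\<lambda>p. ((fst p, x), (snd p, x)) :: (('g \<Rightarrow> real) \<times> 'p) \<times> (('g \<Rightarrow> real) \<times> 'p))"
    have "continuous_map (prod_topology \<Omega> \<Omega>) XX j"
      unfolding j_def XX_def X_def using x
      by (intro continuous_map_pairedI continuous_map_fst continuous_map_snd) auto
    from continuous_map_image_closure_subset[OF this, of T]
    have "j (F, F) \<in> XX closure_of (j ` T)" using FT by blast
    moreover have "j ` T \<subseteq> orbit_of UNIV bb (w, w')"
      unfolding T_def orbit_of_def bb_def b_def j_def ww K_def stabilizer_def by force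
    ultimately have "j (F, F) \<in> orbit_closure UNIV XX bb (w, w')"
      using closure_of_mono by blast
    then show ?thesis by (simp add: j_def z0_def)
  qed
  have pair: "(z0, z0) \<in> orbit_closure UNIV XX bb (y, z)" if yz: "y \<in> S" "z \<in> S" for y z
  proof -
    have c: "continuous_map X P snd" unfolding X_def by (rule continuous_map_snd)
    have e: "equivariant_on UNIV (topspace X) b act snd" by (auto simp: equivariant_on_def b_def)
    from pair_moves_to_fibre[OF closed_subgroup_UNIV flX mP pP c e x z0 yz[unfolded S_def]]
    obtain w w' where w: "w \<in> S" "w' \<in> S" "snd w = x" "snd w' = x" "(w, w') \<in> orbit_closure UNIV XX bb (y, z)"
      unfolding S_def XX_def bb_def by blast
    have "(y, z) \<in> topspace XX" using yz SX by (auto simp: XX_def)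
    then show ?thesis
      using orbit_closure_trans[OF flXX closed_subgroup_UNIV _ w(5)] fibre[OF w(1-4)] by blast
  qed
  note mp = orbit_closure_minimal_proximal[OF flX closed_subgroup_UNIV z0, folded S_def XX_def bb_def]
  have min_prox: "minimal_flow UNIV (subtopology X S) b" "proximal_flow UNIV (subtopology X S) b"
    by (rule mp(1); rule pair; assumption) (rule mp(2); rule pair; assumption)
  have topS: "topspace (subtopology X S) = S" using SX by auto
  obtain \<phi> where \<phi>: "continuous_map P (subtopology X S) \<phi>" "equivariant_on UNIV (topspace P) act b \<phi>"
    using universal_minimal_proximal_flow_factor[OF univ min_prox] by (elim exE conjE)
  have c\<phi>: "continuous_map P X \<phi>" using \<phi>(1) by (rule continuous_map_into_fulltopology)
  have \<phi>S: "\<phi> p \<in> S" if "p \<in> topspace P" for p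
    using continuous_map_image_subset_topspace[OF \<phi>(1)] that unfolding topS by blast
  have snd\<phi>: "snd (\<phi> p) = p" if p: "p \<in> topspace P" for p
  proof (rule equivariant_maps_agree[OF mP pP closed_subgroup_UNIV _ _ _ _ p])
    show "continuous_map P P (\<lambda>p. snd (\<phi> p))"
      using continuous_map_compose[OF c\<phi>, of P snd] unfolding X_def by (simp add: o_def continuous_map_snd)
    show "equivariant_on UNIV (topspace P) act act (\<lambda>p. snd (\<phi> p))"
      using \<phi>(2) by (auto simp: equivariant_on_def b_def pair_action_def case_prod_unfold)
  qed (auto simp: equivariant_on_def)
  define \<omega> where "\<omega> = fst (\<phi> x)"
  have \<phi>x: "\<phi> x = (\<omega>, x)" using snd\<phi>[OF x] by (metis \<omega>_def prod.collapse)
  have inv: "shift k \<omega> = \<omega>" if "k \<in> stabilizer act x" for k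
  proof -
    have "\<phi> (act k x) = b k (\<phi> x)" using \<phi>(2) x by (simp add: equivariant_on_def)
    then show ?thesis using that \<phi>x by (simp add: stabilizer_def b_def)
  qed
  have "(\<omega>, x) \<in> graph_closure P act F x" using \<phi>S[OF x] S_graph \<phi>x by auto
  from collapse[OF this this] have "(F, F) \<in> prod_topology euclidean euclidean closure_of ((\<lambda>k. (shift k \<omega>, shift k \<omega>)) ` stabilizer act x)" .
  also have "\<dots> \<subseteq> prod_topology euclidean euclidean closure_of {(\<omega>, \<omega>)}"
    using inv by (intro closure_of_mono) auto
  also have "\<dots> = {(\<omega>, \<omega>)}"
    by (intro closure_of_closedin closedin_Hausdorff_singleton)
      (simp_all add: Hausdorff_space_prod_topology Hausdorff_fun_space del: prod_topology_euclidean)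
  finally have F\<omega>: "F = \<omega>" by simp
  define f where "f p = fst (\<phi> p) 0" for p
  have "continuous_map \<Omega> euclideanreal (\<lambda>\<omega>. \<omega> 0)"
    unfolding \<Omega>_def by (simp add: continuous_on_subset[OF continuous_on_product_coordinates])
  from continuous_map_compose[OF continuous_map_compose[OF c\<phi>[unfolded X_def] continuous_map_fst] this]
  have "continuous_map P euclideanreal f" by (simp add: o_def f_def[abs_def])
  moreover have "f (act g x) = F g" for g
    using \<phi>(2) x \<phi>x by (simp add: equivariant_on_def b_def f_def F\<omega>)
  ultimately show ?thesis using inv F\<omega> by blast
qed

text \<open>
  Near \<open>x\<close>, group elements moving \<open>x\<close> little are small perturbations of elements of the
  stabilizer, and \<open>F\<close> does not feel small perturbations.
\<close>

lemma graph_closure_fibre_nearly_open: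
  fixes act :: "'g::{topological_group_add, complete_space} \<Rightarrow> 'p \<Rightarrow> 'p"
  assumes fl: "flow UNIV P act" and x: "nearly_open_point P act x" and F: "right_unif_cont F"
    and \<omega>: "(\<omega>, x) \<in> graph_closure P act F x"
  shows "\<omega> \<in> closure ((\<lambda>k. shift k F) ` stabilizer act x)"
  unfolding closure_iff_nhds_not_empty
proof (intro allI impI)
  fix A T :: "('g \<Rightarrow> real) set" assume T: "T \<subseteq> A" "open T" "\<omega> \<in> T"
  obtain D e where D: "finite D" "e > 0" "{\<eta>. \<forall>h\<in>D. \<bar>\<eta> h - \<omega> h\<bar> < e} \<subseteq> T"
    using fun_open_contains_box[OF T(2,3)] by blast
  obtain V where V: "open V" "0 \<in> V" "\<forall>u\<in>V. \<forall>g. \<bar>F (u + g) - F g\<bar> < e / 2"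
    using F D(2) unfolding right_unif_cont_def by (meson half_gt_zero)
  define U where "U = (\<Inter>h\<in>D. {u. h + (u + - h) \<in> V})"
  have "open {u. h + (u + - h) \<in> V}" for h
    using open_group_vimage(2)[OF open_group_vimage(1)[OF V(1), of h], of "- h"] by (simp only: mem_Collect_eq)
  then have "open U" unfolding U_def using D(1) by (intro open_INT) blast+
  moreover have "0 \<in> U" using V(2) by (simp add: U_def)
  ultimately obtain W where W: "openin P W" "x \<in> W"
    "\<And>g. act g x \<in> W \<Longrightarrow> \<exists>u\<in>U. \<exists>k\<in>stabilizer act x. g = u + k"
    using effros_open_orbit_map[OF fl x] by blast
  define B where "B = {\<eta> :: 'g \<Rightarrow> real. \<forall>h\<in>D. \<bar>\<eta> h - \<omega> h\<bar> < e / 2}"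
  have "B = (\<Inter>h\<in>D. {\<eta>. \<bar>\<eta> h - \<omega> h\<bar> < e / 2})" by (auto simp: B_def)
  then have "open B" using D(1)
    by (auto intro!: open_INT open_Collect_less continuous_intros continuous_on_product_coordinates)
  then have "openin (prod_topology euclidean P) (B \<times> W)" using W(1) by (simp add: openin_prod_Times_iff)
  moreover have "(\<omega>, x) \<in> B \<times> W" using W(2) D(2) by (simp add: B_def)
  ultimately obtain p where p: "p \<in> orbit_of UNIV (pair_action shift act) (F, x)" "p \<in> B \<times> W"
    using closure_of_meets[OF \<omega>[unfolded graph_closure_def]] by blast
  then obtain g where g: "shift g F \<in> B" "act g x \<in> W" by (auto simp: orbit_of_def)
  obtain u k where uk: "u \<in> U" "k \<in> stabilizer act x" "g = u + k" using W(3)[OF g(2)] by blast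
  have "\<bar>F (h + k) - \<omega> h\<bar> < e" if h: "h \<in> D" for h
  proof -
    have "h + (u + - h) \<in> V" using uk(1) h by (auto simp: U_def)
    then have "\<bar>F (h + (u + - h) + (h + k)) - F (h + k)\<bar> < e / 2" using V(3) by blast
    moreover have "h + (u + - h) + (h + k) = h + g"
      by (simp add: uk(3) add.assoc[symmetric] add_diff_eq)
    moreover have "\<bar>F (h + g) - \<omega> h\<bar> < e / 2" using g(1) h by (simp add: B_def)
    ultimately show ?thesis by (simp add: abs_if split: if_splits)
  qed
  then have "shift k F \<in> T" using D(3) by auto
  then show "(\<lambda>k. shift k F) ` stabilizer act x \<inter> A \<noteq> {}" using uk(2) T(1) by blast
qed

lemma closure_of_singleton_fun: "closure {\<omega> :: 'a \<Rightarrow> real} = {\<omega>}"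
proof -
  have "closedin euclidean {\<omega>}" by (intro closedin_Hausdorff_singleton) (simp_all add: Hausdorff_fun_space)
  then show ?thesis by simp
qed

text \<open>
  An invariant \<open>F\<close> is alone in its fibre, by the description of the fibre above.
\<close>

lemma extension_of_invariant_function:
  fixes act :: "'g::{topological_group_add, complete_space} \<Rightarrow> 'p \<Rightarrow> 'p"
  assumes univ: "universal_minimal_proximal_flow P act" and x: "nearly_open_point P act x"
    and F: "right_unif_cont F" and inv: "\<And>k. k \<in> stabilizer act x \<Longrightarrow> shift k F = F"
  shows "\<exists>f. continuous_map P euclideanreal f \<and> (\<forall>g. f (act g x) = F g)"
proof -
  have fl: "flow UNIV P act" using univ by (simp add: universal_minimal_proximal_flow_def minimal_flow_def)
  have xP: "x \<in> topspace P" using x by (simp add: nearly_open_point_def)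
  have 0: "0 \<in> stabilizer act x" using closed_subgroup_stabilizer[OF fl xP] by (simp add: closed_subgroup_def)
  have single: "\<omega> = F" if "(\<omega>, x) \<in> graph_closure P act F x" for \<omega>
  proof -
    have "(\<lambda>k. shift k F) ` stabilizer act x \<subseteq> {F}" using inv by auto
    then have "closure ((\<lambda>k. shift k F) ` stabilizer act x) \<subseteq> {F}"
      using closure_mono closure_of_singleton_fun by metis
    then show ?thesis using graph_closure_fibre_nearly_open[OF fl x F that] by blast
  qed
  have "(F, F) \<in> prod_topology euclidean euclidean closure_of ((\<lambda>k. (shift k F, shift k F)) ` stabilizer act x)"
    by (rule subsetD[OF closure_of_subset]) (use 0 in \<open>auto intro!: image_eqI[of _ _ 0]\<close>)
  then show ?thesis
    using extension_of_collapsing_fibre[OF univ xP F] single by blast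
qed


section \<open>Distance to an open set along the group\<close>

text \<open>
  If \<open>H\<close> is the whole group, this is the distance from \<open>g y\<close> to \<open>A\<close>: the least norm of an element that
  moves \<open>g y\<close> into \<open>A\<close>, capped at 1 so that it is defined when there is none. For a flow \<open>Y\<close> of a
  subgroup \<open>H\<close> it is a function on \<open>G \<times> Y\<close> that descends to the quotient of \<open>G \<times> Y\<close> by \<open>H\<close>, and so
  plays the part of a function on the flow of \<open>G\<close> induced from \<open>Y\<close>. It is semicontinuous in \<open>y\<close>
  and Lipschitz in \<open>g\<close>.
\<close>

definition set_distance ::
  "'g::{topological_group_add, first_countable_topology} set \<Rightarrow> ('g \<Rightarrow> 'y \<Rightarrow> 'y) \<Rightarrow> 'y set \<Rightarrow> 'g \<Rightarrow> 'y \<Rightarrow> real" where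
  "set_distance H a A g y = Inf (insert 1 {gnorm (k - g) | k. k \<in> H \<and> a k y \<in> A})"

lemma set_distance_bdd: "bdd_below (insert 1 {gnorm (k - g) | k. k \<in> H \<and> a k y \<in> A})"
  by (rule bdd_belowI[of _ 0]) auto

lemma set_distance_ge_0: "0 \<le> set_distance H a A g y"
  unfolding set_distance_def by (rule cInf_greatest) auto

lemma set_distance_le_1: "set_distance H a A g y \<le> 1"
  unfolding set_distance_def by (rule cInf_lower[OF _ set_distance_bdd]) simp

lemma set_distance_le: "k \<in> H \<Longrightarrow> a k y \<in> A \<Longrightarrow> set_distance H a A g y \<le> gnorm (k - g)"
  unfolding set_distance_def by (rule cInf_lower[OF _ set_distance_bdd]) auto

lemma set_distance_less_iff:
  "set_distance H a A g y < t \<longleftrightarrow> 1 < t \<or> (\<exists>k\<in>H. a k y \<in> A \<and> gnorm (k - g) < t)"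
  unfolding set_distance_def by (subst cInf_less_iff[OF _ set_distance_bdd]) auto

lemma set_distance_greatest:
  "t \<le> 1 \<Longrightarrow> (\<And>k. k \<in> H \<Longrightarrow> a k y \<in> A \<Longrightarrow> t \<le> gnorm (k - g)) \<Longrightarrow> t \<le> set_distance H a A g y"
  unfolding set_distance_def by (rule cInf_greatest) auto

lemma set_distance_Lipschitz:
  "\<bar>set_distance H a A g y - set_distance H a A h y\<bar> \<le> gnorm (g - h)"
proof -
  have "set_distance H a A g y - gnorm (g - h) \<le> set_distance H a A h y" for g h
  proof (rule set_distance_greatest)
    show "set_distance H a A g y - gnorm (g - h) \<le> 1"
      using set_distance_le_1[of H a A g y] gnorm_ge_0[of "g - h"] by linarith
    fix k assume "k \<in> H" "a k y \<in> A"
    then have "set_distance H a A g y \<le> gnorm (k - g)" by (rule set_distance_le)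
    also have "\<dots> \<le> gnorm (k - h) + gnorm (h - g)" by (rule gnorm_diff_triangle)
    finally show "set_distance H a A g y - gnorm (g - h) \<le> gnorm (k - h)"
      by (simp add: gnorm_minus_commute)
  qed
  from this[of g h] this[of h g] show ?thesis by (simp add: gnorm_minus_commute abs_le_iff)
qed

lemma set_distance_act:
  assumes fl: "flow H Y a" and H: "closed_subgroup H" and y: "y \<in> topspace Y" and h: "h \<in> H"
  shows "set_distance H a A (g + h) y = set_distance H a A g (a h y)"
proof -
  have "{gnorm (k - (g + h)) | k. k \<in> H \<and> a k y \<in> A} = {gnorm (k - g) | k. k \<in> H \<and> a k (a h y) \<in> A}"
  proof (intro equalityI subsetI)
    fix t assume "t \<in> {gnorm (k - (g + h)) | k. k \<in> H \<and> a k y \<in> A}"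
    then obtain k where k: "k \<in> H" "a k y \<in> A" "t = gnorm (k - (g + h))" by blast
    have kh: "k + - h \<in> H" using H h k(1) unfolding closed_subgroup_def by blast
    have "a (k + - h) (a h y) = a k y"
      using flow_add[OF fl y kh h] by (simp add: add.assoc)
    moreover have "k + - h - g = k - (g + h)" by (simp add: diff_conv_add_uminus minus_add add.assoc del: add_uminus_conv_diff)
    ultimately show "t \<in> {gnorm (k - g) | k. k \<in> H \<and> a k (a h y) \<in> A}"
      using kh k(2,3) by (metis (mono_tags, lifting) mem_Collect_eq)
  next
    fix t assume "t \<in> {gnorm (k - g) | k. k \<in> H \<and> a k (a h y) \<in> A}"
    then obtain k where k: "k \<in> H" "a k (a h y) \<in> A" "t = gnorm (k - g)" by blast
    have "k + h \<in> H" using H h k(1) unfolding closed_subgroup_def by blast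
    moreover have "a (k + h) y \<in> A" using k(2) flow_add[OF fl y k(1) h] by simp
    moreover have "k + h - (g + h) = k - g"
      by (simp add: diff_conv_add_uminus minus_add add.assoc del: add_uminus_conv_diff)
    ultimately show "t \<in> {gnorm (k - (g + h)) | k. k \<in> H \<and> a k y \<in> A}" using k(3) by (metis (mono_tags, lifting) mem_Collect_eq)
  qed
  then show ?thesis by (simp add: set_distance_def)
qed

lemma open_set_distance_less:
  assumes fl: "flow H Y a" and A: "openin Y A"
  shows "openin Y {y \<in> topspace Y. set_distance H a A g y < t}"
proof (cases "1 < t")
  case True
  then show ?thesis by (simp add: set_distance_less_iff)
next
  case False
  have "openin Y {y \<in> topspace Y. a k y \<in> A}" if "k \<in> H" for k
    using openin_continuous_map_preimage[OF flow_continuous_act[OF fl that] A] .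
  then have "openin Y (\<Union>k\<in>{k \<in> H. gnorm (k - g) < t}. {y \<in> topspace Y. a k y \<in> A})"
    by blast
  moreover have "(\<Union>k\<in>{k \<in> H. gnorm (k - g) < t}. {y \<in> topspace Y. a k y \<in> A})
      = {y \<in> topspace Y. set_distance H a A g y < t}"
    using False by (auto simp: set_distance_less_iff)
  ultimately show ?thesis by simp
qed

lemma right_unif_cont_set_distance: "right_unif_cont (\<lambda>g. set_distance H a A g y)"
  unfolding right_unif_cont_def
proof (intro conjI allI impI)
  show "\<exists>c. \<forall>g. \<bar>set_distance H a A g y\<bar> \<le> c"
    using set_distance_ge_0[of H a A _ y] set_distance_le_1[of H a A _ y] by (intro exI[of _ 1]) simp
  fix e :: real assume "e > 0"
  then obtain U :: "'a set" where U: "open U" "0 \<in> U" "\<forall>g\<in>U. gnorm g < e" using gnorm_small_nhd by blast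
  have "\<bar>set_distance H a A (u + g) y - set_distance H a A g y\<bar> < e" if "u \<in> U" for u g
    using set_distance_Lipschitz[of H a A "u + g" y g] U(3) that by force
  then show "\<exists>U. open U \<and> 0 \<in> U \<and> (\<forall>u\<in>U. \<forall>g. \<bar>set_distance H a A (u + g) y - set_distance H a A g y\<bar> < e)"
    using U by blast
qed

definition set_distance_continuity_point ::
  "'g::{topological_group_add, first_countable_topology} set \<Rightarrow> 'y topology \<Rightarrow> ('g \<Rightarrow> 'y \<Rightarrow> 'y) \<Rightarrow> 'y set \<Rightarrow> 'y \<Rightarrow> bool" where
  "set_distance_continuity_point H Y a A y \<longleftrightarrow> y \<in> topspace Y \<and>
     (\<forall>g. \<forall>e>0. \<exists>W. openin Y W \<and> y \<in> W \<and>
        (\<forall>y'\<in>W. \<bar>set_distance H a A g y' - set_distance H a A g y\<bar> < e))"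

lemma frontier_nowhere_dense:
  assumes "openin Y T"
  shows "Y interior_of (Y closure_of (Y closure_of T - T)) = {}"
proof -
  have "closedin Y (Y closure_of T - T)" using assms by (intro closedin_diff) auto
  moreover have "W = {}" if W: "openin Y W" "W \<subseteq> Y closure_of T - T" for W
  proof (rule ccontr)
    assume "W \<noteq> {}"
    then obtain y where "y \<in> W" by blast
    with W closure_of_meets[of y Y T W] show False by blast
  qed
  ultimately show ?thesis by (simp add: closure_of_closedin interior_of_eq_empty)
qed

text \<open>
  Each function \<open>set_distance H a A g\<close> is upper semicontinuous, hence continuous off the
  frontiers of its countably many rational sublevel sets; the Lipschitz bound reduces all \<open>g\<close> to
  a countable dense set.
\<close>

lemma set_distance_continuity_point_exists:
  fixes a :: "'g::{topological_group_add, first_countable_topology, second_countable_topology} \<Rightarrow> 'y \<Rightarrow> 'y"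
  assumes fl: "flow H Y a" and A: "openin Y A"
  shows "\<exists>y. set_distance_continuity_point H Y a A y"
proof -
  obtain D :: "'g set" where D: "countable D" "\<And>X. open X \<Longrightarrow> X \<noteq> {} \<Longrightarrow> \<exists>d\<in>D. d \<in> X"
    using countable_dense_setE by blast
  define T where "T g t = {y \<in> topspace Y. set_distance H a A g y < t}" for g t
  define \<N> where "\<N> = (\<lambda>(g, t). Y closure_of (T g t) - T g t) ` (D \<times> \<rat>)"
  have oT: "openin Y (T g t)" for g t unfolding T_def by (rule open_set_distance_less[OF fl A])
  have "\<not> topspace Y \<subseteq> \<Union>\<N>"
  proof (rule flow_nonmeager[OF fl])
    show "countable \<N>" unfolding \<N>_def using D(1) countable_rat by blast
    show "Y interior_of (Y closure_of N) = {}" if "N \<in> \<N>" for N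
      using that frontier_nowhere_dense[OF oT] unfolding \<N>_def by auto
    show "topspace Y \<noteq> {}" using fl unfolding flow_def by blast
  qed simp
  then obtain y where y: "y \<in> topspace Y" "y \<notin> \<Union>\<N>" by blast
  have "\<exists>W. openin Y W \<and> y \<in> W \<and> (\<forall>y'\<in>W. \<bar>set_distance H a A g y' - set_distance H a A g y\<bar> < e)"
    if "e > 0" for g e
  proof -
    obtain U :: "'g set" where U: "open U" "0 \<in> U" "\<forall>u\<in>U. gnorm u < e / 4"
      using gnorm_small_nhd[of "e / 4"] \<open>e > 0\<close> by auto
    have "open {x. x + - g \<in> U}" "g \<in> {x. x + - g \<in> U}" using U by (auto intro: open_group_vimage(2)[of U "- g", simplified])
    then obtain q where q: "q \<in> D" "q - g \<in> U" using D(2) by fastforce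
    let ?f = "set_distance H a A q"
    have fg: "\<bar>set_distance H a A g z - ?f z\<bar> < e / 4" for z
      using set_distance_Lipschitz[of H a A g z q] U(3) q(2) by (force simp: gnorm_minus_commute)
    obtain s where s: "s \<in> \<rat>" "?f y < s" "s < ?f y + e / 4"
      using Rats_dense_in_real[of "?f y" "?f y + e / 4"] \<open>e > 0\<close> by auto
    obtain r where r: "r \<in> \<rat>" "?f y - e / 4 < r" "r < ?f y"
      using Rats_dense_in_real[of "?f y - e / 4" "?f y"] \<open>e > 0\<close> by auto
    define W where "W = T q s - Y closure_of (T q r)"
    have "openin Y W" unfolding W_def using oT by (intro openin_diff) auto
    moreover have "y \<notin> T q r" using r(3) by (simp add: T_def)
    then have "y \<notin> Y closure_of (T q r)" using y(2) q(1) r(1) by (auto simp: \<N>_def)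
    then have "y \<in> W" using y(1) s(2) by (simp add: W_def T_def)
    moreover have "\<bar>set_distance H a A g y' - set_distance H a A g y\<bar> < e" if "y' \<in> W" for y'
    proof -
      have y': "y' \<in> topspace Y" using that oT[of q s] openin_subset by (auto simp: W_def T_def)
      have "y' \<notin> T q r" using that closure_of_subset[of "T q r" Y] by (auto simp: W_def T_def)
      then have "r \<le> ?f y'" "?f y' < s" using that y' by (auto simp: W_def T_def)
      then show ?thesis using fg[of y] fg[of y'] r(2) s(3) by linarith
    qed
    ultimately show ?thesis by blast
  qed
  then show ?thesis using y(1) unfolding set_distance_continuity_point_def by blast
qed

text \<open>
  Continuity at \<open>y\<close> makes the orbit closure of \<open>(set_distance H a A (-) y, y)\<close> an almost one-to-one
  extension of the flow: over \<open>y\<close> there is a single point.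
\<close>

lemma set_distance_graph_singleton:
  assumes fl: "flow H Y a" and H: "closed_subgroup H" and y: "set_distance_continuity_point H Y a A y"
    and \<eta>: "(\<eta>, y) \<in> orbit_closure H (prod_topology euclidean Y) (pair_action shift a) (\<lambda>g. set_distance H a A g y, y)"
  shows "\<eta> = (\<lambda>g. set_distance H a A g y)"
proof
  fix g
  let ?f = "set_distance H a A g"
  have yY: "y \<in> topspace Y" using y by (simp add: set_distance_continuity_point_def)
  have "\<bar>\<eta> g - ?f y\<bar> < e" if "e > 0" for e
  proof -
    obtain W where W: "openin Y W" "y \<in> W" "\<forall>y'\<in>W. \<bar>?f y' - ?f y\<bar> < e / 2"
      using y \<open>e > 0\<close> unfolding set_distance_continuity_point_def by (meson half_gt_zero)
    define B where "B = {\<zeta> :: 'a \<Rightarrow> real. \<bar>\<zeta> g - \<eta> g\<bar> < e / 2}"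
    have "open B" unfolding B_def
      by (intro open_Collect_less continuous_intros continuous_on_product_coordinates)
    then have "openin (prod_topology euclidean Y) (B \<times> W)" using W(1) by (simp add: openin_prod_Times_iff)
    moreover have "(\<eta>, y) \<in> B \<times> W" using W(2) \<open>e > 0\<close> by (simp add: B_def)
    ultimately obtain p where p: "p \<in> orbit_of H (pair_action shift a) (\<lambda>g. set_distance H a A g y, y)" "p \<in> B \<times> W"
      using closure_of_meets[OF \<eta>] by blast
    then obtain k where k: "k \<in> H" "\<bar>set_distance H a A (g + k) y - \<eta> g\<bar> < e / 2" "a k y \<in> W"
      by (auto simp: orbit_of_def B_def)
    have "\<bar>?f (a k y) - \<eta> g\<bar> < e / 2" using k(2) set_distance_act[OF fl H yY k(1)] by simp
    moreover have "\<bar>?f (a k y) - ?f y\<bar> < e / 2" using W(3) k(3) by blast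
    ultimately show ?thesis by linarith
  qed
  then have "\<bar>\<eta> g - ?f y\<bar> \<le> 0" by (meson dense_ge linorder_not_le order_less_irrefl)
  then show "\<eta> g = ?f y" by simp
qed

section \<open>Presyndetic subgroups\<close>

lemma flow_restrict:
  assumes "flow UNIV X a"
  shows "flow H X a"
proof -
  have "continuous_map (prod_topology (top_of_set H) X) (prod_topology (top_of_set UNIV) X) (\<lambda>q. (fst q, snd q))"
    by (intro continuous_map_pairedI continuous_map_snd)
      (simp add: continuous_map_into_fulltopology[OF continuous_map_fst])
  from continuous_map_compose[OF this flow_continuous[OF assms]] show ?thesis
    using assms by (simp add: flow_def o_def)
qed

text \<open>
  If the \<open>H\<close>-orbit closure \<open>C\<close> of a pair missed the diagonal, so would a closed
  neighbourhood containing \<open>U C\<close> for some \<open>U\<close>; its finitely many translates by \<open>F\<close> contain the whole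
  \<open>G\<close>-orbit of the pair and still miss the diagonal.
\<close>

lemma presyndetic_proximal_restrict:
  assumes H: "presyndetic H" and p: "proximal_flow UNIV X a"
  shows "proximal_flow H X a"
proof -
  have fl: "flow UNIV X a" using p by (simp add: proximal_flow_def)
  have sub: "closed_subgroup H" using H by (simp add: presyndetic_def)
  define XX where "XX = prod_topology X X"
  define aa where "aa = pair_action a a"
  have flXX: "flow UNIV XX aa" unfolding XX_def aa_def by (rule flow_prod[OF fl fl])
  define \<Delta> where "\<Delta> = (\<lambda>z. (z, z)) ` topspace X"
  have \<Delta>: "closedin XX \<Delta>"
    using flow_Hausdorff[OF fl] unfolding XX_def \<Delta>_def Hausdorff_space_closedin_diagonal .
  have "\<exists>z. (z, z) \<in> orbit_closure H XX aa (x, y)" if xy: "x \<in> topspace X" "y \<in> topspace X" for x y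
  proof (rule ccontr)
    assume no: "\<nexists>z. (z, z) \<in> orbit_closure H XX aa (x, y)"
    define C where "C = orbit_closure H XX aa (x, y)"
    have xyXX: "(x, y) \<in> topspace XX" using xy by (simp add: XX_def)
    have clC: "closedin XX C" by (simp add: C_def)
    have "normal_space XX"
      using flow_compact[OF flXX] flow_Hausdorff[OF flXX] compact_Hausdorff_or_regular_imp_normal_space by blast
    moreover have "openin XX (topspace XX - \<Delta>)" "C \<subseteq> topspace XX - \<Delta>"
      using \<Delta> no closedin_subset[OF clC] by (auto simp: C_def \<Delta>_def)
    ultimately obtain O' where O': "openin XX O'" "C \<subseteq> O'" "XX closure_of O' \<subseteq> topspace XX - \<Delta>"
      using clC unfolding normal_space_alt by meson
    define R where "R = {q \<in> topspace (prod_topology (top_of_set UNIV) XX). (\<lambda>(g, y). aa g y) q \<in> O'}"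
    have "openin (prod_topology (top_of_set UNIV) XX) R"
      unfolding R_def by (rule openin_continuous_map_preimage[OF flow_continuous[OF flXX] O'(1)])
    moreover have "compactin XX C" by (rule closedin_compact_space[OF flow_compact[OF flXX] clC])
    moreover have "{0} \<times> C \<subseteq> R"
    proof
      fix q assume "q \<in> {0::'a} \<times> C"
      then obtain c where c: "q = (0, c)" "c \<in> C" by blast
      then have "c \<in> topspace XX" using closedin_subset[OF clC] by blast
      then show "q \<in> R" using c O'(2) flow_zero[OF flXX, of c] by (auto simp: R_def)
    qed
    ultimately obtain U V where UV: "openin (top_of_set UNIV) U" "0 \<in> U" "C \<subseteq> V" "U \<times> V \<subseteq> R"
      using tube_lemma_right[of "top_of_set UNIV" XX R C 0] by auto
    have "open U" using UV(1) by simp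
    then obtain F where F: "finite F" "F + (U + H) = UNIV"
      using H UV(2) unfolding presyndetic_def by blast
    define T where "T = (\<Union>f\<in>F. aa f ` (XX closure_of O'))"
    have "closedin XX (aa f ` (XX closure_of O'))" for f
      using homeomorphic_imp_closed_map[OF flow_homeomorphic_act[OF flXX]] by (simp add: closed_map_def)
    then have "closedin XX T" unfolding T_def using F(1) by (intro closedin_Union) auto
    moreover have "orbit_of UNIV aa (x, y) \<subseteq> T"
    proof
      fix q assume "q \<in> orbit_of UNIV aa (x, y)"
      then obtain g where g: "q = aa g (x, y)" by (auto simp: orbit_of_def)
      have "g \<in> F + (U + H)" using F(2) by simp
      then obtain f u h where fuh: "f \<in> F" "u \<in> U" "h \<in> H" "g = f + (u + h)"
        by (auto simp: set_plus_def)
      have "aa h (x, y) \<in> C" unfolding C_def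
        using orbit_subset_orbit_closure[OF flow_restrict[OF flXX] xyXX, of H] fuh(3) by (auto simp: orbit_of_def)
      then have "aa u (aa h (x, y)) \<in> O'" 
        using subsetD[OF UV(4), of "(u, aa h (x, y))"] UV(3) fuh(2) by (auto simp: R_def)
      then have "aa u (aa h (x, y)) \<in> XX closure_of O'"
        using closure_of_subset[OF openin_subset[OF O'(1)]] by blast
      moreover have "q = aa f (aa u (aa h (x, y)))"
        using flow_add[OF flXX xyXX, of f "u + h"] flow_add[OF flXX xyXX, of u h] g fuh(4) by simp
      ultimately show "q \<in> T" unfolding T_def using fuh(1) by blast
    qed
    ultimately have "orbit_closure UNIV XX aa (x, y) \<subseteq> T" by (intro closure_of_minimal)
    moreover obtain z where z: "(z, z) \<in> orbit_closure UNIV XX aa (x, y)"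
      using p xy unfolding proximal_flow_iff XX_def aa_def by blast
    ultimately obtain f s t where st: "(s, t) \<in> XX closure_of O'" "(z, z) = (a f s, a f t)"
      unfolding T_def aa_def by force
    have st': "s \<in> topspace X" "t \<in> topspace X" "(s, t) \<notin> \<Delta>" using st(1) O'(3) by (auto simp: XX_def)
    have "a f s = a f t" using st(2) by auto
    then have "a (- f) (a f s) = a (- f) (a f t)" by (rule arg_cong)
    then have "s = t" using flow_act_inverse(1)[OF fl] st' by simp
    then show False using st' by (auto simp: \<Delta>_def)
  qed
  then show ?thesis
    unfolding proximal_flow_iff XX_def aa_def using flow_restrict[OF fl] by blast
qed

lemma presyndetic_superset:
  assumes "presyndetic H" "closed_subgroup L" "H \<subseteq> L"
  shows "presyndetic L"
  unfolding presyndetic_def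
proof (intro conjI assms(2) allI impI)
  fix U :: "'a set" assume "open U \<and> 0 \<in> U"
  then obtain F where "finite F" "F + (U + H) = UNIV" using assms(1) unfolding presyndetic_def by blast
  moreover have "F + (U + H) \<subseteq> F + (U + L)" using assms(3) by (intro set_plus_mono2 subset_refl)
  ultimately show "\<exists>F. finite F \<and> F + (U + L) = UNIV" by blast
qed

text \<open>
  By minimality and compactness finitely many group elements suffice to bring every point into the
  neighbourhood \<open>W\<close> of \<open>x\<close> given by the open mapping theorem.
\<close>

lemma stabilizer_presyndetic:
  fixes act :: "'g::{topological_group_add, complete_space} \<Rightarrow> 'p \<Rightarrow> 'p"
  assumes m: "minimal_flow UNIV P act" and x: "nearly_open_point P act x"
  shows "presyndetic (stabilizer act x)"
  unfolding presyndetic_def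
proof (intro conjI allI impI)
  have fl: "flow UNIV P act" using m by (simp add: minimal_flow_def)
  have xP: "x \<in> topspace P" using x by (simp add: nearly_open_point_def)
  show "closed_subgroup (stabilizer act x)" by (rule closed_subgroup_stabilizer[OF fl xP])
  fix U :: "'g set" assume U: "open U \<and> 0 \<in> U"
  then obtain W where W: "openin P W" "x \<in> W"
    "\<And>g. act g x \<in> W \<Longrightarrow> \<exists>u\<in>U. \<exists>k\<in>stabilizer act x. g = u + k"
    using effros_open_orbit_map[OF fl x] by blast
  define R where "R g = {p \<in> topspace P. act g p \<in> W}" for g
  have oR: "openin P (R g)" for g
    unfolding R_def using openin_continuous_map_preimage[OF flow_continuous_act[OF fl] W(1)] by blast
  have cover: "topspace P \<subseteq> \<Union>(range R)"
  proof
    fix p assume p: "p \<in> topspace P"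
    then have "x \<in> orbit_closure UNIV P act p" using minimal_flow_orbit_closure[OF m] xP by simp
    from closure_of_meets[OF this W(1,2)] show "p \<in> \<Union>(range R)"
      using p by (auto simp: R_def orbit_of_def)
  qed
  have "\<forall>U\<in>range R. openin P U" using oR by blast
  with cover have "\<exists>\<F>. finite \<F> \<and> \<F> \<subseteq> range R \<and> topspace P \<subseteq> \<Union>\<F>"
    using flow_compact[OF fl, unfolded compact_space_alt, rule_format, of "range R"] by metis
  then obtain \<F> where \<F>: "finite \<F>" "\<F> \<subseteq> range R" "topspace P \<subseteq> \<Union>\<F>" by blast
  then obtain G where G: "finite G" "\<F> = R ` G" using finite_subset_image by metis
  have "h \<in> uminus ` G + (U + stabilizer act x)" for h
  proof -
    have "act h x \<in> topspace P" by (rule flow_act_in[OF fl xP])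
    then obtain g where g: "g \<in> G" "act g (act h x) \<in> W" using \<F>(3) G(2) by (auto simp: R_def)
    then have "act (g + h) x \<in> W" using flow_add[OF fl xP, of g h] by simp
    then obtain u k where uk: "u \<in> U" "k \<in> stabilizer act x" "g + h = u + k" using W(3) by blast
    have "h = - g + (u + k)" by (simp add: uk(3)[symmetric] add.assoc[symmetric])
    then show ?thesis using g(1) uk(1,2) by (auto simp: set_plus_def)
  qed
  then show "\<exists>F. finite F \<and> F + (U + stabilizer act x) = UNIV"
    using G(1) by (intro exI[of _ "uminus ` G"]) auto
qed

text \<open>
  Finitely many translates of \<open>V H\<close> cover the group, so finitely many translates of the closure of
  \<open>V x = V H x\<close> cover the closure of the orbit.
\<close>

lemma presyndetic_fixed_point_nearly_open:
  assumes m: "minimal_flow UNIV P act" and H: "presyndetic H"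
    and x: "x \<in> topspace P" "\<And>h. h \<in> H \<Longrightarrow> act h x = x"
  shows "nearly_open_point P act x"
proof -
  have fl: "flow UNIV P act" using m by (simp add: minimal_flow_def)
  show ?thesis
  proof (rule nearly_open_point_of_countable_cover[OF fl x(1), of "{}"])
    fix V :: "'a set" assume V: "open V" "0 \<in> V"
    then obtain F where F: "finite F" "F + (V + H) = UNIV" using H unfolding presyndetic_def by blast
    define T where "T = (\<Union>q\<in>F. P closure_of ((\<lambda>g. act (q + g) x) ` V))"
    have "closedin P T" unfolding T_def using F(1) by (intro closedin_Union) auto
    moreover have "orbit_of UNIV act x \<subseteq> T"
    proof
      fix y assume "y \<in> orbit_of UNIV act x"
      then obtain g where g: "y = act g x" by (auto simp: orbit_of_def)
      have "g \<in> F + (V + H)" using F(2) by simp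
      then obtain f v h where fvh: "f \<in> F" "v \<in> V" "h \<in> H" "g = f + v + h"
        by (auto simp: set_plus_def add.assoc)
      have "y = act (f + v) x" using flow_add[OF fl x(1), of "f + v" h] x(2)[OF fvh(3)] g fvh(4) by simp
      moreover have "(\<lambda>g. act (f + g) x) ` V \<subseteq> P closure_of ((\<lambda>g. act (f + g) x) ` V)"
        by (rule closure_of_subset) (use flow_act_in[OF fl x(1)] in blast)
      ultimately show "y \<in> T" unfolding T_def using fvh(1,2) by blast
    qed
    ultimately have "orbit_closure UNIV P act x \<subseteq> T" by (intro closure_of_minimal)
    then have "topspace P \<subseteq> \<Union>{} \<union> T" using minimal_flow_orbit_closure[OF m x(1)] by simp
    then show "\<exists>Q. countable Q \<and> topspace P \<subseteq> \<Union>{} \<union> (\<Union>q\<in>Q. P closure_of ((\<lambda>g. act (q + g) x) ` V))"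
      unfolding T_def using F(1) countable_finite by blast
  qed auto
qed

lemma presyndetic_strongly_amenable_fixed_point:
  assumes m: "minimal_flow UNIV P act" and p: "proximal_flow UNIV P act"
    and H: "presyndetic H" "strongly_amenable H"
  obtains x where "nearly_open_point P act x" "H \<subseteq> stabilizer act x"
proof -
  have "closed_subgroup H" using H(1) by (simp add: presyndetic_def)
  from strongly_amenable_fixed_point[OF H(2) this presyndetic_proximal_restrict[OF H(1) p]]
  obtain x where x: "x \<in> topspace P" "\<And>h. h \<in> H \<Longrightarrow> act h x = x" by blast
  show thesis
    using that[of x] presyndetic_fixed_point_nearly_open[OF m H(1) x] x(2) by (auto simp: stabilizer_def)
qed

section \<open>The stabilizer is maximal strongly amenable\<close>

text \<open>
  Let \<open>Y\<close> be a minimal proximal flow of \<open>K = stabilizer act x\<close>, and \<open>F = set_distance K a A (-) y\<close> at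
  a continuity point \<open>y\<close>. The fibre of the orbit closure of \<open>(F, x)\<close> over \<open>x\<close> is a factor of the orbit
  closure of \<open>(F, y)\<close>, which is an almost one-to-one extension of \<open>Y\<close> and so still proximal. Hence the
  fibre collapses to \<open>F\<close>, and \<open>F\<close> is \<open>K\<close>-invariant.
\<close>

lemma set_distance_invariant:
  fixes act :: "'g::{topological_group_add, polish_space} \<Rightarrow> 'p \<Rightarrow> 'p" and Y :: "'y topology"
  assumes univ: "universal_minimal_proximal_flow P act" and x: "nearly_open_point P act x"
    and m: "minimal_flow (stabilizer act x) Y a" and p: "proximal_flow (stabilizer act x) Y a"
    and y: "set_distance_continuity_point (stabilizer act x) Y a A y"
    and k: "k \<in> stabilizer act x"
  shows "set_distance (stabilizer act x) a A 0 (a k y) = set_distance (stabilizer act x) a A 0 y"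
proof -
  define K where "K = stabilizer act x"
  have flP: "flow UNIV P act" using univ by (simp add: universal_minimal_proximal_flow_def minimal_flow_def)
  have xP: "x \<in> topspace P" using x by (simp add: nearly_open_point_def)
  have K: "closed_subgroup K" unfolding K_def by (rule closed_subgroup_stabilizer[OF flP xP])
  have flY: "flow K Y a" using m by (simp add: minimal_flow_def K_def)
  have yY: "y \<in> topspace Y" using y by (simp add: set_distance_continuity_point_def)
  define F where "F g = set_distance K a A g y" for g
  have F: "right_unif_cont F" unfolding F_def by (rule right_unif_cont_set_distance)
  obtain M where M: "F \<in> M" "closed M" "flow UNIV (top_of_set M) shift"
    using right_unif_cont_function_flow[OF F] by blast
  define \<Omega> where "\<Omega> = top_of_set M"
  have flO1: "flow UNIV \<Omega> shift" using M(3) by (simp add: \<Omega>_def)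
  have topO: "topspace \<Omega> = M" by (simp add: \<Omega>_def)
  have flO: "flow K \<Omega> shift" by (rule flow_restrict[OF flO1])
  define X where "X = prod_topology \<Omega> Y"
  define b where "b = pair_action shift a"
  have flX: "flow K X b" unfolding X_def b_def by (rule flow_prod[OF flO flY])
  define XX where "XX = prod_topology X X"
  define bb where "bb = pair_action b b"
  have flXX: "flow K XX bb" unfolding XX_def bb_def by (rule flow_prod[OF flX flX])
  have topX: "topspace X = M \<times> topspace Y" by (simp add: X_def topO)
  have FyX: "(F, y) \<in> topspace X" using M(1) yY by (simp add: topX)
  define S where "S = orbit_closure K X b (F, y)"
  have SX: "S \<subseteq> topspace X" unfolding S_def by (rule closure_of_subset_topspace)
  have XE: "X = subtopology (prod_topology euclidean Y) (M \<times> UNIV)"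
    unfolding X_def \<Omega>_def by (simp add: subtopology_Times)
  have single: "\<eta> = F" if "(\<eta>, y) \<in> S" for \<eta>
  proof -
    have "S \<subseteq> orbit_closure K (prod_topology euclidean Y) (pair_action shift a) (F, y)"
      unfolding S_def XE b_def by (rule closure_of_subtopology_subset)
    then show ?thesis
      using set_distance_graph_singleton[OF flY K y[folded K_def]] that unfolding F_def by blast
  qed
  have pairS: "((F, y), (F, y)) \<in> orbit_closure K XX bb (s, t)" if st: "s \<in> S" "t \<in> S" for s t
  proof -
    have c: "continuous_map X Y snd" unfolding X_def by (rule continuous_map_snd)
    have e: "equivariant_on K (topspace X) b a snd" by (auto simp: equivariant_on_def b_def)
    from pair_moves_to_fibre[OF K flX m[folded K_def] p[folded K_def] c e yY FyX st[unfolded S_def]]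
    obtain w w' where w: "w \<in> S" "w' \<in> S" "snd w = y" "snd w' = y" "(w, w') \<in> orbit_closure K XX bb (s, t)"
      unfolding S_def XX_def bb_def by blast
    have "w = (fst w, y)" "w' = (fst w', y)" using w(3,4) by (auto simp: prod_eq_iff)
    then have "w = (F, y)" "w' = (F, y)" using single w(1,2) by metis+
    then show ?thesis using w(5) by simp
  qed
  \<comment> \<open>Every point of the fibre over \<open>x\<close> lifts to the orbit closure \<open>S\<close> of \<open>(F, y)\<close>.\<close>
  have lift: "\<exists>s\<in>S. fst s = \<omega>" if "(\<omega>, x) \<in> graph_closure P act F x" for \<omega>
  proof -
    have "\<omega> \<in> closure ((\<lambda>k. shift k F) ` K)"
      unfolding K_def by (rule graph_closure_fibre_nearly_open[OF flP x F that])
    moreover have sub: "(\<lambda>k. shift k F) ` K \<subseteq> M" using flow_act_in[OF flO1] M(1) unfolding topO by auto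
    ultimately have "\<omega> \<in> M" using closure_minimal[OF _ M(2)] by blast
    then have "\<omega> \<in> \<Omega> closure_of ((\<lambda>k. shift k F) ` K)"
      using \<open>\<omega> \<in> closure ((\<lambda>k. shift k F) ` K)\<close> sub unfolding \<Omega>_def
      by (simp add: closure_of_subtopology Int_absorb1)
    moreover have "\<Omega> closure_of ((\<lambda>k. shift k F) ` K) = fst ` S"
      using orbit_closure_image[OF flX flow_Hausdorff[OF flO], of fst shift "(F, y)"] FyX
      by (auto simp: X_def b_def equivariant_on_def continuous_map_fst orbit_of_def S_def)
    ultimately show ?thesis by auto
  qed
  have "(F, F) \<in> prod_topology euclidean euclidean closure_of ((\<lambda>k. (shift k \<omega>, shift k \<omega>')) ` K)"
    if \<omega>: "(\<omega>, x) \<in> graph_closure P act F x" "(\<omega>', x) \<in> graph_closure P act F x" for \<omega> \<omega>'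
  proof -
    obtain s t where st: "s \<in> S" "t \<in> S" "fst s = \<omega>" "fst t = \<omega>'" using lift \<omega> by metis
    define j where "j = (\<lambda>p :: (('g \<Rightarrow> real) \<times> 'y) \<times> (('g \<Rightarrow> real) \<times> 'y). (fst (fst p), fst (snd p)))"
    have "continuous_map X euclidean fst"
      using continuous_map_fst unfolding X_def \<Omega>_def by (rule continuous_map_into_fulltopology)
    then have "continuous_map XX (prod_topology euclidean euclidean) j"
      unfolding j_def XX_def
      by (intro continuous_map_pairedI continuous_map_compose[OF continuous_map_fst, unfolded o_def]
          continuous_map_compose[OF continuous_map_snd, unfolded o_def])
    from continuous_map_image_closure_subset[OF this, of "orbit_of K bb (s, t)"]
    have "j ((F, y), (F, y)) \<in> prod_topology euclidean euclidean closure_of (j ` orbit_of K bb (s, t))"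
      using pairS[OF st(1,2)] by blast
    moreover have "j ` orbit_of K bb (s, t) = (\<lambda>k. (shift k \<omega>, shift k \<omega>')) ` K"
      unfolding orbit_of_def image_image j_def bb_def b_def st(3,4)[symmetric]
      by (rule image_cong) (auto simp: pair_action_def case_prod_unfold)
    ultimately show ?thesis by (simp add: j_def)
  qed
  then have "shift k F = F"
    using extension_of_collapsing_fibre[OF univ xP F] k unfolding K_def by blast
  then have "shift k F 0 = F 0" by simp
  then show ?thesis
    using set_distance_act[OF flY K yY, of k A 0] k unfolding F_def shift_apply K_def by simp
qed

text \<open>
  Otherwise disjoint neighbourhoods \<open>A\<close> of \<open>v\<close> and \<open>B\<close> of \<open>w\<close> could be chosen at positive distance along
  the group. The distance to \<open>A\<close> would be zero at points of \<open>A\<close> and positive on \<open>B\<close>, although it is constant on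
  a dense orbit.
\<close>

lemma stabilizer_minimal_proximal_flow_trivial:
  fixes act :: "'g::{topological_group_add, polish_space} \<Rightarrow> 'p \<Rightarrow> 'p"
  assumes univ: "universal_minimal_proximal_flow P act" and x: "nearly_open_point P act x"
    and m: "minimal_flow (stabilizer act x) Y a" and p: "proximal_flow (stabilizer act x) Y a"
    and v: "v \<in> topspace Y" and w: "w \<in> topspace Y"
  shows "v = w"
proof (rule ccontr)
  assume vw: "v \<noteq> w"
  define K where "K = stabilizer act x"
  have flP: "flow UNIV P act" using univ by (simp add: universal_minimal_proximal_flow_def minimal_flow_def)
  have xP: "x \<in> topspace P" using x by (simp add: nearly_open_point_def)
  have K: "closed_subgroup K" unfolding K_def by (rule closed_subgroup_stabilizer[OF flP xP])
  have flY: "flow K Y a" using m by (simp add: minimal_flow_def K_def)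
  obtain A C where AC: "openin Y A" "openin Y C" "v \<in> A" "w \<in> C" "disjnt A C"
    using flow_Hausdorff[OF flY] vw v w unfolding Hausdorff_space_def by blast
  \<comment> \<open>By joint continuity at \<open>(0, w)\<close>, small elements move a smaller neighbourhood \<open>B\<close> of \<open>w\<close> into \<open>C\<close>, off \<open>A\<close>.\<close>
  have "\<exists>r>0. \<exists>B. openin Y B \<and> w \<in> B \<and> (\<forall>k\<in>K. gnorm k < r \<longrightarrow> (\<forall>z\<in>B. a k z \<in> C))"
  proof -
    have "openin (prod_topology (top_of_set K) Y) {q \<in> topspace (prod_topology (top_of_set K) Y). (\<lambda>(g, y). a g y) q \<in> C}"
      by (rule openin_continuous_map_preimage[OF flow_continuous[OF flY] AC(2)])
    moreover have "(0, w) \<in> {q \<in> topspace (prod_topology (top_of_set K) Y). (\<lambda>(g, y). a g y) q \<in> C}"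
      using K w AC(4) flow_zero[OF flY w] by (simp add: closed_subgroup_def)
    ultimately obtain U B where UB: "openin (top_of_set K) U" "openin Y B" "0 \<in> U" "w \<in> B"
      "U \<times> B \<subseteq> {q \<in> topspace (prod_topology (top_of_set K) Y). (\<lambda>(g, y). a g y) q \<in> C}"
      unfolding openin_prod_topology_alt by meson
    obtain U' where U': "open U'" "U = K \<inter> U'" using UB(1) unfolding openin_open by blast
    then have "0 \<in> U'" using UB(3) by blast
    from gnorm_ball_subset[OF U'(1) this] obtain r where "r > 0" "\<And>g. gnorm g < r \<Longrightarrow> g \<in> U'" by blast
    moreover have "a k z \<in> C" if "k \<in> K" "k \<in> U'" "z \<in> B" for k z
      using subsetD[OF UB(5), of "(k, z)"] that U'(2) by simp
    ultimately show ?thesis using UB(2,4) by (intro exI[of _ r] conjI exI[of _ B]) blast+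
  qed
  then obtain r B where r: "r > 0" and B: "openin Y B" "w \<in> B"
    "\<And>k z. k \<in> K \<Longrightarrow> gnorm k < r \<Longrightarrow> z \<in> B \<Longrightarrow> a k z \<in> C" by blast
  let ?f = "set_distance K a A 0"
  obtain y where y: "set_distance_continuity_point K Y a A y"
    using set_distance_continuity_point_exists[OF flY AC(1)] by blast
  have yY: "y \<in> topspace Y" using y by (simp add: set_distance_continuity_point_def)
  have inv: "?f (a k y) = ?f y" if "k \<in> K" for k
    using set_distance_invariant[OF univ x m p y[unfolded K_def] that[unfolded K_def]] by (simp add: K_def)
  have dense: "orbit_closure K Y a y = topspace Y"
    using minimal_flow_orbit_closure[OF m yY] by (simp add: K_def)
  obtain k where k: "k \<in> K" "a k y \<in> A"
    using closure_of_meets[of v Y "orbit_of K a y" A] AC v dense by (auto simp: orbit_of_def)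
  obtain l where l: "l \<in> K" "a l y \<in> B"
    using closure_of_meets[of w Y "orbit_of K a y" B] B w dense by (auto simp: orbit_of_def)
  have "0 \<in> K" "a 0 (a k y) \<in> A"
    using K k flow_zero[OF flY flow_action_in[OF flY k(1) yY]] by (auto simp: closed_subgroup_def)
  from set_distance_le[of 0 K a "a k y" A 0, OF this] have "?f (a k y) \<le> 0" by simp
  then have "?f (a l y) \<le> 0" using inv k(1) l(1) by simp
  then have "?f (a l y) < min r 1" using r by simp
  then obtain k' where "k' \<in> K" "a k' (a l y) \<in> A" "gnorm k' < r"
    unfolding set_distance_less_iff by auto
  then show False using B(3)[OF _ _ l(2)] AC(5) by (auto simp: disjnt_iff)
qed

lemma stabilizer_strongly_amenable:
  fixes act :: "'g::{topological_group_add, polish_space} \<Rightarrow> 'p \<Rightarrow> 'p"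
  assumes univ: "universal_minimal_proximal_flow P act" and x: "nearly_open_point P act x"
  shows "strongly_amenable (stabilizer act x)"
  unfolding strongly_amenable_def
proof (intro allI impI)
  fix X :: "'g set set topology" and a
  let ?K = "stabilizer act x"
  assume prox: "proximal_flow ?K X a"
  have flP: "flow UNIV P act" using univ by (simp add: universal_minimal_proximal_flow_def minimal_flow_def)
  have xP: "x \<in> topspace P" using x by (simp add: nearly_open_point_def)
  obtain S where S: "S \<subseteq> topspace X" "minimal_flow ?K (subtopology X S) a" "proximal_flow ?K (subtopology X S) a"
    using minimal_proximal_subflow[OF prox closed_subgroup_stabilizer[OF flP xP]] by blast
  have topS: "topspace (subtopology X S) = S" using S(1) by auto
  have fl: "flow ?K (subtopology X S) a" using S(2) by (simp add: minimal_flow_def)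
  then have "S \<noteq> {}" unfolding flow_def topS by blast
  then obtain s where s: "s \<in> S" by blast
  have "a g s = s" if "g \<in> ?K" for g
    using stabilizer_minimal_proximal_flow_trivial[OF univ x S(2,3)] flow_action_in[OF fl that] s unfolding topS by blast
  then show "\<exists>x\<in>topspace X. \<forall>g\<in>?K. a g x = x" using s S(1) by blast
qed

text \<open>
  Group elements that bring \<open>(x, q)\<close> near the diagonal point \<open>(x, x)\<close> nearly fix \<open>x\<close>, hence differ
  little from stabilizer elements, and so hardly move \<open>q\<close>. This gives maximality below, as a larger
  strongly amenable group fixes some \<open>q\<close>.
\<close>

lemma stabilizer_fixes_only:
  fixes act :: "'g::{topological_group_add, complete_space} \<Rightarrow> 'p \<Rightarrow> 'p"
  assumes m: "minimal_flow UNIV P act" and p: "proximal_flow UNIV P act" and x: "nearly_open_point P act x"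
    and q: "q \<in> topspace P" "\<And>k. k \<in> stabilizer act x \<Longrightarrow> act k q = q"
  shows "q = x"
proof (rule ccontr)
  assume "q \<noteq> x"
  have fl: "flow UNIV P act" using m by (simp add: minimal_flow_def)
  have xP: "x \<in> topspace P" using x by (simp add: nearly_open_point_def)
  obtain A B where AB: "openin P A" "openin P B" "q \<in> A" "x \<in> B" "disjnt A B"
    using flow_Hausdorff[OF fl] q(1) xP \<open>q \<noteq> x\<close> unfolding Hausdorff_space_def by blast
  have "open {g. act g q \<in> A}" by (rule open_orbit_preimage[OF fl q(1) AB(1)])
  moreover have "0 \<in> {g. act g q \<in> A}" using AB(3) flow_zero[OF fl q(1)] by simp
  ultimately obtain W where W: "openin P W" "x \<in> W"
    "\<And>g. act g x \<in> W \<Longrightarrow> \<exists>u\<in>{g. act g q \<in> A}. \<exists>k\<in>stabilizer act x. g = u + k"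
    using effros_open_orbit_map[OF fl x] by blast
  have cl: "(x, x) \<in> orbit_closure UNIV (prod_topology P P) (pair_action act act) (x, q)"
    by (rule minimal_proximal_pair[OF closed_subgroup_UNIV m p xP q(1) xP])
  have "openin (prod_topology P P) (W \<times> B)" "(x, x) \<in> W \<times> B"
    using W AB by (auto simp: openin_prod_Times_iff)
  from closure_of_meets[OF cl this]
  obtain z where "z \<in> orbit_of UNIV (pair_action act act) (x, q)" "z \<in> W \<times> B" by (elim bexE)
  then obtain g where g: "act g x \<in> W" "act g q \<in> B" by (auto simp: orbit_of_def)
  obtain u k where uk: "act u q \<in> A" "k \<in> stabilizer act x" "g = u + k" using W(3)[OF g(1)] by blast
  have "act g q = act u q" using flow_add[OF fl q(1), of u k] q(2)[OF uk(2)] uk(3) by simp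
  then show False using g(2) uk(1) AB(5) by (auto simp: disjnt_iff)
qed

lemma stabilizer_maximal_strongly_amenable:
  fixes act :: "'g::{topological_group_add, polish_space} \<Rightarrow> 'p \<Rightarrow> 'p"
  assumes univ: "universal_minimal_proximal_flow P act" and x: "nearly_open_point P act x"
  shows "maximal_strongly_amenable (stabilizer act x)"
  unfolding maximal_strongly_amenable_def
proof (intro conjI allI impI)
  have m: "minimal_flow UNIV P act" and p: "proximal_flow UNIV P act"
    using univ by (auto simp: universal_minimal_proximal_flow_def)
  have fl: "flow UNIV P act" using m by (simp add: minimal_flow_def)
  have xP: "x \<in> topspace P" using x by (simp add: nearly_open_point_def)
  show "closed_subgroup (stabilizer act x)" by (rule closed_subgroup_stabilizer[OF fl xP])
  show "strongly_amenable (stabilizer act x)" by (rule stabilizer_strongly_amenable[OF univ x])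
  fix L assume L: "closed_subgroup L \<and> strongly_amenable L \<and> stabilizer act x \<subseteq> L"
  then have "presyndetic L"
    using presyndetic_superset[OF stabilizer_presyndetic[OF m x]] by blast
  then obtain q where q: "nearly_open_point P act q" "L \<subseteq> stabilizer act q"
    using presyndetic_strongly_amenable_fixed_point[OF m p, of L] L by blast
  have "q = x"
  proof (rule stabilizer_fixes_only[OF m p x])
    show "q \<in> topspace P" using q(1) by (simp add: nearly_open_point_def)
    show "act k q = q" if "k \<in> stabilizer act x" for k
      using that L q(2) by (auto simp: stabilizer_def)
  qed
  then show "L = stabilizer act x" using L q(2) by blast
qed


section \<open>Metrizable universal flows have nearly open points\<close>

lemma closure_of_openin_Int_dense:
  assumes "openin X A" "X closure_of D = topspace X"
  shows "X closure_of A \<subseteq> X closure_of (A \<inter> D)"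
proof (rule closure_of_minimal)
  have "A \<inter> X closure_of D \<subseteq> X closure_of (A \<inter> D)"
    by (rule openin_Int_closure_of_subset[OF assms(1)])
  then show "A \<subseteq> X closure_of (A \<inter> D)" using assms openin_subset by blast
qed simp

text \<open>
  A trace of the fact that the universal flow has no proper highly proximal extension. The distance
  to \<open>A\<close> agrees on a dense orbit with a continuous function, which vanishes on the closure of \<open>A\<close> and is at least
  \<open>min r 1\<close> on the closure of \<open>B\<close>. The base point is a continuity point of all distance functions,
  so the fibre over it in the graph closure is a single function.
\<close>

lemma separated_open_sets_disjoint_closures:
  fixes act :: "'g::{topological_group_add, polish_space} \<Rightarrow> 'p \<Rightarrow> 'p"
  assumes univ: "universal_minimal_proximal_flow P act"
    and A: "openin P A" and B: "openin P B" and r: "r > 0"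
    and sep: "\<And>g z. gnorm g < r \<Longrightarrow> z \<in> A \<Longrightarrow> act g z \<notin> B"
  shows "P closure_of A \<inter> P closure_of B = {}"
proof -
  have m: "minimal_flow UNIV P act" using univ by (simp add: universal_minimal_proximal_flow_def)
  have fl: "flow UNIV P act" using m by (simp add: minimal_flow_def)
  obtain y where y: "set_distance_continuity_point UNIV P act A y"
    using set_distance_continuity_point_exists[OF fl A] by blast
  have yP: "y \<in> topspace P" using y by (simp add: set_distance_continuity_point_def)
  define F where "F g = set_distance UNIV act A g y" for g
  have single: "\<omega> = F" if "(\<omega>, y) \<in> graph_closure P act F y" for \<omega>
    using set_distance_graph_singleton[OF fl closed_subgroup_UNIV y] that
    unfolding graph_closure_def F_def by blast
  have "0 \<in> stabilizer act y" using flow_zero[OF fl yP] by (simp add: stabilizer_def)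
  then have "(F, F) \<in> prod_topology euclidean euclidean closure_of ((\<lambda>k. (shift k F, shift k F)) ` stabilizer act y)"
    by (intro subsetD[OF closure_of_subset]) (auto intro!: image_eqI[of _ _ 0])
  then obtain f where f: "continuous_map P euclideanreal f" "\<And>g. f (act g y) = F g"
    using extension_of_collapsing_fibre[OF univ yP right_unif_cont_set_distance[of UNIV act A y, folded F_def]] single
    by blast
  have dense: "orbit_closure UNIV P act y = topspace P" by (rule minimal_flow_orbit_closure[OF m yP])
  have clA: "closedin P {p \<in> topspace P. f p \<in> {..0}}" and clB: "closedin P {p \<in> topspace P. f p \<in> {min r 1..}}"
    by (rule closedin_continuous_map_preimage[OF f(1)], simp)+
  have "F g \<le> 0" if "act g y \<in> A" for g
    unfolding F_def using set_distance_le[of g UNIV act y A g] that by simp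
  then have "A \<inter> orbit_of UNIV act y \<subseteq> {p \<in> topspace P. f p \<in> {..0}}"
    using f(2) flow_act_in[OF fl yP] by (auto simp: orbit_of_def)
  from closure_of_minimal[OF this clA]
  have 1: "P closure_of A \<subseteq> {p \<in> topspace P. f p \<in> {..0}}"
    by (rule order_trans[OF closure_of_openin_Int_dense[OF A dense]])
  have "min r 1 \<le> F g" if g: "act g y \<in> B" for g
  proof (rule ccontr)
    assume "\<not> min r 1 \<le> F g"
    then obtain k where k: "act k y \<in> A" "gnorm (k - g) < r"
      unfolding F_def not_le set_distance_less_iff by auto
    have "act (g - k) (act k y) = act g y" using flow_add[OF fl yP, of "g - k" k] by simp
    then show False using sep[of "g - k" "act k y"] k g by (simp add: gnorm_minus_commute)
  qed
  then have "B \<inter> orbit_of UNIV act y \<subseteq> {p \<in> topspace P. f p \<in> {min r 1..}}"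
    using f(2) flow_act_in[OF fl yP] by (auto simp: orbit_of_def)
  from closure_of_minimal[OF this clB]
  have 2: "P closure_of B \<subseteq> {p \<in> topspace P. f p \<in> {min r 1..}}"
    by (rule order_trans[OF closure_of_openin_Int_dense[OF B dense]])
  show ?thesis using 1 2 r by fastforce
qed

lemma compact_metrizable_subsequence:
  fixes z :: "nat \<Rightarrow> 'a"
  assumes "metrizable_space X" "compact_space X" "range z \<subseteq> topspace X"
  obtains l r where "strict_mono (r :: nat \<Rightarrow> nat)" "limitin X (z \<circ> r) l sequentially"
proof -
  obtain M d where M: "Metric_space M d" "X = Metric_space.mtopology M d"
    using assms(1) unfolding metrizable_space_def by blast
  interpret Metric_space M d by (rule M(1))
  show thesis
    using assms(2,3) that unfolding M(2) compact_space_sequentially topspace_mtopology by blast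
qed

lemma compact_metrizable_countable_base:
  assumes "metrizable_space X" "compact_space X"
  obtains \<B> where "countable \<B>" "\<And>B. B \<in> \<B> \<Longrightarrow> openin X B"
    "\<And>W z. openin X W \<Longrightarrow> z \<in> W \<Longrightarrow> \<exists>B\<in>\<B>. z \<in> B \<and> B \<subseteq> W"
proof -
  obtain M d where M: "Metric_space M d" "X = Metric_space.mtopology M d"
    using assms(1) unfolding metrizable_space_def by blast
  interpret Metric_space M d by (rule M(1))
  have "mtotally_bounded M"
    using assms(2) unfolding M(2) by (simp add: compact_space_eq_mcomplete_mtotally_bounded)
  then have "\<exists>K. finite K \<and> K \<subseteq> M \<and> M \<subseteq> (\<Union>x\<in>K. mball x (inverse (Suc n)))" for n
    unfolding mtotally_bounded_def by simp
  then obtain K where K: "\<And>n. finite (K n)" "\<And>n. M \<subseteq> (\<Union>x\<in>K n. mball x (inverse (Suc n)))" by metis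
  define \<B> where "\<B> = (\<Union>n. (\<lambda>x. mball x (inverse (Suc n))) ` K n)"
  show thesis
  proof (rule that[of \<B>])
    show "countable \<B>" unfolding \<B>_def using K(1) by (intro countable_UN countable_image) (auto intro: countable_finite)
    show "openin X B" if "B \<in> \<B>" for B using that unfolding \<B>_def M(2) by auto
    fix W z assume W: "openin X W" "z \<in> W"
    then obtain e where e: "e > 0" "mball z e \<subseteq> W" and zM: "z \<in> M"
      unfolding M(2) openin_mtopology by blast
    obtain n where n: "inverse (Suc n) < e / 2" using reals_Archimedean[of "e/2"] e(1) by auto
    obtain x where x: "x \<in> K n" "z \<in> mball x (inverse (Suc n))" using K(2) zM by blast
    have "mball x (inverse (Suc n)) \<subseteq> mball z e"
    proof
      fix t assume t: "t \<in> mball x (inverse (Suc n))"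
      have "d z t \<le> d z x + d x t" using x(2) t zM by (intro triangle) auto
      also have "\<dots> < e" using x(2) t n by (simp add: commute)
      finally show "t \<in> mball z e" using t zM by auto
    qed
    then show "\<exists>B\<in>\<B>. z \<in> B \<and> B \<subseteq> W" using x e(2) unfolding \<B>_def by blast
  qed
qed

text \<open>
  Choose \<open>z n \<in> A n\<close> and a convergent subsequence. Its limit is in the closure of the union of the
  \<open>A n\<close> with even position in the subsequence, and of those with odd position; but these unions are
  separated.
\<close>

lemma no_separated_sequence:
  fixes act :: "'g::{topological_group_add, polish_space} \<Rightarrow> 'p \<Rightarrow> 'p"
  assumes univ: "universal_minimal_proximal_flow P act" and met: "metrizable_space P"
    and A: "\<And>n::nat. openin P (A n)" "\<And>n. A n \<noteq> {}" and r: "r > 0"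
    and sep: "\<And>i j g z. i < j \<Longrightarrow> gnorm g < r \<Longrightarrow> z \<in> A i \<Longrightarrow> act g z \<notin> A j"
  shows False
proof -
  have fl: "flow UNIV P act" using univ by (simp add: universal_minimal_proximal_flow_def minimal_flow_def)
  have AP: "A n \<subseteq> topspace P" for n by (rule openin_subset[OF A(1)])
  define z where "z n = (SOME p. p \<in> A n)" for n
  have z: "z n \<in> A n" for n unfolding z_def using A(2)[of n] by (simp add: some_in_eq)
  have "z n \<in> topspace P" for n using subsetD[OF AP z] .
  then have "range z \<subseteq> topspace P" by (rule image_subsetI)
  then obtain l s where s: "strict_mono (s :: nat \<Rightarrow> nat)" "limitin P (z \<circ> s) l sequentially"
    by (rule compact_metrizable_subsequence[OF met flow_compact[OF fl]])
  have sep': "act g p \<notin> A j" if "i \<noteq> j" "gnorm g < r" "p \<in> A i" for i j g p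
  proof (cases "i < j")
    case True
    then show ?thesis using sep that by blast
  next
    case False
    have "p \<in> topspace P" using AP that(3) by blast
    then have "act (- g) (act g p) \<in> A i" using flow_act_inverse(1)[OF fl] that(3) by simp
    then show ?thesis using sep[of j i "- g" "act g p"] False that(1,2) by auto
  qed
  define E where "E = (\<Union>n. A (s (2 * n)))"
  define O' where "O' = (\<Union>n. A (s (2 * n + 1)))"
  have "openin P E" "openin P O'" unfolding E_def O'_def using A(1) by blast+
  moreover have "act g p \<notin> O'" if "gnorm g < r" "p \<in> E" for g p
  proof -
    obtain n where n: "p \<in> A (s (2 * n))" using \<open>p \<in> E\<close> by (auto simp: E_def)
    have "s (2 * n) \<noteq> s (2 * m + 1)" for m
      using strict_mono_eq[OF s(1)] by presburger
    then show ?thesis using sep' that(1) n unfolding O'_def by blast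
  qed
  ultimately have "P closure_of E \<inter> P closure_of O' = {}"
    using separated_open_sets_disjoint_closures[OF univ _ _ r] by blast
  moreover have "l \<in> P closure_of E" "l \<in> P closure_of O'"
  proof -
    have l: "l \<in> topspace P" using s(2) by (rule limitin_topspace)
    have "\<exists>n. z (s (2 * n)) \<in> T \<and> z (s (2 * n + 1)) \<in> T" if "openin P T" "l \<in> T" for T
    proof -
      have "\<forall>\<^sub>F n in sequentially. (z \<circ> s) n \<in> T" by (rule limitinD[OF s(2) that])
      then obtain N where "\<And>n. n \<ge> N \<Longrightarrow> z (s n) \<in> T" by (auto simp: eventually_sequentially)
      then show ?thesis by (intro exI[of _ N]) auto
    qed
    then have "\<exists>y. y \<in> E \<and> y \<in> T" "\<exists>y. y \<in> O' \<and> y \<in> T" if "openin P T" "l \<in> T" for T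
      using z that unfolding E_def O'_def by blast+
    then show "l \<in> P closure_of E" "l \<in> P closure_of O'" using l by (simp_all add: in_closure_of)
  qed
  ultimately show False by blast
qed

text \<open>
  If every open subset of \<open>W\<close> contained two separated open pieces, splitting off pieces one after
  the other would give an infinite separated sequence.
\<close>

lemma locally_unseparated:
  fixes act :: "'g::{topological_group_add, polish_space} \<Rightarrow> 'p \<Rightarrow> 'p"
  assumes univ: "universal_minimal_proximal_flow P act" and met: "metrizable_space P"
    and W: "openin P W" "W \<noteq> {}" and r: "r > 0"
  shows "\<exists>V\<subseteq>W. openin P V \<and> V \<noteq> {} \<and> (\<forall>A B. openin P A \<and> A \<noteq> {} \<and> A \<subseteq> V \<and> openin P B \<and> B \<noteq> {} \<and> B \<subseteq> V \<longrightarrow>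
    (\<exists>g. gnorm g < r \<and> (\<exists>z\<in>A. act g z \<in> B)))"
proof (rule ccontr)
  assume neg: "\<not> ?thesis"
  have split: "\<exists>A B. openin P A \<and> A \<noteq> {} \<and> A \<subseteq> V \<and> openin P B \<and> B \<noteq> {} \<and> B \<subseteq> V \<and>
      (\<forall>g z. gnorm g < r \<longrightarrow> z \<in> A \<longrightarrow> act g z \<notin> B)" if "V \<subseteq> W" "openin P V" "V \<noteq> {}" for V
    using neg that by meson
  define R where "R p \<longleftrightarrow> snd p \<subseteq> W \<and> openin P (fst p) \<and> fst p \<noteq> {} \<and> openin P (snd p) \<and> snd p \<noteq> {}" for p :: "'p set \<times> 'p set"
  have "\<exists>f. \<forall>n::nat. R (f n) \<and> (fst (f (Suc n)) \<subseteq> snd (f n) \<and> snd (f (Suc n)) \<subseteq> snd (f n) \<and>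
      (\<forall>g z. gnorm g < r \<longrightarrow> z \<in> fst (f (Suc n)) \<longrightarrow> act g z \<notin> snd (f (Suc n))))"
  proof (rule dependent_nat_choice)
    show "\<exists>p. R p" using W by (intro exI[of _ "(W, W)"]) (simp add: R_def)
    fix p :: "'p set \<times> 'p set" and n :: nat assume p: "R p"
    then obtain A B where "openin P A" "A \<noteq> {}" "A \<subseteq> snd p" "openin P B" "B \<noteq> {}" "B \<subseteq> snd p"
        "\<forall>g z. gnorm g < r \<longrightarrow> z \<in> A \<longrightarrow> act g z \<notin> B" using split[of "snd p"] unfolding R_def by auto
    then show "\<exists>q. R q \<and> (fst q \<subseteq> snd p \<and> snd q \<subseteq> snd p \<and> (\<forall>g z. gnorm g < r \<longrightarrow> z \<in> fst q \<longrightarrow> act g z \<notin> snd q))"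
      using p by (intro exI[of _ "(A, B)"]) (auto simp: R_def)
  qed
  then obtain f where f: "\<And>n. R (f n)" "\<And>n. fst (f (Suc n)) \<subseteq> snd (f n)" "\<And>n. snd (f (Suc n)) \<subseteq> snd (f n)"
    "\<And>n g z. gnorm g < r \<Longrightarrow> z \<in> fst (f (Suc n)) \<Longrightarrow> act g z \<notin> snd (f (Suc n))" by blast
  have dec: "snd (f j) \<subseteq> snd (f i)" if "i \<le> j" for i j
    using lift_Suc_antimono_le[of "\<lambda>n. snd (f n)" i j] f(3) that by blast
  show False
  proof (rule no_separated_sequence[OF univ met _ _ r, of "\<lambda>n. fst (f (Suc n))"])
    show "openin P (fst (f (Suc n)))" "fst (f (Suc n)) \<noteq> {}" for n using f(1)[of "Suc n"] by (simp_all add: R_def)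
    fix i j :: nat and g :: 'g and z assume ij: "i < j" "gnorm g < r" "z \<in> fst (f (Suc i))"
    have "fst (f (Suc j)) \<subseteq> snd (f (Suc i))" using f(2)[of j] dec[of "Suc i" j] ij(1) by auto
    then show "act g z \<notin> fst (f (Suc j))" using f(4)[OF ij(2,3)] by blast
  qed
qed

text \<open>
  Inside a set \<open>V\<close> as above, generic points can be moved into any given basic open subset of \<open>V\<close> by an
  element of norm below \<open>r\<close>. Such sets \<open>V\<close> exist inside every open set and for every \<open>r\<close>, so a point
  generic for all of them is nearly open.
\<close>

lemma metrizable_nearly_open_point:
  fixes act :: "'g::{topological_group_add, polish_space} \<Rightarrow> 'p \<Rightarrow> 'p"
  assumes univ: "universal_minimal_proximal_flow P act" and met: "metrizable_space P"
  shows "\<exists>x. nearly_open_point P act x"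
proof -
  have fl: "flow UNIV P act" using univ by (simp add: universal_minimal_proximal_flow_def minimal_flow_def)
  obtain \<B> where \<B>: "countable \<B>" "\<And>B. B \<in> \<B> \<Longrightarrow> openin P B"
    "\<And>W z. openin P W \<Longrightarrow> z \<in> W \<Longrightarrow> \<exists>B\<in>\<B>. z \<in> B \<and> B \<subseteq> W"
    using compact_metrizable_countable_base[OF met flow_compact[OF fl]] by blast
  define rr where "rr n = inverse (real (Suc n))" for n
  have rr: "rr n > 0" for n by (simp add: rr_def)
  define good where "good n W V \<longleftrightarrow> V \<subseteq> W \<and> openin P V \<and> V \<noteq> {} \<and>
    (\<forall>A B. openin P A \<and> A \<noteq> {} \<and> A \<subseteq> V \<and> openin P B \<and> B \<noteq> {} \<and> B \<subseteq> V \<longrightarrow>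
    (\<exists>g. gnorm g < rr n \<and> (\<exists>z\<in>A. act g z \<in> B)))" for n W V
  have "\<exists>V. good n W V" if "W \<in> \<B>" "W \<noteq> {}" for n W
    using locally_unseparated[OF univ met \<B>(2)[OF that(1)] that(2) rr[of n]] unfolding good_def by blast
  then have ex: "W \<in> \<B> \<Longrightarrow> W \<noteq> {} \<Longrightarrow> \<exists>V. good n W V" for n W by blast
  define V where "V n W = (SOME V. good n W V)" for n W
  have V: "good n W (V n W)" if "W \<in> \<B>" "W \<noteq> {}" for n W
    unfolding V_def by (rule someI_ex[OF ex[OF that]])
  define \<B>' where "\<B>' = \<B> - {{}}"
  have V': "good n W (V n W)" if "W \<in> \<B>'" for n W using V that by (simp add: \<B>'_def)
  have c': "countable \<B>'" using \<B>(1) by (simp add: \<B>'_def)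
  define T where "T n A = (\<Union>g\<in>{g. gnorm g < rr n}. {p \<in> topspace P. act g p \<in> A})" for n A
  have oT: "openin P (T n A)" if "openin P A" for n A
    unfolding T_def using openin_continuous_map_preimage[OF flow_continuous_act[OF fl] that] by blast
  define D where "D n = (\<Union>W\<in>\<B>'. V n W)" for n
  have oD: "openin P (D n)" for n unfolding D_def using V' good_def by blast
  \<comment> \<open>\<open>\<N>\<close> is visibly countable; only its part \<open>\<N>'\<close> consists of nowhere dense sets.\<close>
  define \<N> where "\<N> = range (\<lambda>n. topspace P - D n) \<union>
    (\<lambda>(n, W, A). V n W - T n A) ` (UNIV \<times> \<B>' \<times> \<B>') "
  define \<N>' where "\<N>' = range (\<lambda>n. topspace P - D n) \<union>
    (\<lambda>(n, W, A). V n W - T n A) ` {(n, W, A). W \<in> \<B>' \<and> A \<in> \<B>' \<and> A \<subseteq> V n W}"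
  have "\<not> topspace P \<subseteq> \<Union>\<N>'"
  proof (rule flow_nonmeager[OF fl])
    have "countable \<N>" unfolding \<N>_def using c' by simp
    moreover have "\<N>' \<subseteq> \<N>" unfolding \<N>_def \<N>'_def by auto
    ultimately show "countable \<N>'" by (rule countable_subset[rotated])
    show "topspace P \<noteq> {}" using fl unfolding flow_def by blast
    have DD: "P interior_of (P closure_of (topspace P - D n)) = {}" for n
    proof -
      have "closedin P (topspace P - D n)" using oD by blast
      moreover have "U = {}" if U: "openin P U" "U \<subseteq> topspace P - D n" for U
      proof (rule ccontr)
        assume "U \<noteq> {}"
        then obtain z where "z \<in> U" by blast
        then obtain W where W: "W \<in> \<B>" "z \<in> W" "W \<subseteq> U" using \<B>(3) U(1) by blast
        then have "W \<in> \<B>'" by (auto simp: \<B>'_def)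
        then have "V n W \<subseteq> W" "V n W \<noteq> {}" "V n W \<subseteq> D n" using V'[of W n] by (auto simp: good_def D_def)
        then show False using W(3) U(2) by blast
      qed
      ultimately show ?thesis by (simp add: closure_of_closedin interior_of_eq_empty)
    qed
    have VV: "P interior_of (P closure_of (V n W - T n A)) = {}" if WA: "W \<in> \<B>'" "A \<in> \<B>'" "A \<subseteq> V n W" for n W A
    proof -
      have oA: "openin P A" "A \<noteq> {}" using WA(2) \<B>(2) by (auto simp: \<B>'_def)
      have "U = {}" if U: "openin P U" "U \<subseteq> P closure_of (V n W - T n A)" for U
      proof (rule ccontr)
        assume "U \<noteq> {}"
        then obtain u where u: "u \<in> U" by blast
        have oV: "openin P (V n W)" using V'[OF WA(1)] by (simp add: good_def)
        obtain p where p: "p \<in> V n W - T n A" "p \<in> U" using closure_of_meets[OF _ U(1) u] u U(2) by blast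
        have "openin P (U \<inter> V n W)" "U \<inter> V n W \<noteq> {}" using U(1) oV p by auto
        then obtain g z where g: "gnorm g < rr n" "z \<in> U \<inter> V n W" "act g z \<in> A"
          using V'[OF WA(1), of n] oA WA(3) unfolding good_def by (metis inf_le2)
        have "z \<in> T n A" using g openin_subset[OF U(1)] by (auto simp: T_def)
        moreover have "openin P (U \<inter> T n A)" using U(1) oT[OF oA(1)] by blast
        ultimately show False using closure_of_meets[of z P "V n W - T n A" "U \<inter> T n A"] g(2) U(2) by blast
      qed
      then show ?thesis by (simp add: interior_of_eq_empty)
    qed
    show "P interior_of (P closure_of N) = {}" if "N \<in> \<N>'" for N
      using that DD VV unfolding \<N>'_def by auto
  qed simp
  then obtain x where x: "x \<in> topspace P" "x \<notin> \<Union>\<N>'" by blast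
  have "nearly_open_point P act x"
    unfolding nearly_open_point_def
  proof (intro conjI allI impI x(1))
    fix U :: "'g set" assume "open U \<and> 0 \<in> U"
    then obtain e where e: "e > 0" "\<And>g. gnorm g < e \<Longrightarrow> g \<in> U" using gnorm_ball_subset by meson
    obtain n where n: "rr n < e" using reals_Archimedean[OF e(1)] unfolding rr_def by blast
    have "x \<in> D n" using x unfolding \<N>'_def by blast
    then obtain W where W: "W \<in> \<B>'" "x \<in> V n W" by (auto simp: D_def)
    have oV: "openin P (V n W)" using V'[OF W(1)] by (simp add: good_def)
    have "V n W \<subseteq> P closure_of ((\<lambda>g. act g x) ` U)"
    proof
      fix y assume y: "y \<in> V n W"
      show "y \<in> P closure_of ((\<lambda>g. act g x) ` U)"
        unfolding in_closure_of
      proof (intro conjI allI impI)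
        show "y \<in> topspace P" using y openin_subset[OF oV] by blast
        fix S assume "y \<in> S \<and> openin P S"
        then have "openin P (S \<inter> V n W)" "y \<in> S \<inter> V n W" using oV y by auto
        then obtain A where A: "A \<in> \<B>" "y \<in> A" "A \<subseteq> S \<inter> V n W" using \<B>(3) by blast
        then have "A \<in> \<B>'" by (auto simp: \<B>'_def)
        then have "x \<in> T n A" using x(2) W A(3) unfolding \<N>'_def by blast
        then obtain g where "gnorm g < rr n" "act g x \<in> A" by (auto simp: T_def)
        then show "\<exists>y. y \<in> (\<lambda>g. act g x) ` U \<and> y \<in> S"
          using e(2)[of g] n A(3) by (intro exI[of _ "act g x"]) auto
      qed
    qed
    then show "x \<in> P interior_of (P closure_of ((\<lambda>g. act g x) ` U))"
      using interior_of_maximal[OF _ oV] W(2) by blast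
  qed
  then show ?thesis by blast
qed


section \<open>The universal flow as Samuel compactification\<close>

lemma elt_set_plus_assoc: "g +o (h +o C) = ((g::'g::semigroup_add) + h) +o C"
  by (auto simp: elt_set_plus_def add.assoc image_iff)

lemma stabilizer_coset_eq:
  assumes fl: "flow UNIV P act" and x: "x \<in> topspace P"
  shows "g +o stabilizer act x = h +o stabilizer act x \<longleftrightarrow> act g x = act h x"
proof -
  have mem: "k \<in> l +o stabilizer act x \<longleftrightarrow> act k x = act l x" for k l
  proof
    assume "k \<in> l +o stabilizer act x"
    then obtain s where "k = l + s" "act s x = x" by (auto simp: elt_set_plus_def stabilizer_def)
    then show "act k x = act l x" using flow_add[OF fl x] by simp
  next
    assume "act k x = act l x"
    then have "act (- l + k) x = x" using flow_add[OF fl x, of "- l" k] flow_act_inverse(1)[OF fl x] by simp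
    moreover have "k = l + (- l + k)" by (simp add: add.assoc[symmetric])
    ultimately show "k \<in> l +o stabilizer act x" unfolding elt_set_plus_def stabilizer_def by blast
  qed
  then show ?thesis by (metis set_eqI)
qed

lemma translate_left_coset_iff:
  "g +o y \<in> left_cosets H \<longleftrightarrow> y \<in> left_cosets (H :: 'g::group_add set)"
proof
  assume "g +o y \<in> left_cosets H"
  then obtain h where h: "g +o y = h +o H" by (auto simp: left_cosets_def)
  have "y = - g +o (g +o y)" by (auto simp: elt_set_plus_assoc) (auto simp: elt_set_plus_def)
  then have "y = (- g + h) +o H" unfolding h elt_set_plus_assoc .
  then show "y \<in> left_cosets H" by (auto simp: left_cosets_def)
qed (auto simp: left_cosets_def elt_set_plus_assoc)

text \<open>
  A function on \<open>P\<close> restricted to the orbit of \<open>x\<close>, as a function on the coset space: a coset of the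
  stabilizer is the set of group elements taking \<open>x\<close> to a given point, so the choice of representative
  does not matter. The value 0 off the cosets follows the convention of \<open>unif_cont_algebra\<close>.
\<close>

definition coset_fun :: "('g::group_add \<Rightarrow> 'p \<Rightarrow> 'p) \<Rightarrow> 'p \<Rightarrow> ('p \<Rightarrow> complex) \<Rightarrow> 'g set \<Rightarrow> complex" where
  "coset_fun act x F y = (if y \<in> left_cosets (stabilizer act x)
     then F (act (SOME g. y = g +o stabilizer act x) x) else 0)"

lemma coset_fun_coset:
  assumes fl: "flow UNIV P act" and x: "x \<in> topspace P"
  shows "coset_fun act x F (g +o stabilizer act x) = F (act g x)"
proof -
  define h where "h = (SOME h. g +o stabilizer act x = h +o stabilizer act x)"
  have "g +o stabilizer act x = h +o stabilizer act x" unfolding h_def by (rule someI) (rule refl)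
  then have "act g x = act h x" using stabilizer_coset_eq[OF fl x] by blast
  then show ?thesis by (simp add: coset_fun_def left_cosets_def h_def[symmetric])
qed

lemma coset_fun_eqI:
  assumes fl: "flow UNIV P act" and x: "x \<in> topspace P"
    and "\<And>y. y \<notin> left_cosets (stabilizer act x) \<Longrightarrow> f y = 0"
    and "\<And>g. f (g +o stabilizer act x) = F (act g x)"
  shows "f = coset_fun act x F"
proof
  fix y
  show "f y = coset_fun act x F y"
  proof (cases "y \<in> left_cosets (stabilizer act x)")
    case True
    then obtain g where "y = g +o stabilizer act x" by (auto simp: left_cosets_def)
    then show ?thesis using coset_fun_coset[OF fl x] assms(4) by simp
  qed (simp add: assms(3) coset_fun_def)
qed

text \<open>
  Tube lemma: near the compact slice \<open>{0} \<times> X\<close> the function \<open>F (a g z)\<close> is close to \<open>F z\<close>.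
\<close>

lemma flow_function_uniformly_continuous:
  fixes F :: "'x \<Rightarrow> 'b::metric_space"
  assumes fl: "flow UNIV X a" and F: "continuous_map X euclidean F" and e: "e > 0"
  shows "\<exists>U. open U \<and> 0 \<in> U \<and> (\<forall>u\<in>U. \<forall>z\<in>topspace X. dist (F (a u z)) (F z) < e)"
proof -
  let ?Y = "prod_topology (top_of_set UNIV) X"
  define h where "h = (\<lambda>q. (F (a (fst q) (snd q)), F (snd q)))"
  have "continuous_map ?Y (prod_topology euclidean euclidean) h"
    unfolding h_def
    using continuous_map_compose[OF flow_continuous[OF fl] F] continuous_map_compose[OF continuous_map_snd F]
    by (intro continuous_map_pairedI) (simp_all add: o_def case_prod_unfold)
  then have h: "continuous_map ?Y euclidean h" by simp
  have "open {p :: 'b \<times> 'b. dist (fst p) (snd p) < e}"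
    by (intro open_Collect_less continuous_intros)
  then have R: "openin ?Y {q \<in> topspace ?Y. h q \<in> {p. dist (fst p) (snd p) < e}}"
    by (intro openin_continuous_map_preimage[OF h]) simp
  have C: "compactin X (topspace X)" using flow_compact[OF fl] by (simp add: compact_space_def)
  have sub: "{0} \<times> topspace X \<subseteq> {q \<in> topspace ?Y. h q \<in> {p. dist (fst p) (snd p) < e}}"
    using e flow_zero[OF fl] by (auto simp: h_def)
  from tube_lemma_right[OF R C _ sub]
  obtain U V where UV: "openin (top_of_set UNIV) U" "0 \<in> U" "topspace X \<subseteq> V"
    "U \<times> V \<subseteq> {q \<in> topspace ?Y. h q \<in> {p. dist (fst p) (snd p) < e}}" by auto
  have "dist (F (a u z)) (F z) < e" if "u \<in> U" "z \<in> topspace X" for u z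
    using subsetD[OF UV(4), of "(u, z)"] UV(3) that by (auto simp: h_def)
  then show ?thesis using UV(1,2) by auto
qed

lemma coset_fun_in_algebra:
  assumes fl: "flow UNIV P act" and x: "x \<in> topspace P" and F: "continuous_map P euclidean F"
  shows "coset_fun act x F \<in> unif_cont_algebra (stabilizer act x)"
  unfolding unif_cont_algebra_def
proof (intro CollectI conjI allI impI)
  show "coset_fun act x F y = 0" if "y \<notin> left_cosets (stabilizer act x)" for y
    using that by (simp add: coset_fun_def)
  have "compactin euclidean (F ` topspace P)"
    using image_compactin[OF _ F] flow_compact[OF fl] by (simp add: compact_space_def)
  then have "bounded (F ` topspace P)" by (simp add: compact_imp_bounded)
  moreover have "coset_fun act x F ` left_cosets (stabilizer act x) \<subseteq> F ` topspace P"
    using coset_fun_coset[OF fl x] flow_act_in[OF fl x] by (auto simp: left_cosets_def)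
  ultimately show "bounded (coset_fun act x F ` left_cosets (stabilizer act x))" by (rule bounded_subset)
  fix e :: real assume "e > 0"
  then obtain U where U: "open U" "0 \<in> U" "\<forall>u\<in>U. \<forall>z\<in>topspace P. dist (F (act u z)) (F z) < e"
    using flow_function_uniformly_continuous[OF fl F] by blast
  have "cmod (coset_fun act x F (u +o y) - coset_fun act x F y) < e"
    if u: "u \<in> U" and y: "y \<in> left_cosets (stabilizer act x)" for u y
  proof -
    obtain g where g: "y = g +o stabilizer act x" using y by (auto simp: left_cosets_def)
    show ?thesis
      using U(3) u flow_act_in[OF fl x, of g]
      by (simp add: g elt_set_plus_assoc coset_fun_coset[OF fl x] flow_add[OF fl x] dist_norm)
  qed
  then show "\<exists>U. open U \<and> 0 \<in> U \<and> (\<forall>u\<in>U. \<forall>y\<in>left_cosets (stabilizer act x).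
      cmod (coset_fun act x F (u +o y) - coset_fun act x F y) < e)" using U(1,2) by blast
qed

text \<open>
  Uniformly continuous functions on the coset space are precisely the restrictions of continuous
  functions on \<open>P\<close>: the extension is found for real and imaginary parts separately. This identifies the
  Samuel compactification with the spectrum of \<open>C(P)\<close>, that is, with \<open>P\<close>.
\<close>

lemma algebra_eq_coset_fun_image:
  fixes act :: "'g::{topological_group_add, complete_space} \<Rightarrow> 'p \<Rightarrow> 'p"
  assumes univ: "universal_minimal_proximal_flow P act" and x: "nearly_open_point P act x"
  shows "unif_cont_algebra (stabilizer act x) = coset_fun act x ` {F. continuous_map P euclidean F}"
proof
  let ?K = "stabilizer act x"
  have fl: "flow UNIV P act" using univ by (simp add: universal_minimal_proximal_flow_def minimal_flow_def)
  have xP: "x \<in> topspace P" using x by (simp add: nearly_open_point_def)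
  show "coset_fun act x ` {F. continuous_map P euclidean F} \<subseteq> unif_cont_algebra ?K"
    using coset_fun_in_algebra[OF fl xP] by auto
  show "unif_cont_algebra ?K \<subseteq> coset_fun act x ` {F. continuous_map P euclidean F}"
  proof
    fix f assume f: "f \<in> unif_cont_algebra ?K"
    obtain c where c: "\<And>y. y \<in> left_cosets ?K \<Longrightarrow> cmod (f y) \<le> c"
    proof -
      have "bounded (f ` left_cosets ?K)" using f unfolding unif_cont_algebra_def by blast
      then show thesis using that unfolding bounded_iff by blast
    qed
    have ext: "\<exists>F. continuous_map P euclideanreal F \<and> (\<forall>g. F (act g x) = R (f (g +o ?K)))"
      if R: "\<And>z. \<bar>R z\<bar> \<le> cmod z" "\<And>z w. R (z - w) = R z - R w" for R :: "complex \<Rightarrow> real"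
    proof (rule extension_of_invariant_function[OF univ x])
      have "\<bar>R (f (g +o ?K))\<bar> \<le> c" for g
        using c[of "g +o ?K"] R(1)[of "f (g +o ?K)"] by (auto simp: left_cosets_def)
      moreover have "\<exists>U. open U \<and> 0 \<in> U \<and> (\<forall>u\<in>U. \<forall>g. \<bar>R (f ((u + g) +o ?K)) - R (f (g +o ?K))\<bar> < e)"
        if "e > 0" for e
      proof -
        obtain U where U: "open U" "0 \<in> U" "\<forall>u\<in>U. \<forall>y\<in>left_cosets ?K. cmod (f (u +o y) - f y) < e"
          using f \<open>e > 0\<close> unfolding unif_cont_algebra_def by blast
        have "\<bar>R (f ((u + g) +o ?K)) - R (f (g +o ?K))\<bar> < e" if "u \<in> U" for u g
        proof -
          have "cmod (f (u +o (g +o ?K)) - f (g +o ?K)) < e"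
            using U(3) that by (auto simp: left_cosets_def)
          then show ?thesis using R(1)[of "f (u +o (g +o ?K)) - f (g +o ?K)"] R(2)
            by (simp add: elt_set_plus_assoc)
        qed
        then show ?thesis using U(1,2) by blast
      qed
      ultimately show "right_unif_cont (\<lambda>g. R (f (g +o ?K)))"
        unfolding right_unif_cont_def by blast
      fix k assume "k \<in> ?K"
      then have "(h + k) +o ?K = h +o ?K" for h
        unfolding stabilizer_coset_eq[OF fl xP] using flow_add[OF fl xP, of h k] by (simp add: stabilizer_def)
      then show "shift k (\<lambda>g. R (f (g +o ?K))) = (\<lambda>g. R (f (g +o ?K)))" by (simp add: shift_def)
    qed
    obtain A where A: "continuous_map P euclideanreal A" "\<And>g. A (act g x) = Re (f (g +o ?K))"
      using ext[of Re] by (auto simp: abs_Re_le_cmod)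
    obtain B where B: "continuous_map P euclideanreal B" "\<And>g. B (act g x) = Im (f (g +o ?K))"
      using ext[of Im] by (auto simp: abs_Im_le_cmod)
    define F where "F p = Complex (A p) (B p)" for p
    have "continuous_map P euclidean F"
      unfolding F_def using A(1) B(1) by (simp add: continuous_map_atin tendsto_Complex)
    moreover have "f = coset_fun act x F"
    proof (rule coset_fun_eqI[OF fl xP])
      show "f y = 0" if "y \<notin> left_cosets ?K" for y
        using f that unfolding unif_cont_algebra_def by blast
      show "f (g +o ?K) = F (act g x)" for g by (simp add: F_def A(2) B(2))
    qed
    ultimately show "f \<in> coset_fun act x ` {F. continuous_map P euclidean F}" by blast
  qed
qed

lemma continuous_maps_agree_on_orbit:
  assumes m: "minimal_flow UNIV P act" and x: "x \<in> topspace P" and Y: "Hausdorff_space Y"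
    and F: "continuous_map P Y F" and G: "continuous_map P Y G"
    and eq: "\<And>g. F (act g x) = G (act g x)" and p: "p \<in> topspace P"
  shows "F p = G p"
proof -
  have fl: "flow UNIV P act" using m by (simp add: minimal_flow_def)
  have "closedin P {p \<in> topspace P. F p = G p}" by (rule closedin_continuous_maps_eq[OF Y F G])
  moreover have "orbit_of UNIV act x \<subseteq> {p \<in> topspace P. F p = G p}"
    using eq flow_act_in[OF fl x] by (auto simp: orbit_of_def)
  ultimately have "orbit_closure UNIV P act x \<subseteq> {p \<in> topspace P. F p = G p}"
    by (intro closure_of_minimal)
  then show ?thesis using minimal_flow_orbit_closure[OF m x] p by blast
qed

text \<open>
  A character of \<open>C(P)\<close> annihilating functions without common zero would annihilate the invertible
  function \<open>\<Sum> \<bar>G\<bar>\<^sup>2\<close> for finitely many of them.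
\<close>

lemma character_is_evaluation:
  fixes \<psi> :: "('p \<Rightarrow> complex) \<Rightarrow> complex"
  assumes P: "compact_space P"
    and add: "\<And>F G. continuous_map P euclidean F \<Longrightarrow> continuous_map P euclidean G \<Longrightarrow> \<psi> (\<lambda>p. F p + G p) = \<psi> F + \<psi> G"
    and scale: "\<And>c F. continuous_map P euclidean F \<Longrightarrow> \<psi> (\<lambda>p. c * F p) = c * \<psi> F"
    and mult: "\<And>F G. continuous_map P euclidean F \<Longrightarrow> continuous_map P euclidean G \<Longrightarrow> \<psi> (\<lambda>p. F p * G p) = \<psi> F * \<psi> G"
    and cong: "\<And>F G. continuous_map P euclidean F \<Longrightarrow> continuous_map P euclidean G \<Longrightarrow> (\<And>p. p \<in> topspace P \<Longrightarrow> F p = G p) \<Longrightarrow> \<psi> F = \<psi> G"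
    and nz: "\<exists>F. continuous_map P euclidean F \<and> \<psi> F \<noteq> 0"
  shows "\<exists>p\<in>topspace P. \<forall>F. continuous_map P euclidean F \<longrightarrow> \<psi> F = F p"
proof (rule ccontr)
  assume neg: "\<not> ?thesis"
  obtain F0 where F0: "continuous_map P euclidean F0" "\<psi> F0 \<noteq> 0" using nz by blast
  have c1: "continuous_map P euclidean (\<lambda>_. 1 :: complex)" by simp
  have "\<psi> F0 = \<psi> (\<lambda>_. 1) * \<psi> F0" using mult[OF c1 F0(1)] by simp
  then have one: "\<psi> (\<lambda>_. 1) = 1" using F0(2) by simp
  have const: "\<psi> (\<lambda>_. c) = c" for c using scale[OF c1, of c] one by simp
  have "\<exists>G. continuous_map P euclidean G \<and> \<psi> G = 0 \<and> G p \<noteq> 0" if p: "p \<in> topspace P" for p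
  proof -
    obtain F where F: "continuous_map P euclidean F" "\<psi> F \<noteq> F p" using neg p by blast
    have "\<psi> (\<lambda>q. F q + - \<psi> F) = \<psi> F + - \<psi> F" using add[OF F(1), of "\<lambda>_. - \<psi> F"] const by simp
    then show ?thesis using F by (intro exI[of _ "\<lambda>q. F q + - \<psi> F"]) (simp add: continuous_map_diff)
  qed
  then obtain G where G: "\<And>p. p \<in> topspace P \<Longrightarrow> continuous_map P euclidean (G p)"
    "\<And>p. p \<in> topspace P \<Longrightarrow> \<psi> (G p) = 0" "\<And>p. p \<in> topspace P \<Longrightarrow> G p p \<noteq> 0" by metis
  define V where "V p = {q \<in> topspace P. G p q \<in> - {0}}" for p
  have "\<forall>U\<in>V ` topspace P. openin P U"
  proof
    fix U assume "U \<in> V ` topspace P"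
    then obtain p where "p \<in> topspace P" "U = V p" by blast
    moreover have "openin euclidean (- {0 :: complex})" by (simp add: open_Compl)
    ultimately show "openin P U" unfolding V_def using openin_continuous_map_preimage[OF G(1)] by blast
  qed
  moreover have "topspace P \<subseteq> \<Union>(V ` topspace P)" using G(3) by (auto simp: V_def)
  ultimately obtain \<F> where \<F>: "finite \<F>" "\<F> \<subseteq> V ` topspace P" "topspace P \<subseteq> \<Union>\<F>"
    using P[unfolded compact_space_alt, rule_format, of "V ` topspace P"] by metis
  then obtain I where I: "finite I" "I \<subseteq> topspace P" "\<F> = V ` I" using finite_subset_image by metis
  have cG: "continuous_map P euclidean (\<lambda>q. G p q * cnj (G p q))" if "p \<in> I" for p
    using G(1)[of p] I(2) that by (auto simp: continuous_map_atin intro!: tendsto_mult tendsto_cnj)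
  define S where "S J q = (\<Sum>p\<in>J. G p q * cnj (G p q))" for J q
  have S: "J \<subseteq> I \<Longrightarrow> continuous_map P euclidean (S J) \<and> \<psi> (S J) = 0" if "finite J" for J
    using that
  proof (induction J rule: finite_induct)
    case empty
    then show ?case using const[of 0] by (simp add: S_def[abs_def])
  next
    case (insert p J)
    have p: "p \<in> I" "p \<in> topspace P" using insert.prems I(2) by auto
    have cc: "continuous_map P euclidean (\<lambda>q. cnj (G p q))"
      using G(1)[OF p(2)] by (auto simp: continuous_map_atin intro!: tendsto_cnj)
    have "S (insert p J) = (\<lambda>q. G p q * cnj (G p q) + S J q)"
      using insert.hyps by (auto simp: S_def)
    moreover have "\<psi> (\<lambda>q. G p q * cnj (G p q)) = 0" using mult[OF G(1)[OF p(2)] cc] G(2)[OF p(2)] by simp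
    ultimately show ?case using insert.IH insert.prems add[OF cG[OF p(1)]] continuous_map_add[OF cG[OF p(1)]] by simp
  qed
  have Sne: "S I q \<noteq> 0" if q: "q \<in> topspace P" for q
  proof -
    have "S I q = of_real (\<Sum>p\<in>I. (cmod (G p q))\<^sup>2)"
      by (simp add: S_def complex_norm_square[symmetric])
    moreover obtain p where "p \<in> I" "G p q \<noteq> 0" using \<F>(3) q I(3) by (auto simp: V_def)
    then have "(\<Sum>p\<in>I. (cmod (G p q))\<^sup>2) > 0"
      using I(1) by (intro sum_pos2) auto
    ultimately show ?thesis by (metis of_real_eq_0_iff less_irrefl)
  qed
  have SI: "continuous_map P euclidean (S I)" "\<psi> (S I) = 0" using S[OF I(1)] by auto
  have inv: "continuous_map P euclidean (\<lambda>q. inverse (S I q))"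
    using SI(1) Sne by (auto simp: continuous_map_atin intro!: tendsto_inverse)
  have "\<psi> (\<lambda>q. S I q * inverse (S I q)) = \<psi> (\<lambda>_. 1)"
  proof (rule cong[OF _ c1])
    show "continuous_map P euclidean (\<lambda>q. S I q * inverse (S I q))"
      using SI(1) inv by (simp add: continuous_map_atin tendsto_mult)
  qed (simp add: Sne)
  then show False using mult[OF SI(1) inv] SI(2) one by simp
qed

lemma compact_Hausdorff_separating_function:
  assumes "compact_space P" "Hausdorff_space P" "p \<in> topspace P" "closedin P C" "p \<notin> C"
  obtains u :: "'p \<Rightarrow> real" where "continuous_map P euclideanreal u" "u p = 0" "\<And>q. q \<in> C \<Longrightarrow> u q = 1"
    "\<And>q. q \<in> topspace P \<Longrightarrow> 0 \<le> u q \<and> u q \<le> 1"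
proof -
  have "normal_space P" using assms(1,2) compact_Hausdorff_or_regular_imp_normal_space by blast
  moreover have "closedin P {p}" using assms(2,3) by (simp add: closedin_Hausdorff_singleton)
  moreover have "disjnt {p} C" using assms(5) by simp
  ultimately obtain u :: "'p \<Rightarrow> real" where u: "continuous_map P (top_of_set {0..1}) u" "u ` {p} \<subseteq> {0}" "u ` C \<subseteq> {1}"
    using Urysohn_lemma[of P "{p}" C 0 1] assms(4) by auto
  show thesis
  proof (rule that[of u])
    show "continuous_map P euclideanreal u" using u(1) continuous_map_into_fulltopology by blast
    show "0 \<le> u q \<and> u q \<le> 1" if "q \<in> topspace P" for q
      using continuous_map_image_subset_topspace[OF u(1)] that by force
  qed (use u in auto)
qed

lemma samuel_isomorphism:
  fixes act :: "'g::{topological_group_add, complete_space} \<Rightarrow> 'p \<Rightarrow> 'p"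
  assumes univ: "universal_minimal_proximal_flow P act" and x: "nearly_open_point P act x"
  defines "K \<equiv> stabilizer act x"
  shows "\<exists>\<Phi>. homeomorphic_map P (samuel K) \<Phi> \<and>
    equivariant_on UNIV (topspace P) act (samuel_action K) \<Phi> \<and>
    (\<forall>g. \<Phi> (act g x) = samuel_point K (g +o K))"
proof -
  have m: "minimal_flow UNIV P act" using univ by (simp add: universal_minimal_proximal_flow_def)
  have fl: "flow UNIV P act" using m by (simp add: minimal_flow_def)
  have xP: "x \<in> topspace P" using x by (simp add: nearly_open_point_def)
  define A where "A = unif_cont_algebra K"
  define cf where "cf = coset_fun act x"
  have A: "A = cf ` {F. continuous_map P euclidean F}"
    unfolding A_def K_def cf_def by (rule algebra_eq_coset_fun_image[OF univ x])
  have cfA: "cf F \<in> A" if "continuous_map P euclidean F" for F using that A by blast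
  have cf_pt: "cf F (g +o K) = F (act g x)" for F g
    unfolding cf_def K_def by (rule coset_fun_coset[OF fl xP])
  have cf_inj: "F p = G p" if "continuous_map P euclidean F" "continuous_map P euclidean G" "cf F = cf G" "p \<in> topspace P" for F G p
    by (rule continuous_maps_agree_on_orbit[OF m xP _ that(1,2) _ that(4)]) (use cf_pt that(3) in \<open>metis Hausdorff_space_euclidean\<close>)+
  define E where "E f = (SOME F. continuous_map P euclidean F \<and> cf F = f)" for f
  have E: "continuous_map P euclidean (E f)" "cf (E f) = f" if "f \<in> A" for f
  proof -
    have "\<exists>F. continuous_map P euclidean F \<and> cf F = f" using that A by blast
    from someI_ex[OF this] show "continuous_map P euclidean (E f)" "cf (E f) = f" by (simp_all add: E_def)
  qed
  have E_cf: "E (cf F) p = F p" if "continuous_map P euclidean F" "p \<in> topspace P" for F p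
    by (rule cf_inj[OF E(1)[OF cfA[OF that(1)]] that(1) E(2)[OF cfA[OF that(1)]] that(2)])
  define \<Phi> where "\<Phi> p = (\<lambda>f\<in>A. E f p)" for p
  have \<Phi>_cf: "\<Phi> p (cf F) = F p" if "continuous_map P euclidean F" "p \<in> topspace P" for F p
    using E_cf[OF that] cfA[OF that(1)] by (simp add: \<Phi>_def)
  have cf_add: "(\<lambda>y. cf F y + cf G y) = cf (\<lambda>p. F p + G p)" for F G
    by (auto simp: cf_def coset_fun_def)
  have cf_mult: "(\<lambda>y. cf F y * cf G y) = cf (\<lambda>p. F p * G p)" for F G
    by (auto simp: cf_def coset_fun_def)
  have cf_scale: "(\<lambda>y. c * cf F y) = cf (\<lambda>p. c * F p)" for F c
    by (auto simp: cf_def coset_fun_def)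
  have c_mult: "continuous_map P euclidean (\<lambda>p. F p * G p)"
    if "continuous_map P euclidean F" "continuous_map P euclidean G" for F G :: "'p \<Rightarrow> complex"
    using that by (simp add: continuous_map_atin tendsto_mult)
  have c_scale: "continuous_map P euclidean (\<lambda>p. c * F p)" if "continuous_map P euclidean F" for F :: "'p \<Rightarrow> complex" and c
    using c_mult[of "\<lambda>_. c" F] that by simp
  have sam: "samuel K = subtopology (product_topology (\<lambda>_. euclidean) A) (algebra_characters A)"
    by (simp add: samuel_def gelfand_spectrum_def A_def)
  have ext: "algebra_characters A \<subseteq> extensional A" by (auto simp: algebra_characters_def)
  then have topsam: "topspace (samuel K) = algebra_characters A" by (auto simp: sam PiE_def)
  have \<Phi>_char: "\<Phi> p \<in> algebra_characters A" if p: "p \<in> topspace P" for p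
    unfolding algebra_characters_def
  proof (intro CollectI conjI ballI allI)
    show "\<Phi> p \<in> extensional A" by (simp add: \<Phi>_def)
    fix f g assume "f \<in> A" "g \<in> A"
    then obtain F G where FG: "continuous_map P euclidean F" "continuous_map P euclidean G" "f = cf F" "g = cf G"
      using A by blast
    show "\<Phi> p (\<lambda>x. f x + g x) = \<Phi> p f + \<Phi> p g" "\<Phi> p (\<lambda>x. f x * g x) = \<Phi> p f * \<Phi> p g"
      unfolding FG(3,4) cf_add cf_mult using FG(1,2) p by (simp_all add: \<Phi>_cf c_mult continuous_map_add)
  next
    fix c f assume "f \<in> A"
    then obtain F where F: "continuous_map P euclidean F" "f = cf F" using A by blast
    show "\<Phi> p (\<lambda>x. c * f x) = c * \<Phi> p f" unfolding F(2) cf_scale using F(1) p by (simp add: \<Phi>_cf c_scale)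
  next
    show "\<exists>f\<in>A. \<Phi> p f \<noteq> 0"
      using \<Phi>_cf[of "\<lambda>_. 1" p] cfA[of "\<lambda>_. 1"] p by (intro bexI[of _ "cf (\<lambda>_. 1)"]) auto
  qed
  have cont: "continuous_map P (samuel K) \<Phi>"
    unfolding sam continuous_map_in_subtopology
  proof
    show "continuous_map P (product_topology (\<lambda>_. euclidean) A) \<Phi>"
      unfolding continuous_map_componentwise
    proof (intro conjI ballI)
      fix f assume f: "f \<in> A"
      then have "(\<lambda>p. \<Phi> p f) = E f" by (simp add: \<Phi>_def)
      then show "continuous_map P euclidean (\<lambda>p. \<Phi> p f)" using E(1)[OF f] by simp
    qed (simp add: \<Phi>_def image_subset_iff)
  qed (use \<Phi>_char in auto)
  have haus: "Hausdorff_space (samuel K)"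
    unfolding sam by (intro Hausdorff_space_subtopology) (simp add: Hausdorff_space_product_topology)
  have inj: "inj_on \<Phi> (topspace P)"
  proof (rule inj_onI, rule ccontr)
    fix p q assume pq: "p \<in> topspace P" "q \<in> topspace P" "\<Phi> p = \<Phi> q" "p \<noteq> q"
    have "closedin P {q}" using flow_Hausdorff[OF fl] pq(2) by (simp add: closedin_Hausdorff_singleton)
    then obtain u :: "'p \<Rightarrow> real" where u: "continuous_map P euclideanreal u" "u p = 0" "u q = 1"
      using compact_Hausdorff_separating_function[OF flow_compact[OF fl] flow_Hausdorff[OF fl] pq(1)] pq(4)
      by (metis singleton_iff)
    have "continuous_map P euclidean (\<lambda>p. complex_of_real (u p))"
      using u(1) by (simp add: continuous_map_atin tendsto_of_real)
    from \<Phi>_cf[OF this pq(1)] \<Phi>_cf[OF this pq(2)] pq(3) u(2,3) show False by simp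
  qed
  have surj: "\<Phi> ` topspace P = topspace (samuel K)"
  proof
    show "\<Phi> ` topspace P \<subseteq> topspace (samuel K)" using \<Phi>_char topsam by auto
    show "topspace (samuel K) \<subseteq> \<Phi> ` topspace P"
    proof
      fix \<psi> assume "\<psi> \<in> topspace (samuel K)"
      then have \<psi>: "\<psi> \<in> extensional A" "\<And>f g. f \<in> A \<Longrightarrow> g \<in> A \<Longrightarrow> \<psi> (\<lambda>x. f x + g x) = \<psi> f + \<psi> g"
        "\<And>c f. f \<in> A \<Longrightarrow> \<psi> (\<lambda>x. c * f x) = c * \<psi> f"
        "\<And>f g. f \<in> A \<Longrightarrow> g \<in> A \<Longrightarrow> \<psi> (\<lambda>x. f x * g x) = \<psi> f * \<psi> g" "\<exists>f\<in>A. \<psi> f \<noteq> 0"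
        unfolding topsam algebra_characters_def by blast+
      have "\<exists>p\<in>topspace P. \<forall>F. continuous_map P euclidean F \<longrightarrow> \<psi> (cf F) = F p"
      proof (rule character_is_evaluation[OF flow_compact[OF fl]])
        fix F G :: "'p \<Rightarrow> complex" assume FG: "continuous_map P euclidean F" "continuous_map P euclidean G"
        show "\<psi> (cf (\<lambda>p. F p + G p)) = \<psi> (cf F) + \<psi> (cf G)"
          unfolding cf_add[symmetric] by (intro \<psi>(2) cfA FG)
        show "\<psi> (cf (\<lambda>p. F p * G p)) = \<psi> (cf F) * \<psi> (cf G)"
          unfolding cf_mult[symmetric] by (intro \<psi>(4) cfA FG)
        assume "\<And>p. p \<in> topspace P \<Longrightarrow> F p = G p"
        then have "cf F = cf G"
          using flow_act_in[OF fl xP] by (auto simp: cf_def coset_fun_def)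
        then show "\<psi> (cf F) = \<psi> (cf G)" by simp
      next
        fix c and F :: "'p \<Rightarrow> complex" assume F: "continuous_map P euclidean F"
        show "\<psi> (cf (\<lambda>p. c * F p)) = c * \<psi> (cf F)" unfolding cf_scale[symmetric] by (intro \<psi>(3) cfA F)
      next
        show "\<exists>F. continuous_map P euclidean F \<and> \<psi> (cf F) \<noteq> 0" using \<psi>(5) A by auto
      qed
      then obtain p where p: "p \<in> topspace P" "\<And>F. continuous_map P euclidean F \<Longrightarrow> \<psi> (cf F) = F p" by blast
      have "\<psi> = \<Phi> p"
      proof (rule extensionalityI[OF \<psi>(1)])
        show "\<Phi> p \<in> extensional A" by (simp add: \<Phi>_def)
        show "\<psi> f = \<Phi> p f" if "f \<in> A" for f using p \<Phi>_cf that A by auto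
      qed
      then show "\<psi> \<in> \<Phi> ` topspace P" using p(1) by blast
    qed
  qed
  have hom: "homeomorphic_map P (samuel K) \<Phi>"
    by (rule continuous_imp_homeomorphic_map[OF cont flow_compact[OF fl] haus surj inj])
  have "equivariant_on UNIV (topspace P) act (samuel_action K) \<Phi>"
    unfolding equivariant_on_def
  proof (intro ballI)
    fix g p assume p: "p \<in> topspace P"
    show "\<Phi> (act g p) = samuel_action K g (\<Phi> p)"
    proof (rule extensionalityI[of _ A])
      show "\<Phi> (act g p) \<in> extensional A" by (simp add: \<Phi>_def)
      show "samuel_action K g (\<Phi> p) \<in> extensional A" by (simp add: samuel_action_def A_def)
      fix f assume f: "f \<in> A"
      then obtain F where F: "continuous_map P euclidean F" "f = cf F" using A by blast
      have cg: "continuous_map P euclidean (\<lambda>q. F (act g q))"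
        using continuous_map_compose[OF flow_continuous_act[OF fl, of g] F(1)] by (simp add: o_def)
      have "(\<lambda>y. f (g +o y)) = cf (\<lambda>q. F (act g q))"
        unfolding cf_def
      proof (rule coset_fun_eqI[OF fl xP])
        show "f (g +o y) = 0" if "y \<notin> left_cosets (stabilizer act x)" for y
          using that translate_left_coset_iff[of g y] by (simp add: F(2) cf_def coset_fun_def)
        show "f (g +o (h +o stabilizer act x)) = F (act g (act h x))" for h
          using cf_pt[of F "g + h"] flow_add[OF fl xP] by (simp add: F(2) elt_set_plus_assoc K_def)
      qed
      then have "samuel_action K g (\<Phi> p) f = F (act g p)"
        using f \<Phi>_cf[OF cg p] by (simp add: samuel_action_def A_def)
      moreover have "\<Phi> (act g p) f = F (act g p)"
        unfolding F(2) by (rule \<Phi>_cf[OF F(1) flow_act_in[OF fl p]])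
      ultimately show "\<Phi> (act g p) f = samuel_action K g (\<Phi> p) f" by simp
    qed
  qed
  moreover have "\<Phi> (act g x) = samuel_point K (g +o K)" for g
  proof (rule extensionalityI[of _ A])
    show "\<Phi> (act g x) \<in> extensional A" by (simp add: \<Phi>_def)
    show "samuel_point K (g +o K) \<in> extensional A" by (simp add: samuel_point_def A_def)
    fix f assume f: "f \<in> A"
    then obtain F where F: "continuous_map P euclidean F" "f = cf F" using A by blast
    have "\<Phi> (act g x) f = F (act g x)" unfolding F(2) by (rule \<Phi>_cf[OF F(1) flow_act_in[OF fl xP]])
    moreover have "samuel_point K (g +o K) f = F (act g x)"
      using f cf_pt[of F g] by (simp add: samuel_point_def A_def F(2))
    ultimately show "\<Phi> (act g x) f = samuel_point K (g +o K) f" by simp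
  qed
  ultimately show ?thesis using hom by blast
qed


section \<open>The universal flow as completion\<close>

text \<open>
  Precompactness of the coset space, read off in \<open>P\<close>: every point lies in the closure of
  a \<open>U\<close>-small piece of the orbit of \<open>x\<close>.
\<close>

definition orbit_precompact ::
  "'x topology \<Rightarrow> ('g::topological_group_add \<Rightarrow> 'x \<Rightarrow> 'x) \<Rightarrow> 'x \<Rightarrow> bool" where
  "orbit_precompact P act x \<longleftrightarrow> (\<forall>z\<in>topspace P. \<forall>U. open U \<and> 0 \<in> U \<longrightarrow>
     (\<exists>q. z \<in> P closure_of ((\<lambda>u. act (u + q) x) ` U)))"

text \<open>
  On the orbit of \<open>x\<close> take the distance to the single point \<open>q x\<close>; as a function on the group it is
  invariant under the stabilizer of \<open>x\<close>, hence extends to \<open>P\<close>.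
\<close>

lemma orbit_distance_extension:
  fixes act :: "'g::{topological_group_add, polish_space} \<Rightarrow> 'p \<Rightarrow> 'p"
  assumes univ: "universal_minimal_proximal_flow P act" and x: "nearly_open_point P act x"
  shows "\<exists>f. continuous_map P euclideanreal f \<and> (\<forall>u. f (act (u + q) x) \<le> gnorm u) \<and>
    (\<forall>g t. f (act g x) < t \<and> t \<le> 1 \<longrightarrow> (\<exists>u. gnorm u < t \<and> act g x = act (u + q) x))"
proof -
  have fl: "flow UNIV P act" using univ by (simp add: universal_minimal_proximal_flow_def minimal_flow_def)
  have xP: "x \<in> topspace P" using x by (simp add: nearly_open_point_def)
  define F where "F g = set_distance UNIV act {act q x} g x" for g
  have "shift k F = F" if k: "k \<in> stabilizer act x" for k
  proof
    fix g show "shift k F g = F g"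
      using set_distance_act[OF fl closed_subgroup_UNIV xP, of k "{act q x}" g] k
      by (simp add: F_def stabilizer_def)
  qed
  then obtain f where f: "continuous_map P euclideanreal f" "\<And>g. f (act g x) = F g"
    using extension_of_invariant_function[OF univ x] right_unif_cont_set_distance[of UNIV act "{act q x}" x]
    unfolding F_def[symmetric] by blast
  have "f (act (u + q) x) \<le> gnorm u" for u
  proof -
    have "F (u + q) \<le> gnorm (q - (u + q))" unfolding F_def by (rule set_distance_le) auto
    also have "q - (u + q) = - u" by (simp add: diff_conv_add_uminus minus_add add.assoc[symmetric] del: add_uminus_conv_diff)
    finally show ?thesis by (simp add: f(2))
  qed
  moreover have "\<exists>u. gnorm u < t \<and> act g x = act (u + q) x" if t: "f (act g x) < t" "t \<le> 1" for g t
  proof -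
    have "set_distance UNIV act {act q x} g x < t" using t(1) f(2) by (simp add: F_def)
    then obtain k where k: "act k x = act q x" "gnorm (k - g) < t"
      using t(2) unfolding set_distance_less_iff by auto
    have "act g x = act ((g - k) + k) x" by simp
    also have "\<dots> = act (g - k) (act k x)" by (rule flow_add[OF fl xP]) auto
    also have "\<dots> = act ((g - k) + q) x" unfolding k(1) by (rule flow_add[OF fl xP, symmetric]) auto
    finally show ?thesis using k(2) gnorm_minus_commute[of k g] by (intro exI[of _ "g - k"]) simp
  qed
  ultimately show ?thesis using f(1) by blast
qed

lemma eventually_coset_uniformity:
  "eventually Q (coset_uniformity H) \<longleftrightarrow>
    (\<exists>U. open U \<and> 0 \<in> U \<and> (\<forall>y\<in>left_cosets H. \<forall>u\<in>U. Q (y, u +o y)))"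
proof -
  let ?I = "{U :: 'a set. open U \<and> 0 \<in> U \<and> uminus ` U = U}"
  let ?V = "\<lambda>U. {(y, u +o y) | y u. y \<in> left_cosets H \<and> u \<in> U}"
  have *: "eventually Q (coset_uniformity H) \<longleftrightarrow> (\<exists>U\<in>?I. eventually Q (principal (?V U)))"
    unfolding coset_uniformity_def
  proof (rule eventually_INF_base)
    show "?I \<noteq> {}" by (auto intro!: exI[of _ UNIV] simp: surj_def)
    fix U V assume UV: "U \<in> ?I" "V \<in> ?I"
    have "uminus ` (U \<inter> V) = U \<inter> V"
      using UV by (simp add: image_Int)
    then show "\<exists>W\<in>?I. principal (?V W) \<le> inf (principal (?V U)) (principal (?V V))"
      using UV by (intro bexI[of _ "U \<inter> V"]) auto
  qed
  have sym: "\<exists>W\<in>?I. W \<subseteq> U" if U: "open U" "0 \<in> U" for U :: "'a set"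
  proof -
    define W where "W = U \<inter> {u. - u \<in> U}"
    have "uminus ` W = W"
    proof
      show "uminus ` W \<subseteq> W" by (auto simp: W_def)
      show "W \<subseteq> uminus ` W"
      proof
        fix w assume "w \<in> W"
        then have "- w \<in> W" by (simp add: W_def)
        then show "w \<in> uminus ` W" by (intro image_eqI[of _ _ "- w"]) auto
      qed
    qed
    moreover have "open W" "0 \<in> W" unfolding W_def using U by (auto intro: open_group_vimage(3))
    ultimately show ?thesis by (intro bexI[of _ W]) (auto simp: W_def)
  qed
  show ?thesis
  proof
    assume "eventually Q (coset_uniformity H)"
    then obtain U where "U \<in> ?I" "eventually Q (principal (?V U))" unfolding * by blast
    then show "\<exists>U. open U \<and> 0 \<in> U \<and> (\<forall>y\<in>left_cosets H. \<forall>u\<in>U. Q (y, u +o y))"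
      by (intro exI[of _ U]) (auto simp: eventually_principal)
  next
    assume "\<exists>U. open U \<and> 0 \<in> U \<and> (\<forall>y\<in>left_cosets H. \<forall>u\<in>U. Q (y, u +o y))"
    then obtain U where U: "open U" "0 \<in> U" "\<forall>y\<in>left_cosets H. \<forall>u\<in>U. Q (y, u +o y)" by blast
    obtain W where W: "W \<in> ?I" "W \<subseteq> U" using sym[OF U(1,2)] by blast
    then show "eventually Q (coset_uniformity H)"
      unfolding * using U(3) by (intro bexI[of _ W]) (auto simp: eventually_principal)
  qed
qed

lemma eventually_completion_point:
  assumes "y \<in> left_cosets H"
  shows "eventually Q (completion_point (coset_uniformity H) y) \<longleftrightarrow>
    (\<exists>U. open U \<and> 0 \<in> U \<and> (\<forall>u\<in>U. Q (u +o y)))"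
proof
  assume "eventually Q (completion_point (coset_uniformity H) y)"
  then obtain R where R: "eventually R (coset_uniformity H)" "\<And>z. R (y, z) \<Longrightarrow> Q z"
    unfolding completion_point_def eventually_filtercomap by blast
  then show "\<exists>U. open U \<and> 0 \<in> U \<and> (\<forall>u\<in>U. Q (u +o y))"
    unfolding eventually_coset_uniformity using assms by blast
next
  assume "\<exists>U. open U \<and> 0 \<in> U \<and> (\<forall>u\<in>U. Q (u +o y))"
  then have "eventually (\<lambda>p. fst p = y \<longrightarrow> Q (snd p)) (coset_uniformity H)"
    unfolding eventually_coset_uniformity by auto
  then show "eventually Q (completion_point (coset_uniformity H) y)"
    unfolding completion_point_def eventually_filtercomap by (intro exI conjI) auto
qed

lemma cauchy_coset_uniformity_iff:
  "cauchy_wrt (coset_uniformity H) F \<longleftrightarrow> F \<noteq> bot \<and>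
    (\<forall>U. open U \<and> 0 \<in> U \<longrightarrow> (\<exists>M\<subseteq>left_cosets H. eventually (\<lambda>y. y \<in> M) F \<and>
       (\<forall>y\<in>M. \<forall>z\<in>M. \<exists>u\<in>U. z = u +o y)))"
proof -
  have "F \<times>\<^sub>F F \<le> coset_uniformity H \<longleftrightarrow>
    (\<forall>U. open U \<and> 0 \<in> U \<longrightarrow> (\<exists>M\<subseteq>left_cosets H. eventually (\<lambda>y. y \<in> M) F \<and>
       (\<forall>y\<in>M. \<forall>z\<in>M. \<exists>u\<in>U. z = u +o y)))" (is "?L \<longleftrightarrow> ?R")
  proof
    assume L: ?L
    show ?R
    proof (intro allI impI)
      fix U :: "'a set" assume U: "open U \<and> 0 \<in> U"
      have "eventually (\<lambda>p. fst p \<in> left_cosets H \<and> (\<exists>u\<in>U. snd p = u +o fst p)) (coset_uniformity H)"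
        unfolding eventually_coset_uniformity using U by auto
      then have "eventually (\<lambda>p. fst p \<in> left_cosets H \<and> (\<exists>u\<in>U. snd p = u +o fst p)) (F \<times>\<^sub>F F)"
        using L by (simp add: le_filter_def)
      then obtain R where R: "eventually R F"
        "\<And>y z. R y \<Longrightarrow> R z \<Longrightarrow> y \<in> left_cosets H \<and> (\<exists>u\<in>U. z = u +o y)"
        unfolding eventually_prod_same by auto
      then show "\<exists>M\<subseteq>left_cosets H. eventually (\<lambda>y. y \<in> M) F \<and> (\<forall>y\<in>M. \<forall>z\<in>M. \<exists>u\<in>U. z = u +o y)"
        by (intro exI[of _ "Collect R"]) auto
    qed
  next
    assume R: ?R
    show ?L
    proof (rule filter_leI)
      fix Q assume "eventually Q (coset_uniformity H)"
      then obtain U where U: "open U" "0 \<in> U" "\<forall>y\<in>left_cosets H. \<forall>u\<in>U. Q (y, u +o y)"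
        unfolding eventually_coset_uniformity by blast
      from R[rule_format, OF conjI[OF U(1,2)]]
      obtain M where M: "M \<subseteq> left_cosets H" "eventually (\<lambda>y. y \<in> M) F" "\<forall>y\<in>M. \<forall>z\<in>M. \<exists>u\<in>U. z = u +o y"
        by (elim exE conjE)
      have "Q (y, z)" if yz: "y \<in> M" "z \<in> M" for y z
      proof -
        obtain u where "u \<in> U" "z = u +o y" using bspec[OF bspec[OF M(3) yz(1)] yz(2)] by (elim bexE)
        moreover have "y \<in> left_cosets H" by (rule subsetD[OF M(1) yz(1)])
        ultimately show ?thesis using U(3) by simp
      qed
      then show "eventually Q (F \<times>\<^sub>F F)"
        unfolding eventually_prod_same using M(2) by (intro exI[of _ "\<lambda>y. y \<in> M"]) blast
    qed
  qed
  then show ?thesis by (simp add: cauchy_wrt_def)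
qed

text \<open>
  This is the neighbourhood filter of \<open>y\<close>; a coarser Cauchy filter has small members, which contain
  \<open>y\<close> as they belong to the neighbourhood filter as well.
\<close>

lemma completion_point_minimal_cauchy:
  fixes H :: "'g::topological_group_add set"
  assumes y: "y \<in> left_cosets H"
  shows "minimal_cauchy_wrt (coset_uniformity H) (completion_point (coset_uniformity H) y)"
  unfolding minimal_cauchy_wrt_def
proof (intro conjI allI impI)
  let ?C = "completion_point (coset_uniformity H) y"
  have zero: "0 +o y = y" by (auto simp: elt_set_plus_def)
  show "cauchy_wrt (coset_uniformity H) ?C"
    unfolding cauchy_coset_uniformity_iff
  proof (intro conjI allI impI)
    show "?C \<noteq> bot" unfolding trivial_limit_def eventually_completion_point[OF y] by auto
    fix U :: "'g set" assume "open U \<and> 0 \<in> U"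
    from zero_nhd_threefold[OF conjunct1[OF this] conjunct2[OF this]]
    obtain V where V: "open V" "0 \<in> V" "\<forall>v\<in>V. - v \<in> V" "\<forall>a\<in>V. \<forall>b\<in>V. \<forall>c\<in>V. a + b + c \<in> U"
      by (elim exE conjE)
    define M where "M = (\<lambda>v. v +o y) ` V"
    have "\<exists>u\<in>U. w +o y = u +o (v +o y)" if "v \<in> V" "w \<in> V" for v w
    proof
      show "w + - v + 0 \<in> U" using V(2,4) V(3)[rule_format, OF that(1)] that by blast
      show "w +o y = (w + - v + 0) +o (v +o y)" by (simp add: elt_set_plus_assoc add.assoc)
    qed
    moreover have "M \<subseteq> left_cosets H" using y translate_left_coset_iff by (auto simp: M_def)
    moreover have "eventually (\<lambda>y. y \<in> M) ?C"
      unfolding eventually_completion_point[OF y] using V(1,2) by (auto simp: M_def)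
    ultimately show "\<exists>M\<subseteq>left_cosets H. eventually (\<lambda>y. y \<in> M) ?C \<and> (\<forall>y\<in>M. \<forall>z\<in>M. \<exists>u\<in>U. z = u +o y)"
      by (intro exI[of _ M]) (auto simp: M_def)
  qed
  fix F assume F: "cauchy_wrt (coset_uniformity H) F \<and> ?C \<le> F"
  have "F \<le> ?C"
  proof (rule filter_leI)
    fix Q assume "eventually Q ?C"
    then obtain U where U: "open U" "0 \<in> U" "\<forall>u\<in>U. Q (u +o y)" unfolding eventually_completion_point[OF y] by blast
    have "cauchy_wrt (coset_uniformity H) F" using F by blast
    from this[unfolded cauchy_coset_uniformity_iff, THEN conjunct2, rule_format, OF conjI[OF U(1,2)]]
    obtain M where M: "eventually (\<lambda>y. y \<in> M) F" "\<forall>y\<in>M. \<forall>z\<in>M. \<exists>u\<in>U. z = u +o y"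
      by (elim exE conjE)
    have "eventually (\<lambda>y. y \<in> M) ?C" using M(1) F by (simp add: le_filter_def)
    from this[unfolded eventually_completion_point[OF y]]
    obtain V where V: "0 \<in> V" "\<forall>v\<in>V. v +o y \<in> M" by (elim exE conjE)
    then have "0 +o y \<in> M" by blast
    then have "y \<in> M" using zero by simp
    have "\<forall>z\<in>M. Q z"
    proof
      fix z assume "z \<in> M"
      from bspec[OF bspec[OF M(2) \<open>y \<in> M\<close>] this]
      obtain u where "u \<in> U" "z = u +o y" by (elim bexE)
      then show "Q z" using U(3) by simp
    qed
    then show "eventually Q F" using M(1) by (auto elim: eventually_mono)
  qed
  then show "F = ?C" using F by simp
qed

lemma topspace_completion: "topspace (completion_topology \<U>) = Collect (minimal_cauchy_wrt \<U>)"
proof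
  show "topspace (completion_topology \<U>) \<subseteq> Collect (minimal_cauchy_wrt \<U>)"
    using openin_topspace[of "completion_topology \<U>"] by (simp add: completion_open_def)
  have "openin (completion_topology \<U>) (Collect (minimal_cauchy_wrt \<U>))"
    by (auto simp: completion_open_def intro!: exI[of _ UNIV])
  then show "Collect (minimal_cauchy_wrt \<U>) \<subseteq> topspace (completion_topology \<U>)" by (rule openin_subset)
qed

text \<open>
  The neighbourhood filter of \<open>z\<close> in \<open>P\<close>, pulled back to the coset space along the map from cosets
  to the orbit of \<open>x\<close>. These filters turn out to be the points of the completion.
\<close>

definition orbit_trace :: "'x topology \<Rightarrow> ('g::group_add \<Rightarrow> 'x \<Rightarrow> 'x) \<Rightarrow> 'x \<Rightarrow> 'x \<Rightarrow> 'g set filter" where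
  "orbit_trace P act x z =
     (INF W\<in>{W. openin P W \<and> z \<in> W}. principal {g +o stabilizer act x | g. act g x \<in> W})"

lemma eventually_orbit_trace:
  assumes "z \<in> topspace P"
  shows "eventually Q (orbit_trace P act x z) \<longleftrightarrow>
    (\<exists>W. openin P W \<and> z \<in> W \<and> (\<forall>g. act g x \<in> W \<longrightarrow> Q (g +o stabilizer act x)))"
proof -
  let ?I = "{W. openin P W \<and> z \<in> W}"
  have "eventually Q (orbit_trace P act x z) \<longleftrightarrow>
      (\<exists>W\<in>?I. eventually Q (principal {g +o stabilizer act x | g. act g x \<in> W}))"
    unfolding orbit_trace_def
  proof (rule eventually_INF_base)
    show "?I \<noteq> {}" using assms by blast
    fix V W assume "V \<in> ?I" "W \<in> ?I"
    then show "\<exists>U\<in>?I. principal {g +o stabilizer act x | g. act g x \<in> U}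
        \<le> inf (principal {g +o stabilizer act x | g. act g x \<in> V}) (principal {g +o stabilizer act x | g. act g x \<in> W})"
      by (intro bexI[of _ "V \<inter> W"]) auto
  qed
  then show ?thesis by (auto simp: eventually_principal)
qed

text \<open>
  For precompact orbits every point \<open>z\<close> has neighbourhoods \<open>W\<close> whose trace on the orbit is small:
  take \<open>W\<close> to be a sublevel set of the distance to an orbit point close to \<open>z\<close>.
\<close>

lemma small_trace_neighbourhood:
  fixes act :: "'g::{topological_group_add, polish_space} \<Rightarrow> 'p \<Rightarrow> 'p"
  assumes univ: "universal_minimal_proximal_flow P act" and x: "nearly_open_point P act x"
    and pc: "orbit_precompact P act x" and z: "z \<in> topspace P" and U: "open U" "0 \<in> U"
  shows "\<exists>W. openin P W \<and> z \<in> W \<and>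
    (\<forall>g h. act g x \<in> W \<and> act h x \<in> W \<longrightarrow> (\<exists>u\<in>U. act h x = act (u + g) x))"
proof -
  have fl: "flow UNIV P act" using univ by (simp add: universal_minimal_proximal_flow_def minimal_flow_def)
  have xP: "x \<in> topspace P" using x by (simp add: nearly_open_point_def)
  obtain r0 where r0: "r0 > 0" "\<And>g. gnorm g < r0 \<Longrightarrow> g \<in> U" using gnorm_ball_subset[OF U] by blast
  define r where "r = min r0 1 / 4"
  have r: "r > 0" "2 * r \<le> 1" "4 * r \<le> r0" using r0(1) by (auto simp: r_def)
  have "open {u :: 'g. gnorm (u - 0) < r}" by (rule open_gnorm_ball)
  moreover have "0 \<in> {u :: 'g. gnorm (u - 0) < r}" using r by simp
  ultimately obtain q where q: "z \<in> P closure_of ((\<lambda>u. act (u + q) x) ` {u. gnorm (u - 0) < r})"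
    using pc z unfolding orbit_precompact_def by blast
  obtain f where f: "continuous_map P euclideanreal f" "\<And>u. f (act (u + q) x) \<le> gnorm u"
    "\<And>g t. f (act g x) < t \<Longrightarrow> t \<le> 1 \<Longrightarrow> \<exists>u. gnorm u < t \<and> act g x = act (u + q) x"
    using orbit_distance_extension[OF univ x, of q] by blast
  define W where "W = {p \<in> topspace P. f p \<in> {..<2 * r}}"
  have "openin P W" unfolding W_def by (rule openin_continuous_map_preimage[OF f(1)]) simp
  moreover have "z \<in> W"
  proof -
    have "closedin P {p \<in> topspace P. f p \<in> {..r}}" by (rule closedin_continuous_map_preimage[OF f(1)]) simp
    moreover have "f (act (u + q) x) \<le> r" if "gnorm u < r" for u using f(2)[of u] that by linarith
    then have "(\<lambda>u. act (u + q) x) ` {u. gnorm (u - 0) < r} \<subseteq> {p \<in> topspace P. f p \<in> {..r}}"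
      using flow_act_in[OF fl xP] by auto
    ultimately have "P closure_of ((\<lambda>u. act (u + q) x) ` {u. gnorm (u - 0) < r}) \<subseteq> {p \<in> topspace P. f p \<in> {..r}}"
      by (intro closure_of_minimal)
    then show ?thesis using q r(1) by (auto simp: W_def)
  qed
  moreover have "\<exists>u\<in>U. act h x = act (u + g) x" if gh: "act g x \<in> W" "act h x \<in> W" for g h
  proof -
    have "f (act g x) < 2 * r" "f (act h x) < 2 * r" using gh by (simp_all add: W_def)
    from f(3)[OF this(1) r(2)] f(3)[OF this(2) r(2)]
    obtain v w where v: "gnorm v < 2 * r" "act g x = act (v + q) x"
      and w: "gnorm w < 2 * r" "act h x = act (w + q) x" by blast
    have "gnorm (w + - v) \<le> gnorm w + gnorm v" using gnorm_triangle[of w "- v"] by simp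
    then have "w + - v \<in> U" using v(1) w(1) r(3) by (intro r0(2)) linarith
    moreover have "act (w + - v + g) x = act h x"
    proof -
      have "act (w + - v + g) x = act (w + - v) (act (v + q) x)" using flow_add[OF fl xP] v(2) by simp
      also have "\<dots> = act (w + - v + (v + q)) x" by (rule flow_add[OF fl xP, symmetric]) auto
      also have "w + - v + (v + q) = w + q" by (simp add: add.assoc[symmetric])
      finally show ?thesis using w(2) by simp
    qed
    ultimately show ?thesis by (intro bexI[of _ "w + - v"]) simp_all
  qed
  ultimately show ?thesis by blast
qed

lemma orbit_trace_not_bot:
  assumes m: "minimal_flow UNIV P act" and x: "x \<in> topspace P" and z: "z \<in> topspace P"
  shows "orbit_trace P act x z \<noteq> bot"
  unfolding trivial_limit_def eventually_orbit_trace[OF z]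
proof
  assume "\<exists>W. openin P W \<and> z \<in> W \<and> (\<forall>g. act g x \<in> W \<longrightarrow> False)"
  then obtain W where W: "openin P W" "z \<in> W" "\<And>g. act g x \<notin> W" by blast
  have "z \<in> orbit_closure UNIV P act x" using minimal_flow_orbit_closure[OF m x] z by simp
  from closure_of_meets[OF this W(1,2)] show False using W(3) by (auto simp: orbit_of_def)
qed

lemma orbit_trace_cauchy:
  fixes act :: "'g::{topological_group_add, polish_space} \<Rightarrow> 'p \<Rightarrow> 'p"
  assumes univ: "universal_minimal_proximal_flow P act" and x: "nearly_open_point P act x"
    and pc: "orbit_precompact P act x" and z: "z \<in> topspace P"
  shows "cauchy_wrt (coset_uniformity (stabilizer act x)) (orbit_trace P act x z)"
  unfolding cauchy_coset_uniformity_iff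
proof (intro conjI allI impI)
  have m: "minimal_flow UNIV P act" using univ by (simp add: universal_minimal_proximal_flow_def)
  have fl: "flow UNIV P act" using m by (simp add: minimal_flow_def)
  have xP: "x \<in> topspace P" using x by (simp add: nearly_open_point_def)
  show "orbit_trace P act x z \<noteq> bot" by (rule orbit_trace_not_bot[OF m xP z])
  fix U :: "'g set" assume U: "open U \<and> 0 \<in> U"
  from small_trace_neighbourhood[OF univ x pc z conjunct1[OF U] conjunct2[OF U]]
  obtain W where W: "openin P W" "z \<in> W"
    "\<forall>g h. act g x \<in> W \<and> act h x \<in> W \<longrightarrow> (\<exists>u\<in>U. act h x = act (u + g) x)"
    by (elim exE conjE)
  define M where "M = {g +o stabilizer act x | g. act g x \<in> W}"
  have "eventually (\<lambda>y. y \<in> M) (orbit_trace P act x z)"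
    unfolding eventually_orbit_trace[OF z] using W(1,2) by (auto simp: M_def)
  moreover have "\<exists>u\<in>U. b = u +o a" if ab: "a \<in> M" "b \<in> M" for a b
  proof -
    obtain g h where gh: "a = g +o stabilizer act x" "act g x \<in> W" "b = h +o stabilizer act x" "act h x \<in> W"
      using ab by (auto simp: M_def)
    then obtain u where "u \<in> U" "act h x = act (u + g) x" using W(3) by blast
    then show ?thesis using stabilizer_coset_eq[OF fl xP] unfolding gh elt_set_plus_assoc by blast
  qed
  ultimately show "\<exists>M\<subseteq>left_cosets (stabilizer act x). eventually (\<lambda>y. y \<in> M) (orbit_trace P act x z) \<and>
      (\<forall>y\<in>M. \<forall>z\<in>M. \<exists>u\<in>U. z = u +o y)"
    by (intro exI[of _ M]) (auto simp: M_def left_cosets_def)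
qed

text \<open>
  By compactness the filter, seen in \<open>P\<close>, has a cluster point \<open>z\<close>. It converges to \<open>z\<close>, since continuous
  functions on \<open>P\<close> vary little on its small members.
\<close>

lemma cauchy_le_orbit_trace:
  fixes act :: "'g::topological_group_add \<Rightarrow> 'p \<Rightarrow> 'p"
  assumes fl: "flow UNIV P act" and xP: "x \<in> topspace P"
    and F: "cauchy_wrt (coset_uniformity (stabilizer act x)) F"
  shows "\<exists>z\<in>topspace P. F \<le> orbit_trace P act x z"
proof -
  let ?K = "stabilizer act x"
  define tr where "tr W = {g +o ?K | g. act g x \<in> W}" for W
  have nb: "F \<noteq> bot" and small: "\<And>U. open U \<Longrightarrow> 0 \<in> U \<Longrightarrow> \<exists>M\<subseteq>left_cosets ?K. eventually (\<lambda>y. y \<in> M) F \<and>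
       (\<forall>y\<in>M. \<forall>z\<in>M. \<exists>u\<in>U. z = u +o y)" using F unfolding cauchy_coset_uniformity_iff by blast+
  obtain M0 where M0: "M0 \<subseteq> left_cosets ?K" "eventually (\<lambda>y. y \<in> M0) F"
    using small[of UNIV] by auto
  have "\<exists>z\<in>topspace P. \<forall>W. openin P W \<and> z \<in> W \<longrightarrow> \<not> eventually (\<lambda>y. y \<notin> tr W) F"
  proof (rule ccontr)
    assume "\<not> ?thesis"
    then obtain W where W: "\<And>z. z \<in> topspace P \<Longrightarrow> openin P (W z) \<and> z \<in> W z \<and> eventually (\<lambda>y. y \<notin> tr (W z)) F" by metis
    have "\<forall>U\<in>W ` topspace P. openin P U" "topspace P \<subseteq> \<Union>(W ` topspace P)" using W by auto
    then obtain \<F> where \<F>: "finite \<F>" "\<F> \<subseteq> W ` topspace P" "topspace P \<subseteq> \<Union>\<F>"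
      using flow_compact[OF fl, unfolded compact_space_alt, rule_format, of "W ` topspace P"] by metis
    have "eventually (\<lambda>y. \<forall>V\<in>\<F>. y \<notin> tr V) F"
      using \<F>(1,2) W by (intro eventually_ball_finite) auto
    with M0(2) have "eventually (\<lambda>y. False) F"
    proof eventually_elim
      case (elim y)
      then obtain g where g: "y = g +o ?K" using M0(1) by (auto simp: left_cosets_def)
      obtain V where "V \<in> \<F>" "act g x \<in> V" using \<F>(3) flow_act_in[OF fl xP] by blast
      then show False using elim(2) unfolding g tr_def by blast
    qed
    then show False using nb by simp
  qed
  then obtain z where z: "z \<in> topspace P" "\<And>W. openin P W \<Longrightarrow> z \<in> W \<Longrightarrow> \<not> eventually (\<lambda>y. y \<notin> tr W) F" by blast
  have "F \<le> orbit_trace P act x z"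
  proof (rule filter_leI)
    fix Q assume "eventually Q (orbit_trace P act x z)"
    then obtain W where W: "openin P W" "z \<in> W" "\<And>g. act g x \<in> W \<Longrightarrow> Q (g +o ?K)"
      unfolding eventually_orbit_trace[OF z(1)] by blast
    have "closedin P (topspace P - W)" using W(1) by blast
    then obtain u :: "'p \<Rightarrow> real" where u: "continuous_map P euclideanreal u" "u z = 0"
      "\<And>q. q \<in> topspace P - W \<Longrightarrow> u q = 1"
      using compact_Hausdorff_separating_function[OF flow_compact[OF fl] flow_Hausdorff[OF fl] z(1)] W(2) by (metis DiffD2)
    obtain U where U: "open U" "0 \<in> U" "\<forall>g\<in>U. \<forall>p\<in>topspace P. dist (u (act g p)) (u p) < 1/2"
      using flow_function_uniformly_continuous[OF fl u(1), of "1/2"] by auto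
    from small[OF U(1,2)]
    obtain M where M: "M \<subseteq> left_cosets ?K" "eventually (\<lambda>y. y \<in> M) F" "\<forall>y\<in>M. \<forall>z\<in>M. \<exists>u\<in>U. z = u +o y"
      by (elim exE conjE)
    define T where "T = {p \<in> topspace P. u p \<in> {..<1/2}}"
    have "openin P T" unfolding T_def by (rule openin_continuous_map_preimage[OF u(1)]) simp
    moreover have "z \<in> T" using z(1) u(2) by (simp add: T_def)
    ultimately have "\<not> eventually (\<lambda>y. y \<notin> tr T) F" by (rule z(2))
    then have "\<exists>y\<in>M. y \<in> tr T" using M(2) by (metis (mono_tags, lifting) eventually_mono)
    then obtain g where g: "g +o ?K \<in> M" "u (act g x) < 1/2" by (auto simp: tr_def T_def)
    have "Q y" if y: "y \<in> M" for y
    proof -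
      obtain v where v: "v \<in> U" "y = v +o (g +o ?K)"
        using bspec[OF bspec[OF M(3) g(1)] y] by (elim bexE)
      have "dist (u (act v (act g x))) (u (act g x)) < 1/2" using U(3) v(1) flow_act_in[OF fl xP] by blast
      then have "u (act v (act g x)) < 1" using g(2) unfolding dist_real_def by arith
      then have "u (act (v + g) x) < 1" using flow_add[OF fl xP, of v g] by simp
      then have "act (v + g) x \<in> W" using u(3)[of "act (v + g) x"] flow_act_in[OF fl xP] by force
      then show ?thesis using W(3) unfolding v(2) elt_set_plus_assoc by blast
    qed
    then show "eventually Q F" using M(2) by (auto elim: eventually_mono)
  qed
  then show ?thesis using z(1) by blast
qed

lemma orbit_trace_le_imp_eq:
  assumes m: "minimal_flow UNIV P act" and x: "x \<in> topspace P"
    and z: "z \<in> topspace P" and w: "w \<in> topspace P" and le: "orbit_trace P act x z \<le> orbit_trace P act x w"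
  shows "z = w"
proof (rule ccontr)
  assume "z \<noteq> w"
  have fl: "flow UNIV P act" using m by (simp add: minimal_flow_def)
  obtain A B where AB: "openin P A" "openin P B" "z \<in> A" "w \<in> B" "disjnt A B"
    using flow_Hausdorff[OF fl] z w \<open>z \<noteq> w\<close> unfolding Hausdorff_space_def by blast
  let ?K = "stabilizer act x"
  have "eventually (\<lambda>y. \<exists>g. y = g +o ?K \<and> act g x \<in> A) (orbit_trace P act x z)"
    unfolding eventually_orbit_trace[OF z] using AB(1,3) by blast
  moreover have "eventually (\<lambda>y. \<exists>g. y = g +o ?K \<and> act g x \<in> B) (orbit_trace P act x w)"
    unfolding eventually_orbit_trace[OF w] using AB(2,4) by blast
  then have "eventually (\<lambda>y. \<exists>g. y = g +o ?K \<and> act g x \<in> B) (orbit_trace P act x z)"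
    using le by (simp add: le_filter_def)
  ultimately have "eventually (\<lambda>y. False) (orbit_trace P act x z)"
  proof eventually_elim
    case (elim y)
    then obtain g h where "y = g +o ?K" "act g x \<in> A" "y = h +o ?K" "act h x \<in> B" by blast
    then have "act g x \<in> A" "act g x \<in> B" using stabilizer_coset_eq[OF fl x] by metis+
    then show False using AB(5) by (auto simp: disjnt_iff)
  qed
  then show False using orbit_trace_not_bot[OF m x z] by simp
qed

text \<open>
  Every Cauchy filter lies below the trace of a unique point, and traces are Cauchy; so the minimal
  Cauchy filters are the traces. Continuity of \<open>z \<mapsto> orbit_trace P act x z\<close> comes from neighbourhoods with small trace,
  openness from the uniform continuity of functions separating \<open>z\<close> from a closed set.
\<close>

lemma completion_isomorphism:
  fixes act :: "'g::{topological_group_add, polish_space} \<Rightarrow> 'p \<Rightarrow> 'p"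
  assumes univ: "universal_minimal_proximal_flow P act" and x: "nearly_open_point P act x"
    and pc: "orbit_precompact P act x"
  defines "K \<equiv> stabilizer act x"
  shows "\<exists>\<psi>. homeomorphic_map P (coset_completion K) \<psi> \<and>
    equivariant_on UNIV (topspace P) act coset_completion_action \<psi> \<and>
    (\<forall>g. \<psi> (act g x) = completion_point (coset_uniformity K) (g +o K))"
proof -
  have m: "minimal_flow UNIV P act" using univ by (simp add: universal_minimal_proximal_flow_def)
  have fl: "flow UNIV P act" using m by (simp add: minimal_flow_def)
  have xP: "x \<in> topspace P" using x by (simp add: nearly_open_point_def)
  define \<U> where "\<U> = coset_uniformity K"
  define \<psi> where "\<psi> = orbit_trace P act x"
  note ev = eventually_orbit_trace[of _ P _ act x, folded \<psi>_def K_def]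
  have cau: "cauchy_wrt \<U> (\<psi> z)" if "z \<in> topspace P" for z
    unfolding \<U>_def \<psi>_def K_def by (rule orbit_trace_cauchy[OF univ x pc that])
  have lim: "\<exists>z\<in>topspace P. F \<le> \<psi> z" if "cauchy_wrt \<U> F" for F
    using cauchy_le_orbit_trace[OF fl xP] that unfolding \<U>_def \<psi>_def K_def by blast
  have le_eq: "z = w" if "z \<in> topspace P" "w \<in> topspace P" "\<psi> z \<le> \<psi> w" for z w
    using orbit_trace_le_imp_eq[OF m xP that(1,2)] that(3) unfolding \<psi>_def by blast
  have inj: "inj_on \<psi> (topspace P)" by (rule inj_onI) (use le_eq in auto)
  have mc: "minimal_cauchy_wrt \<U> (\<psi> z)" if z: "z \<in> topspace P" for z
    unfolding minimal_cauchy_wrt_def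
  proof (intro conjI cau z allI impI)
    fix F assume F: "cauchy_wrt \<U> F \<and> \<psi> z \<le> F"
    then obtain w where w: "w \<in> topspace P" "F \<le> \<psi> w" using lim by blast
    then have "z = w" using le_eq[OF z w(1)] F by auto
    then show "F = \<psi> z" using F w(2) by auto
  qed
  have onto: "F \<in> \<psi> ` topspace P" if F: "minimal_cauchy_wrt \<U> F" for F
  proof -
    obtain z where z: "z \<in> topspace P" "F \<le> \<psi> z" using lim F unfolding minimal_cauchy_wrt_def by blast
    then have "\<psi> z = F" using F cau[OF z(1)] unfolding minimal_cauchy_wrt_def by blast
    then show ?thesis using z(1) by blast
  qed
  have top: "topspace (coset_completion K) = Collect (minimal_cauchy_wrt \<U>)"
    by (simp add: coset_completion_def topspace_completion \<U>_def)
  have img: "\<psi> ` topspace P = topspace (coset_completion K)" using mc onto unfolding top by blast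
  have op: "openin (coset_completion K) W \<longleftrightarrow> completion_open \<U> W" for W
    by (simp add: coset_completion_def \<U>_def)
  have cont: "continuous_map P (coset_completion K) \<psi>"
    unfolding continuous_map_def
  proof (intro conjI allI impI)
    show "\<psi> \<in> topspace P \<rightarrow> topspace (coset_completion K)" using img by blast
    fix W assume "openin (coset_completion K) W"
    then have W: "completion_open \<U> W" by (simp add: op)
    show "openin P {z \<in> topspace P. \<psi> z \<in> W}"
    proof (subst openin_subopen, intro ballI)
      fix z assume "z \<in> {z \<in> topspace P. \<psi> z \<in> W}"
      then have z: "z \<in> topspace P" "\<psi> z \<in> W" by auto
      obtain V where V: "eventually (\<lambda>p. p \<in> V) \<U>"
        "\<And>F'. minimal_cauchy_wrt \<U> F' \<Longrightarrow> (\<psi> z, F') \<in> completion_entourage V \<Longrightarrow> F' \<in> W"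
        using completion_openD[OF W z(2)] by blast
      obtain U where U: "open U" "0 \<in> U" "\<forall>y\<in>left_cosets K. \<forall>u\<in>U. (y, u +o y) \<in> V"
        using V(1) unfolding \<U>_def eventually_coset_uniformity by blast
      from small_trace_neighbourhood[OF univ x pc z(1) U(1,2)]
      obtain T where T: "openin P T" "z \<in> T"
        "\<forall>g h. act g x \<in> T \<and> act h x \<in> T \<longrightarrow> (\<exists>u\<in>U. act h x = act (u + g) x)"
        by (elim exE conjE)
      define M where "M = {g +o K | g. act g x \<in> T}"
      have M: "M \<times> M \<subseteq> V"
      proof
        fix p assume "p \<in> M \<times> M"
        then obtain g h where gh: "p = (g +o K, h +o K)" "act g x \<in> T" "act h x \<in> T" by (auto simp: M_def)
        then obtain u where u: "u \<in> U" "act h x = act (u + g) x" using T(3) by blast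
        then have "h +o K = u +o (g +o K)"
          using stabilizer_coset_eq[OF fl xP] unfolding K_def elt_set_plus_assoc by blast
        then show "p \<in> V" using U(3) u(1) gh(1) by (auto simp: left_cosets_def)
      qed
      have evM: "eventually (\<lambda>y. y \<in> M) (\<psi> w)" if "w \<in> T" for w
      proof -
        have "w \<in> topspace P" using that openin_subset[OF T(1)] by blast
        then show ?thesis using ev T(1) that by (auto simp: M_def)
      qed
      have "\<psi> w \<in> W" if "w \<in> T" for w
      proof (rule V(2))
        show "minimal_cauchy_wrt \<U> (\<psi> w)" using mc that openin_subset[OF T(1)] by blast
        show "(\<psi> z, \<psi> w) \<in> completion_entourage V"
          unfolding completion_entourage_def using M evM[OF T(2)] evM[OF that] by blast
      qed
      then show "\<exists>T. openin P T \<and> z \<in> T \<and> T \<subseteq> {z \<in> topspace P. \<psi> z \<in> W}"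
        using T(1,2) openin_subset[OF T(1)] by (intro exI[of _ T]) blast
    qed
  qed
  have "open_map P (coset_completion K) \<psi>"
    unfolding open_map_def
  proof (intro allI impI)
    fix O' assume O': "openin P O'"
    have OP: "O' \<subseteq> topspace P" by (rule openin_subset[OF O'])
    show "openin (coset_completion K) (\<psi> ` O')"
      unfolding op completion_open_def
    proof (intro conjI ballI)
      show "\<psi> ` O' \<subseteq> Collect (minimal_cauchy_wrt \<U>)" using mc OP by blast
      fix F assume "F \<in> \<psi> ` O'"
      then obtain z where z: "z \<in> O'" "F = \<psi> z" by blast
      have zP: "z \<in> topspace P" using z(1) OP by blast
      have "closedin P (topspace P - O')" using O' by blast
      then obtain u :: "'p \<Rightarrow> real" where u: "continuous_map P euclideanreal u" "u z = 0"
        "\<And>q. q \<in> topspace P - O' \<Longrightarrow> u q = 1"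
        using compact_Hausdorff_separating_function[OF flow_compact[OF fl] flow_Hausdorff[OF fl] zP] z(1) by (metis DiffD2)
      obtain U where U: "open U" "0 \<in> U" "\<forall>g\<in>U. \<forall>p\<in>topspace P. dist (u (act g p)) (u p) < 1/3"
        using flow_function_uniformly_continuous[OF fl u(1), of "1/3"] by auto
      define V where "V = {(y, v +o y) | y v. y \<in> left_cosets K \<and> v \<in> U}"
      have "eventually (\<lambda>p. p \<in> V) \<U>"
        unfolding \<U>_def eventually_coset_uniformity using U(1,2) by (auto simp: V_def)
      moreover have "F' \<in> \<psi> ` O'" if F': "minimal_cauchy_wrt \<U> F'" "(F, F') \<in> completion_entourage V" for F'
      proof -
        obtain w where w: "w \<in> topspace P" "F' = \<psi> w" using onto[OF F'(1)] by blast
        obtain M where M: "M \<times> M \<subseteq> V" "eventually (\<lambda>y. y \<in> M) (\<psi> z)" "eventually (\<lambda>y. y \<in> M) (\<psi> w)"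
          using F'(2) unfolding completion_entourage_def z(2) w(2) by blast
        have near: "\<exists>g. g +o K \<in> M \<and> \<bar>u (act g x) - u t\<bar> < 1/6" if t: "t \<in> topspace P" "eventually (\<lambda>y. y \<in> M) (\<psi> t)" for t
        proof -
          obtain T where T: "openin P T" "t \<in> T" "\<And>g. act g x \<in> T \<Longrightarrow> g +o K \<in> M"
            using t(2) unfolding ev[OF t(1)] by blast
          have "openin P {p \<in> topspace P. u p \<in> {u t - 1/6<..<u t + 1/6}}"
            by (rule openin_continuous_map_preimage[OF u(1)]) simp
          then have "openin P (T \<inter> {p \<in> topspace P. u p \<in> {u t - 1/6<..<u t + 1/6}})" using T(1) by blast
          moreover have "t \<in> T \<inter> {p \<in> topspace P. u p \<in> {u t - 1/6<..<u t + 1/6}}" using T(2) t(1) by simp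
          moreover have "t \<in> orbit_closure UNIV P act x" using minimal_flow_orbit_closure[OF m xP] t(1) by simp
          ultimately obtain p where "p \<in> orbit_of UNIV act x" "p \<in> T" "u p \<in> {u t - 1/6<..<u t + 1/6}"
            using closure_of_meets[of t P "orbit_of UNIV act x" "T \<inter> {p \<in> topspace P. u p \<in> {u t - 1/6<..<u t + 1/6}}"] by blast
          then obtain g where "act g x \<in> T" "u t - 1/6 < u (act g x)" "u (act g x) < u t + 1/6"
            by (auto simp: orbit_of_def)
          moreover from this have "\<bar>u (act g x) - u t\<bar> < 1/6" by arith
          ultimately show ?thesis using T(3) by blast
        qed
        obtain g where g: "g +o K \<in> M" "\<bar>u (act g x) - u z\<bar> < 1/6" using near[OF zP M(2)] by blast
        obtain h where h: "h +o K \<in> M" "\<bar>u (act h x) - u w\<bar> < 1/6" using near[OF w(1) M(3)] by blast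
        have "(g +o K, h +o K) \<in> V" using M(1) g(1) h(1) by blast
        then obtain v where v: "v \<in> U" "h +o K = v +o (g +o K)" by (auto simp: V_def)
        then have "act h x = act (v + g) x"
          using stabilizer_coset_eq[OF fl xP] unfolding K_def elt_set_plus_assoc by blast
        then have "act h x = act v (act g x)" using flow_add[OF fl xP] by simp
        then have "dist (u (act h x)) (u (act g x)) < 1/3" using U(3) v(1) flow_act_in[OF fl xP] by simp
        then have "u w < 1" using g(2) h(2) u(2) unfolding dist_real_def by arith
        then have "w \<in> O'" using u(3)[of w] w(1) by force
        then show ?thesis using w(2) by blast
      qed
      ultimately show "\<exists>V. eventually (\<lambda>p. p \<in> V) \<U> \<and>
          (\<forall>F'. minimal_cauchy_wrt \<U> F' \<and> (F, F') \<in> completion_entourage V \<longrightarrow> F' \<in> \<psi> ` O')" by blast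
    qed
  qed
  then have hom: "homeomorphic_map P (coset_completion K) \<psi>"
    by (rule bijective_open_imp_homeomorphic_map[OF cont _ img inj])
  have "equivariant_on UNIV (topspace P) act coset_completion_action \<psi>"
    unfolding equivariant_on_def
  proof (intro ballI)
    fix g z assume z: "z \<in> topspace P"
    have gz: "act g z \<in> topspace P" by (rule flow_act_in[OF fl z])
    show "\<psi> (act g z) = coset_completion_action g (\<psi> z)"
      unfolding filter_eq_iff coset_completion_action_def eventually_filtermap ev[OF z] ev[OF gz]
    proof (intro allI iffI)
      fix Q assume "\<exists>W. openin P W \<and> act g z \<in> W \<and> (\<forall>h. act h x \<in> W \<longrightarrow> Q (h +o K))"
      then obtain W where W: "openin P W" "act g z \<in> W" "\<And>h. act h x \<in> W \<Longrightarrow> Q (h +o K)" by blast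
      have "openin P {p \<in> topspace P. act g p \<in> W}"
        using openin_continuous_map_preimage[OF flow_continuous_act[OF fl] W(1)] by blast
      then show "\<exists>W. openin P W \<and> z \<in> W \<and> (\<forall>h. act h x \<in> W \<longrightarrow> Q (g +o (h +o K)))"
        using W(2,3) z flow_add[OF fl xP]
        by (intro exI[of _ "{p \<in> topspace P. act g p \<in> W}"]) (auto simp: elt_set_plus_assoc)
    next
      fix Q assume "\<exists>W. openin P W \<and> z \<in> W \<and> (\<forall>h. act h x \<in> W \<longrightarrow> Q (g +o (h +o K)))"
      then obtain W where W: "openin P W" "z \<in> W" "\<And>h. act h x \<in> W \<Longrightarrow> Q ((g + h) +o K)"
        by (auto simp: elt_set_plus_assoc)
      have "openin P {p \<in> topspace P. act (- g) p \<in> W}"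
        using openin_continuous_map_preimage[OF flow_continuous_act[OF fl] W(1)] by blast
      moreover have "Q (h +o K)" if "act h x \<in> {p \<in> topspace P. act (- g) p \<in> W}" for h
        using W(3)[of "- g + h"] that flow_add[OF fl xP, of "- g" h] by (simp add: add.assoc[symmetric])
      ultimately show "\<exists>W. openin P W \<and> act g z \<in> W \<and> (\<forall>h. act h x \<in> W \<longrightarrow> Q (h +o K))"
        using W(2) gz flow_act_inverse(1)[OF fl z]
        by (intro exI[of _ "{p \<in> topspace P. act (- g) p \<in> W}"]) auto
    qed
  qed
  moreover have "\<psi> (act g x) = completion_point \<U> (g +o K)" for g
  proof -
    have gP: "act g x \<in> topspace P" by (rule flow_act_in[OF fl xP])
    have gc: "g +o K \<in> left_cosets K" by (auto simp: left_cosets_def)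
    have "completion_point \<U> (g +o K) \<le> \<psi> (act g x)"
    proof (rule filter_leI)
      fix Q assume "eventually Q (\<psi> (act g x))"
      then obtain W where W: "openin P W" "act g x \<in> W" "\<And>h. act h x \<in> W \<Longrightarrow> Q (h +o K)"
        unfolding ev[OF gP] by blast
      have "open {u. act u (act g x) \<in> W}" by (rule open_orbit_preimage[OF fl gP W(1)])
      moreover have "0 \<in> {u. act u (act g x) \<in> W}" using W(2) flow_zero[OF fl gP] by simp
      moreover have "Q (u +o (g +o K))" if "act u (act g x) \<in> W" for u
        using W(3)[of "u + g"] that flow_add[OF fl xP] by (simp add: elt_set_plus_assoc)
      ultimately show "eventually Q (completion_point \<U> (g +o K))"
        unfolding \<U>_def eventually_completion_point[OF gc] by blast
    qed
    moreover have "minimal_cauchy_wrt \<U> (completion_point \<U> (g +o K))"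
      unfolding \<U>_def by (rule completion_point_minimal_cauchy[OF gc])
    ultimately show ?thesis using cau[OF gP] unfolding minimal_cauchy_wrt_def by blast
  qed
  ultimately show ?thesis using hom unfolding \<U>_def by blast
qed


section \<open>Metrizability and precompactness\<close>

text \<open>
  Countably many distance functions \<open>f\<^sub>q\<close> separate points: if \<open>f\<^sub>q\<close> is small at both \<open>p\<close> and \<open>p'\<close>,
  then both are limits of points of the orbit obtained from \<open>q x\<close> by small elements, along which
  a continuous function varies little.
\<close>

lemma orbit_precompact_imp_metrizable:
  fixes act :: "'g::{topological_group_add, polish_space} \<Rightarrow> 'p \<Rightarrow> 'p"
  assumes univ: "universal_minimal_proximal_flow P act" and x: "nearly_open_point P act x"
    and pc: "orbit_precompact P act x"
  shows "metrizable_space P"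
proof -
  have m: "minimal_flow UNIV P act" using univ by (simp add: universal_minimal_proximal_flow_def)
  have fl: "flow UNIV P act" using m by (simp add: minimal_flow_def)
  have xP: "x \<in> topspace P" using x by (simp add: nearly_open_point_def)
  have dense: "orbit_closure UNIV P act x = topspace P" by (rule minimal_flow_orbit_closure[OF m xP])
  obtain D :: "'g set" where D: "countable D" "\<And>X. open X \<Longrightarrow> X \<noteq> {} \<Longrightarrow> \<exists>d\<in>D. d \<in> X"
    using countable_dense_setE by blast
  have "D \<noteq> {}" using D(2)[of UNIV] by auto
  define q where "q = from_nat_into D"
  have q: "range q = D" unfolding q_def by (rule range_from_nat_into[OF \<open>D \<noteq> {}\<close> D(1)])
  define dist_fun where "dist_fun n f \<longleftrightarrow> continuous_map P euclideanreal f \<and> (\<forall>u. f (act (u + q n) x) \<le> gnorm u) \<and>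
    (\<forall>g t. f (act g x) < t \<and> t \<le> 1 \<longrightarrow> (\<exists>u. gnorm u < t \<and> act g x = act (u + q n) x))" for n f
  have "\<forall>n. \<exists>f. dist_fun n f" unfolding dist_fun_def using orbit_distance_extension[OF univ x] by blast
  then obtain f where f: "\<And>n. dist_fun n (f n)" by metis
  have fc: "continuous_map P euclideanreal (f n)" for n using f[of n] by (simp add: dist_fun_def)
  have f_le: "f n (act (u + q n) x) \<le> gnorm u" for n u using f[of n] by (simp add: dist_fun_def)
  have f_less: "\<exists>u. gnorm u < t \<and> act g x = act (u + q n) x" if "f n (act g x) < t" "t \<le> 1" for n g t
    using f[of n] that unfolding dist_fun_def by blast
  define e where "e p = (\<lambda>n. f n p)" for p
  have inj: "inj_on e (topspace P)"
  proof (rule inj_onI, rule ccontr)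
    fix p p' assume p: "p \<in> topspace P" "p' \<in> topspace P" "e p = e p'" "p \<noteq> p'"
    have "closedin P {p'}" using flow_Hausdorff[OF fl] p(2) by (simp add: closedin_Hausdorff_singleton)
    then obtain v :: "'p \<Rightarrow> real" where v: "continuous_map P euclideanreal v" "v p = 0" "v p' = 1"
      using compact_Hausdorff_separating_function[OF flow_compact[OF fl] flow_Hausdorff[OF fl] p(1)] p(4)
      by (metis singleton_iff)
    obtain U where U: "open U" "0 \<in> U" "\<forall>g\<in>U. \<forall>z\<in>topspace P. dist (v (act g z)) (v z) < 1/3"
      using flow_function_uniformly_continuous[OF fl v(1), of "1/3"] by auto
    obtain r0 where r0: "r0 > 0" "\<And>g. gnorm g < r0 \<Longrightarrow> g \<in> U" using gnorm_ball_subset[OF U(1,2)] by blast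
    define r where "r = min r0 1"
    have r: "r > 0" "r \<le> 1" "\<And>g. gnorm g < r \<Longrightarrow> g \<in> U" using r0 by (auto simp: r_def)
    have "open {u :: 'g. gnorm (u - 0) < r/4}" "0 \<in> {u :: 'g. gnorm (u - 0) < r/4}"
      by (rule open_gnorm_ball) (simp add: r(1))
    then obtain q' where q': "p \<in> P closure_of ((\<lambda>u. act (u + q') x) ` {u. gnorm (u - 0) < r/4})"
      using pc p(1) unfolding orbit_precompact_def by blast
    have "open {g. gnorm (g - q') < r/4}" "q' \<in> {g. gnorm (g - q') < r/4}"
      by (rule open_gnorm_ball) (simp add: r(1))
    then obtain d where "d \<in> D" "gnorm (d - q') < r/4" using D(2)[of "{g. gnorm (g - q') < r/4}"] by blast
    then obtain n where n: "gnorm (q n - q') < r/4" using q by (metis rangeE)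
    have "f n (act (u + q') x) \<le> r/2" if "gnorm u < r/4" for u
    proof -
      have "act (u + q') x = act ((u + (q' - q n)) + q n) x" by (simp add: add.assoc)
      then have "f n (act (u + q') x) \<le> gnorm (u + (q' - q n))" using f_le[of n "u + (q' - q n)"] by simp
      also have "\<dots> \<le> gnorm u + gnorm (q' - q n)" by (rule gnorm_triangle)
      finally show ?thesis using that n gnorm_minus_commute[of "q n" q'] by linarith
    qed
    then have "(\<lambda>u. act (u + q') x) ` {u. gnorm (u - 0) < r/4} \<subseteq> {p \<in> topspace P. f n p \<in> {..r/2}}"
      using flow_act_in[OF fl xP] by auto
    moreover have "closedin P {p \<in> topspace P. f n p \<in> {..r/2}}" by (rule closedin_continuous_map_preimage[OF fc]) simp
    ultimately have "f n p \<le> r/2" using q' closure_of_minimal by blast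
    moreover have "f n p = f n p'" using p(3) by (metis e_def)
    ultimately have small: "f n p < r" "f n p' < r" using r(1) by linarith+
    have "\<bar>v t - v (act (q n) x)\<bar> \<le> 1/3" if t: "t \<in> topspace P" "f n t < r" for t
    proof -
      define T where "T = {p \<in> topspace P. f n p \<in> {..<r}}"
      have T: "openin P T" unfolding T_def by (rule openin_continuous_map_preimage[OF fc]) simp
      define C where "C = {p \<in> topspace P. v p \<in> {v (act (q n) x) - 1/3..v (act (q n) x) + 1/3}}"
      have C: "closedin P C" unfolding C_def by (rule closedin_continuous_map_preimage[OF v(1)]) simp
      have "T \<inter> orbit_of UNIV act x \<subseteq> C"
      proof
        fix s assume "s \<in> T \<inter> orbit_of UNIV act x"
        then obtain g where g: "s = act g x" "f n (act g x) < r" "s \<in> topspace P" by (auto simp: T_def orbit_of_def)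
        obtain u where u: "gnorm u < r" "act g x = act (u + q n) x" using f_less[OF g(2) r(2)] by blast
        have "act g x = act u (act (q n) x)" unfolding u(2) by (rule flow_add[OF fl xP]) auto
        then have "dist (v s) (v (act (q n) x)) < 1/3"
          using U(3) r(3)[OF u(1)] flow_act_in[OF fl xP] g(1) by simp
        then have "v (act (q n) x) - 1/3 \<le> v s" "v s \<le> v (act (q n) x) + 1/3"
          unfolding dist_real_def by arith+
        then show "s \<in> C" using g(3) by (simp add: C_def)
      qed
      then have "P closure_of T \<subseteq> C"
        using closure_of_openin_Int_dense[OF T dense] closure_of_minimal[OF _ C] by blast
      moreover have "t \<in> P closure_of T"
        using closure_of_subset[OF openin_subset[OF T]] t by (auto simp: T_def)
      ultimately have "t \<in> C" by blast
      then have "v (act (q n) x) - 1/3 \<le> v t" "v t \<le> v (act (q n) x) + 1/3" by (simp_all add: C_def)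
      then show ?thesis by arith
    qed
    from this[OF p(1) small(1)] this[OF p(2) small(2)] show False using v(2,3) by arith
  qed
  have cont: "continuous_map P euclidean e"
  proof -
    have "continuous_map P (product_topology (\<lambda>_. euclideanreal) UNIV) e"
      unfolding continuous_map_componentwise_UNIV e_def using fc by blast
    then show ?thesis by (simp add: euclidean_product_topology)
  qed
  have "homeomorphic_map P (top_of_set (e ` topspace P)) e"
    by (rule continuous_imp_homeomorphic_map)
      (use cont flow_compact[OF fl] inj in \<open>auto simp: continuous_map_in_subtopology
        intro: Hausdorff_space_subtopology Hausdorff_fun_space\<close>)
  then have "P homeomorphic_space top_of_set (e ` topspace P)"
    using homeomorphic_map_imp_homeomorphic_space by blast
  moreover have "metrizable_space (top_of_set (e ` topspace P))"
    by (intro metrizable_space_subtopology metrizable_space_euclidean)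
  ultimately show ?thesis using homeomorphic_metrizable_space by blast
qed

text \<open>
  Were \<open>z\<close> outside \<open>closure (U q x)\<close> for every \<open>q\<close>, orbit points \<open>g\<^sub>n x\<close> could be chosen in shrinking
  neighbourhoods \<open>W\<^sub>n\<close> of \<open>z\<close> avoiding \<open>closure (U g\<^sub>m x)\<close> for \<open>m < n\<close>; small pieces around them are separated.
\<close>

lemma metrizable_imp_orbit_precompact:
  fixes act :: "'g::{topological_group_add, polish_space} \<Rightarrow> 'p \<Rightarrow> 'p"
  assumes univ: "universal_minimal_proximal_flow P act" and x: "nearly_open_point P act x"
    and met: "metrizable_space P"
  shows "orbit_precompact P act x"
  unfolding orbit_precompact_def
proof (intro ballI allI impI, rule ccontr)
  fix z and U :: "'g set"
  assume z: "z \<in> topspace P" and U: "open U \<and> 0 \<in> U"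
    and neg: "\<nexists>q. z \<in> P closure_of ((\<lambda>u. act (u + q) x) ` U)"
  have m: "minimal_flow UNIV P act" using univ by (simp add: universal_minimal_proximal_flow_def)
  have fl: "flow UNIV P act" using m by (simp add: minimal_flow_def)
  have xP: "x \<in> topspace P" using x by (simp add: nearly_open_point_def)
  obtain r where r: "r > 0" "\<And>g. gnorm g < r \<Longrightarrow> g \<in> U" using U gnorm_ball_subset by meson
  define C where "C q = P closure_of ((\<lambda>u. act (u + q) x) ` U)" for q
  define R where "R n p \<longleftrightarrow> openin P (snd p) \<and> z \<in> snd p \<and> act (fst p) x \<in> snd p"
    for n :: nat and p :: "'g \<times> 'p set"
  have orb: "\<exists>g. act g x \<in> W" if "openin P W" "z \<in> W" for W
    using closure_of_meets[of z P "orbit_of UNIV act x" W] minimal_flow_orbit_closure[OF m xP] z that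
    by (auto simp: orbit_of_def)
  have "\<exists>s. \<forall>n. R n (s n) \<and> snd (s (Suc n)) = snd (s n) - C (fst (s n))"
  proof (rule dependent_nat_choice)
    obtain g where "act g x \<in> topspace P" using flow_act_in[OF fl xP] by blast
    then show "\<exists>p. R 0 p" using z by (intro exI[of _ "(g, topspace P)"]) (simp add: R_def)
    fix p n assume p: "R n p"
    define W where "W = snd p - C (fst p)"
    have "openin P W" "z \<in> W" using p neg by (auto simp: R_def W_def C_def intro!: openin_diff)
    moreover from this obtain g where "act g x \<in> W" using orb by blast
    ultimately show "\<exists>q. R (Suc n) q \<and> snd q = snd p - C (fst p)"
      by (intro exI[of _ "(g, W)"]) (simp add: R_def W_def)
  qed
  then obtain s where s: "\<And>n. R n (s n)" "\<And>n. snd (s (Suc n)) = snd (s n) - C (fst (s n))" by blast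
  define gg where "gg n = fst (s n)" for n
  define W where "W n = snd (s n)" for n
  have W: "openin P (W n)" "act (gg n) x \<in> W n" "W (Suc n) = W n - C (gg n)" for n
    using s[of n] by (simp_all add: R_def W_def gg_def)
  have dec: "W j \<subseteq> W i" if "i \<le> j" for i j
    using lift_Suc_antimono_le[of W i j] W(3) that by blast
  define B where "B = {u :: 'g. gnorm (u - 0) < r / 2}"
  have B: "open B" "0 \<in> B" unfolding B_def by (rule open_gnorm_ball) (simp add: r(1))
  define A where "A n = W n \<inter> P interior_of (P closure_of ((\<lambda>u. act u (act (gg n) x)) ` B))" for n
  show False
  proof (rule no_separated_sequence[OF univ met, of A "r / 2"])
    show "openin P (A n)" for n unfolding A_def by (intro openin_Int W(1) openin_interior_of)
    show "A n \<noteq> {}" for n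
      using nearly_open_point_act[OF fl x, of "gg n"] W(2) B unfolding A_def nearly_open_point_def by blast
    show "r / 2 > 0" using r(1) by simp
    fix i j :: nat and g :: 'g and p assume ij: "i < j" "gnorm g < r / 2" "p \<in> A i"
    have p: "p \<in> P closure_of ((\<lambda>u. act u (act (gg i) x)) ` B)"
      using ij(3) unfolding A_def by (blast dest: interior_of_mem)
    have "act g p \<in> act g ` (P closure_of ((\<lambda>u. act u (act (gg i) x)) ` B))" using p by blast
    also have "\<dots> = P closure_of ((\<lambda>u. act (g + u) (act (gg i) x)) ` B)"
      by (rule flow_act_closure[OF fl flow_act_in[OF fl xP]])
    also have "\<dots> \<subseteq> C (gg i)"
      unfolding C_def
    proof (rule closure_of_mono, rule image_subsetI)
      fix u assume u: "u \<in> B"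
      have "gnorm (g + u) < r" using gnorm_triangle[of g u] ij(2) u by (simp add: B_def)
      then have "g + u \<in> U" by (rule r(2))
      moreover have "act (g + u) (act (gg i) x) = act (g + u + gg i) x"
        by (rule flow_add[OF fl xP, symmetric]) auto
      ultimately show "act (g + u) (act (gg i) x) \<in> (\<lambda>u. act (u + gg i) x) ` U" by blast
    qed
    finally have "act g p \<notin> W (Suc i)" using W(3) by blast
    then show "act g p \<notin> A j" using dec[of "Suc i" j] ij(1) unfolding A_def by auto
  qed
qed

text \<open>
  A point \<open>z\<close> corresponds to a minimal Cauchy filter \<open>F\<close> through the two homeomorphisms with the Samuel
  compactification. A \<open>U\<close>-small member \<open>M\<close> of \<open>F\<close> is contained in \<open>U q K\<close> for any coset \<open>q K\<close> in it, and the
  points of \<open>M\<close> accumulate at \<open>F\<close> in the completion. Both homeomorphisms respect the points of the coset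
  space, so this carries over to \<open>P\<close>.
\<close>

lemma co_precompact_imp_orbit_precompact:
  fixes act :: "'g::{topological_group_add, polish_space} \<Rightarrow> 'p \<Rightarrow> 'p"
  assumes univ: "universal_minimal_proximal_flow P act" and x: "nearly_open_point P act x"
    and co: "co_precompact (stabilizer act x)"
  shows "orbit_precompact P act x"
  unfolding orbit_precompact_def
proof (intro ballI allI impI)
  fix z and U :: "'g set"
  assume z: "z \<in> topspace P" and U: "open U \<and> 0 \<in> U"
  define K where "K = stabilizer act x"
  define \<U> where "\<U> = coset_uniformity K"
  have fl: "flow UNIV P act" using univ by (simp add: universal_minimal_proximal_flow_def minimal_flow_def)
  have xP: "x \<in> topspace P" using x by (simp add: nearly_open_point_def)
  obtain \<Phi> where \<Phi>: "homeomorphic_map P (samuel K) \<Phi>" "\<And>g. \<Phi> (act g x) = samuel_point K (g +o K)"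
    using samuel_isomorphism[OF univ x] unfolding K_def by blast
  obtain \<phi> where \<phi>: "homeomorphic_map (coset_completion K) (samuel K) \<phi>"
    "\<And>y. y \<in> left_cosets K \<Longrightarrow> \<phi> (completion_point \<U> y) = samuel_point K y"
    using co unfolding co_precompact_def K_def \<U>_def by blast
  have top: "topspace (coset_completion K) = Collect (minimal_cauchy_wrt \<U>)"
    by (simp add: coset_completion_def topspace_completion \<U>_def)
  have "\<Phi> z \<in> topspace (samuel K)" using homeomorphic_imp_surjective_map[OF \<Phi>(1)] z by blast
  then obtain F where F: "minimal_cauchy_wrt \<U> F" "\<phi> F = \<Phi> z"
    using homeomorphic_imp_surjective_map[OF \<phi>(1)] top by (metis (no_types, lifting) imageE mem_Collect_eq)
  have Fc: "cauchy_wrt \<U> F" using F(1) by (simp add: minimal_cauchy_wrt_def)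
  note Fcau = Fc[unfolded \<U>_def cauchy_coset_uniformity_iff]
  have nb: "F \<noteq> bot" using Fcau by blast
  from Fcau[THEN conjunct2, rule_format, OF U]
  obtain M where M: "M \<subseteq> left_cosets K" "eventually (\<lambda>y. y \<in> M) F" "\<forall>y\<in>M. \<forall>z\<in>M. \<exists>u\<in>U. z = u +o y"
    by (elim exE conjE)
  obtain y0 where y0: "y0 \<in> M" using eventually_happens'[OF nb M(2)] by blast
  then obtain q where q: "y0 = q +o K" using M(1) by (auto simp: left_cosets_def)
  have "z \<in> P closure_of ((\<lambda>u. act (u + q) x) ` U)"
    unfolding in_closure_of
  proof (intro conjI z allI impI)
    fix T assume T: "z \<in> T \<and> openin P T"
    have TP: "T \<subseteq> topspace P" using T openin_subset by blast
    have "openin (samuel K) (\<Phi> ` T)"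
      using homeomorphic_imp_open_map[OF \<Phi>(1)] T unfolding open_map_def by blast
    then have "openin (coset_completion K) {G \<in> topspace (coset_completion K). \<phi> G \<in> \<Phi> ` T}"
      by (rule openin_continuous_map_preimage[OF homeomorphic_imp_continuous_map[OF \<phi>(1)]])
    then have O': "completion_open \<U> {G \<in> topspace (coset_completion K). \<phi> G \<in> \<Phi> ` T}"
      by (simp add: coset_completion_def \<U>_def)
    have "F \<in> {G \<in> topspace (coset_completion K). \<phi> G \<in> \<Phi> ` T}" using F T top by auto
    from completion_openD[OF O' this]
    obtain V where V: "eventually (\<lambda>p. p \<in> V) \<U>"
      "\<And>G. minimal_cauchy_wrt \<U> G \<Longrightarrow> (F, G) \<in> completion_entourage V \<Longrightarrow> \<phi> G \<in> \<Phi> ` T" by blast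
    obtain U1 where U1: "open U1" "0 \<in> U1" "\<forall>y\<in>left_cosets K. \<forall>u\<in>U1. (y, u +o y) \<in> V"
      using V(1) unfolding \<U>_def eventually_coset_uniformity by blast
    from zero_nhd_threefold[OF U1(1,2)]
    obtain U2 where U2: "open U2" "0 \<in> U2" "\<forall>v\<in>U2. - v \<in> U2" "\<forall>a\<in>U2. \<forall>b\<in>U2. \<forall>c\<in>U2. a + b + c \<in> U1"
      by (elim exE conjE)
    from Fcau[THEN conjunct2, rule_format, OF conjI[OF U2(1,2)]]
    obtain M2 where M2: "M2 \<subseteq> left_cosets K" "eventually (\<lambda>y. y \<in> M2) F" "\<forall>y\<in>M2. \<forall>z\<in>M2. \<exists>u\<in>U2. z = u +o y"
      by (elim exE conjE)
    have "eventually (\<lambda>y. y \<in> M \<and> y \<in> M2) F" using M(2) M2(2) by (rule eventually_conj)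
    then obtain y where y: "y \<in> M" "y \<in> M2" using eventually_happens'[OF nb] by blast
    have yc: "y \<in> left_cosets K" using y(1) M(1) by blast
    define M3 where "M3 = (\<lambda>u. u +o y) ` U2"
    have "(u +o y, v +o y) \<in> V" if uv: "u \<in> U2" "v \<in> U2" for u v
    proof -
      have "v + - u + 0 \<in> U1" using U2(2,4) U2(3)[rule_format, OF uv(1)] uv(2) by blast
      moreover have "v +o y = (v + - u + 0) +o (u +o y)" by (simp add: elt_set_plus_assoc add.assoc)
      moreover have "u +o y \<in> left_cosets K" using yc by (simp add: translate_left_coset_iff)
      ultimately show ?thesis using U1(3) by metis
    qed
    then have "M3 \<times> M3 \<subseteq> V" by (auto simp: M3_def)
    moreover have "eventually (\<lambda>y. y \<in> M3) F"
    proof (rule eventually_mono[OF M2(2)])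
      fix w assume "w \<in> M2"
      from bspec[OF bspec[OF M2(3) y(2)] this] show "w \<in> M3" by (auto simp: M3_def)
    qed
    moreover have "eventually (\<lambda>y. y \<in> M3) (completion_point \<U> y)"
      unfolding \<U>_def eventually_completion_point[OF yc] using U2(1,2) by (auto simp: M3_def)
    ultimately have "(F, completion_point \<U> y) \<in> completion_entourage V"
      unfolding completion_entourage_def by blast
    then have "\<phi> (completion_point \<U> y) \<in> \<Phi> ` T"
      using V(2) completion_point_minimal_cauchy[OF yc] unfolding \<U>_def by blast
    moreover from bspec[OF bspec[OF M(3) y0] y(1)]
    obtain u where u: "u \<in> U" "y = u +o y0" by (elim bexE)
    then have yq: "y = (u + q) +o K" by (simp add: q elt_set_plus_assoc)
    ultimately have "\<Phi> (act (u + q) x) \<in> \<Phi> ` T" using \<phi>(2)[OF yc] \<Phi>(2) by simp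
    then have "act (u + q) x \<in> T"
      using homeomorphic_imp_injective_map[OF \<Phi>(1)] flow_act_in[OF fl xP] TP by (metis inj_on_image_mem_iff)
    then show "\<exists>p. p \<in> (\<lambda>u. act (u + q) x) ` U \<and> p \<in> T" using u(1) by blast
  qed
  then show "\<exists>q. z \<in> P closure_of ((\<lambda>u. act (u + q) x) ` U)" by blast
qed

lemma orbit_precompact_imp_co_precompact:
  fixes act :: "'g::{topological_group_add, polish_space} \<Rightarrow> 'p \<Rightarrow> 'p"
  assumes univ: "universal_minimal_proximal_flow P act" and x: "nearly_open_point P act x"
    and pc: "orbit_precompact P act x"
  shows "co_precompact (stabilizer act x)"
proof -
  define K where "K = stabilizer act x"
  have fl: "flow UNIV P act" using univ by (simp add: universal_minimal_proximal_flow_def minimal_flow_def)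
  have xP: "x \<in> topspace P" using x by (simp add: nearly_open_point_def)
  obtain \<Phi> where \<Phi>: "homeomorphic_map P (samuel K) \<Phi>" "\<And>g. \<Phi> (act g x) = samuel_point K (g +o K)"
    using samuel_isomorphism[OF univ x] unfolding K_def by blast
  obtain \<psi> where \<psi>: "homeomorphic_map P (coset_completion K) \<psi>"
    "\<And>g. \<psi> (act g x) = completion_point (coset_uniformity K) (g +o K)"
    using completion_isomorphism[OF univ x pc] unfolding K_def by blast
  obtain \<rho> where \<rho>: "homeomorphic_maps P (coset_completion K) \<psi> \<rho>" using \<psi>(1) homeomorphic_map_maps by blast
  then have "homeomorphic_map (coset_completion K) P \<rho>" "\<And>p. p \<in> topspace P \<Longrightarrow> \<rho> (\<psi> p) = p"
    by (auto simp: homeomorphic_maps_map)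
  then have "homeomorphic_map (coset_completion K) (samuel K) (\<Phi> \<circ> \<rho>)"
    "\<And>g. (\<Phi> \<circ> \<rho>) (completion_point (coset_uniformity K) (g +o K)) = samuel_point K (g +o K)"
    using \<Phi> \<psi>(2) flow_act_in[OF fl xP] by (auto intro: homeomorphic_map_compose simp flip: \<psi>(2))
  then show ?thesis
    unfolding co_precompact_def K_def[symmetric] by (intro exI[of _ "\<Phi> \<circ> \<rho>"]) (auto simp: left_cosets_def)
qed

section \<open>The universal minimal proximal flow of a Polish group\<close>

theorem theorem5p12:
  fixes P :: "'p topology"
    and act :: "'g::{topological_group_add, polish_space} \<Rightarrow> 'p \<Rightarrow> 'p"
  assumes "universal_minimal_proximal_flow P act"
  shows
    "(has_comeager_orbit P act \<longleftrightarrow>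
        (\<exists>H :: 'g set. presyndetic H \<and> maximal_strongly_amenable H)) \<and>
     (\<forall>H :: 'g set. presyndetic H \<and> maximal_strongly_amenable H \<longrightarrow>
        flow_iso UNIV P act (samuel H) (samuel_action H)) \<and>
     (metrizable_space P \<longleftrightarrow>
        (\<exists>H :: 'g set. presyndetic H \<and> co_precompact H \<and> maximal_strongly_amenable H)) \<and>
     (\<forall>H :: 'g set. presyndetic H \<and> co_precompact H \<and> maximal_strongly_amenable H \<longrightarrow>
        flow_iso UNIV P act (coset_completion H) coset_completion_action)"
proof -
  have m: "minimal_flow UNIV P act" and p: "proximal_flow UNIV P act"
    using assms by (auto simp: universal_minimal_proximal_flow_def)
  have fl: "flow UNIV P act" using m by (simp add: minimal_flow_def)
  \<comment> \<open>The groups in question are exactly the stabilizers of nearly open points.\<close>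
  have stab: "\<exists>x. nearly_open_point P act x \<and> H = stabilizer act x"
    if H: "presyndetic H" "maximal_strongly_amenable H" for H
  proof -
    have "strongly_amenable H" using H(2) by (simp add: maximal_strongly_amenable_def)
    from presyndetic_strongly_amenable_fixed_point[OF m p H(1) this]
    obtain x where x: "nearly_open_point P act x" "H \<subseteq> stabilizer act x" by blast
    have "closed_subgroup (stabilizer act x)" "strongly_amenable (stabilizer act x)"
      using stabilizer_maximal_strongly_amenable[OF assms x(1)] by (simp_all add: maximal_strongly_amenable_def)
    then have "stabilizer act x = H" using H(2) x(2) unfolding maximal_strongly_amenable_def by blast
    then show ?thesis using x(1) by blast
  qed
  have good: "presyndetic (stabilizer act x) \<and> maximal_strongly_amenable (stabilizer act x)"
    if "nearly_open_point P act x" for x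
    using stabilizer_presyndetic[OF m that] stabilizer_maximal_strongly_amenable[OF assms that] by blast
  have comeager: "has_comeager_orbit P act \<longleftrightarrow> (\<exists>x. nearly_open_point P act x)"
  proof
    assume "has_comeager_orbit P act"
    then show "\<exists>x. nearly_open_point P act x"
      using comeager_orbit_imp_nearly_open[OF fl] unfolding has_comeager_orbit_def by blast
  next
    assume "\<exists>x. nearly_open_point P act x"
    then obtain x where x: "nearly_open_point P act x" by blast
    then have "x \<in> topspace P" by (simp add: nearly_open_point_def)
    then show "has_comeager_orbit P act"
      unfolding has_comeager_orbit_def
      using nearly_open_imp_comeager_orbit[OF fl x] minimal_flow_orbit_closure[OF m] by blast
  qed
  have samuel: "flow_iso UNIV P act (samuel H) (samuel_action H)"
    if H: "presyndetic H" "maximal_strongly_amenable H" for H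
  proof -
    obtain x where x: "nearly_open_point P act x" "H = stabilizer act x" using stab[OF H] by blast
    show ?thesis using samuel_isomorphism[OF assms x(1)] unfolding x(2) flow_iso_def by blast
  qed
  have compl: "metrizable_space P \<and> flow_iso UNIV P act (coset_completion H) coset_completion_action"
    if H: "presyndetic H" "co_precompact H" "maximal_strongly_amenable H" for H
  proof -
    obtain x where x: "nearly_open_point P act x" "H = stabilizer act x" using stab[OF H(1,3)] by blast
    have pc: "orbit_precompact P act x"
      using co_precompact_imp_orbit_precompact[OF assms x(1)] H(2) x(2) by blast
    show ?thesis
      using orbit_precompact_imp_metrizable[OF assms x(1) pc] completion_isomorphism[OF assms x(1) pc]
      unfolding x(2) flow_iso_def by blast
  qed
  have met: "\<exists>H :: 'g set. presyndetic H \<and> co_precompact H \<and> maximal_strongly_amenable H"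
    if P: "metrizable_space P"
  proof -
    obtain x where x: "nearly_open_point P act x" using metrizable_nearly_open_point[OF assms P] by blast
    have "co_precompact (stabilizer act x)"
      using orbit_precompact_imp_co_precompact[OF assms x metrizable_imp_orbit_precompact[OF assms x P]] .
    then show ?thesis using good[OF x] by blast
  qed
  show ?thesis
  proof (intro conjI allI impI)
    show "has_comeager_orbit P act \<longleftrightarrow> (\<exists>H :: 'g set. presyndetic H \<and> maximal_strongly_amenable H)"
      unfolding comeager using stab good by blast
    show "metrizable_space P \<longleftrightarrow> (\<exists>H :: 'g set. presyndetic H \<and> co_precompact H \<and> maximal_strongly_amenable H)"
      using met compl by blast
  qed (use samuel compl in blast)+
qed


end
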